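(* Let $J\in\mathbb{N}$ with $J\ge J_0$, $0<\varepsilon\le1$, and $\theta>1$. Let $\mathcal{S}_M^{(\varepsilon)}$ and $\mathcal{R}_{N_J}$ be the sampling space and the boundary wavelet reconstruction space defined in the context. Then $$\inf_{\substack{\varphi\in\mathcal{R}_{N_J}\\ \|\varphi\|=1}}\|P_{\mathcal{S}_M^{(\varepsilon)}}\varphi\|\ge\frac1\theta$$ for $M=(\lceil S^\theta/\varepsilon\rceil2^J,\lceil S^\theta/\varepsilon\rceil2^J)\in\mathbb{N}\times\mathbb{N}$, where $S^\theta$ is a constant independent of $J$. In particular, the stable sampling rate obeys $\Theta(N_J,\theta)=\mathcal{O}(N_J)$ as $N_J\to\infty$ for every fixed $\theta>1$.
   Context: 1D boundary wavelets (Cohen--Daubechies--Vial construction). Let $\phi$ be a compactly supported Daubechies scaling function with $p$ vanishing moments, shifted so that $\mathrm{supp}\,\phi=[-p+1,p]$, and let $\psi$ be the corresponding wavelet with $p$ vanishing moments and $\mathrm{supp}\,\psi=[-p+1,p]$. (In particular $|\widehat\phi(\xi)|\lesssim\frac1{1+|\xi|}$ as $|\xi|\to\infty$.) Define edge functions on $[0,\infty)$ by $\widetilde\phi^k(x)=\sum_{n=0}^{2p-2}\binom nk\phi(x+n-p+1)$, $k=0,\dots,p-1$; applying Gram--Schmidt to them gives the left boundary functions $\phi^{\mathrm{left}}_k$, $k=0,\dots,p-1$. The right boundary functions $\phi^{\mathrm{right}}_k$, supported on $(-\infty,0]$, are obtained by reflection: the same construction is applied to the reflected scaling function $\phi(1-\cdot)$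 on $[0,\infty)$ and the result is reflected by $x\mapsto-x$. For $2^j\ge2p$ define on $[0,1]$ - $\phi^{b}_{j,n}=2^{j/2}\phi(2^j\cdot-n)$ for $p\le n<2^j-p$, - $\phi^{b}_{j,n}=2^{j/2}\phi^{\mathrm{left}}_n(2^j\cdot)$ for $0\le n<p$, - $\phi^{b}_{j,n}=2^{j/2}\phi^{\mathrm{right}}_{2^j-1-n}(2^j(\cdot-1))$ for $2^j-p\le n<2^j$. It is known that $\{\phi^b_{j,n}\}_{n=0}^{2^j-1}$ is an orthonormal basis of a space $V^b_j\subset L^2[0,1]$ with $V_j^b\subset V_{j+1}^b$ and dense union. $W_j^b$ is the orthogonal complement of $V_j^b$ in $V_{j+1}^b$, and $\{\psi^b_{j,n}\}_{n=0}^{2^j-1}$ is the Cohen--Daubechies--Vial orthonormal basis of $W_j^b$, consisting of the interior wavelets $2^{j/2}\psi(2^j\cdot-n)$, $p\le n<2^j-p$, and $p$ left and $p$ right boundary wavelets. Reconstruction space. Let $J_0$ be the smallest number with $2^{J_0}\ge2p$. Put $\phi^b_{J_0,(n_1,n_2)}=\phi^b_{J_0,n_1}\otimes\phi^b_{J_0,n_2}$ for $0\le n_1,n_2\le2^{J_0}-1$, and for $j\ge J_0$, $0\le n_1,n_2\le2^j-1$, let $\psi^{b,1}_{j,(n_1,n_2)}=\phi^b_{j,n_1}\otimes\psi^b_{j,n_2}$, $\psi^{b,2}_{j,(n_1,n_2)}=\psi^b_{j,n_1}\otimes\phi^b_{j,n_2}$, $\psi^{b,3}_{j,(n_1,n_2)}=\psi^b_{j,n_1}\otimes\psi^b_{j,n_2}$.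 Then $N_J=2^{2J}$ and $\mathcal{R}_{N_J}$ is the span of all $\phi^b_{J_0,(n_1,n_2)}$, $0\le n_1,n_2\le2^{J_0}-1$, and all $\psi^{b,k}_{j,(n_1,n_2)}$, $j=J_0,\dots,J-1$, $0\le n_1,n_2\le2^j-1$, $k=1,2,3$. Sampling space. $s_l^{(\varepsilon)}=\varepsilon e^{2\pi i\varepsilon\langle l,\cdot\rangle}\chi_{[0,1]^2}$, $l\in\mathbb{Z}^2$, and for $M=(M_1,M_2)\in\mathbb{N}\times\mathbb{N}$, $\mathcal{S}_M^{(\varepsilon)}=\mathrm{span}\{s_l^{(\varepsilon)}:l=(l_1,l_2)\in\mathbb{Z}^2,\ -M_i\le l_i\le M_i,\ i=1,2\}$. $P_U$ denotes the orthogonal projection onto a closed subspace $U$. Stable sampling rate. $\Theta(N,\theta)$, $\theta>1$, is the smallest number of samples (here the total number of sampling vectors $s_l^{(\varepsilon)}$ spanning $\mathcal{S}_M^{(\varepsilon)}$) for which the reconstruction constant of generalized sampling, which equals $1/\cos(\omega(\mathcal{R}_N,\mathcal{S}_M^{(\varepsilon)}))$ with $\cos(\omega(U,V))=\inf_{u\in U,\|u\|=1}\|P_Vu\|$, is less than $\theta$. *)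

theory Defs
  imports "HOL-Analysis.Analysis" "HOL-Library.Landau_Symbols" "HOL-Library.Extended_Nat"
begin

section \<open>The spaces \<open>L\<^sup>2(\<real>)\<close> and \<open>L\<^sup>2(\<real>\<^sup>2)\<close>\<close>

text \<open>
  Elements of \<open>L\<^sup>2\<close> are represented by functions. All subspaces below are closed under
  modification on null sets, so that equality of subspaces is equality of sets.
  Functions on \<open>[0,1]\<close> or \<open>[0,1]\<^sup>2\<close> are extended by \<open>0\<close>.
\<close>

definition L2_fun :: "('a::euclidean_space \<Rightarrow> complex) set" where
  "L2_fun = {f \<in> borel_measurable borel. integrable lborel (\<lambda>x. (norm (f x))\<^sup>2)}"

definition L2_inner :: "('a::euclidean_space \<Rightarrow> complex) \<Rightarrow> ('a \<Rightarrow> complex) \<Rightarrow> complex" where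
  "L2_inner f g = (LINT x|lborel. f x * cnj (g x))"

definition L2_nrm :: "('a::euclidean_space \<Rightarrow> complex) \<Rightarrow> real" where
  "L2_nrm f = sqrt (LINT x|lborel. (norm (f x))\<^sup>2)"

definition L2_span :: "('a::euclidean_space \<Rightarrow> complex) set \<Rightarrow> ('a \<Rightarrow> complex) set" where
  "L2_span B = {f \<in> L2_fun. \<exists>T c. finite T \<and> T \<subseteq> B \<and>
     (AE x in lborel. f x = (\<Sum>b\<in>T. c b * b x))}"

definition L2_orthonormal :: "'i set \<Rightarrow> ('i \<Rightarrow> 'a::euclidean_space \<Rightarrow> complex) \<Rightarrow> bool" where
  "L2_orthonormal I F \<longleftrightarrow> (\<forall>i\<in>I. F i \<in> L2_fun) \<and>
     (\<forall>i\<in>I. \<forall>k\<in>I. L2_inner (F i) (F k) = (if i = k then 1 else 0))"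

text \<open>
  A representative of the orthogonal projection of \<open>f\<close> onto \<open>U\<close>; it is unique up to null sets,
  and exists for every \<open>f\<close> in \<open>L\<^sup>2\<close> if \<open>U\<close> is a closed subspace.
\<close>

definition orth_proj ::
  "('a::euclidean_space \<Rightarrow> complex) set \<Rightarrow> ('a \<Rightarrow> complex) \<Rightarrow> ('a \<Rightarrow> complex)" where
  "orth_proj U f = (SOME g. g \<in> U \<and> (\<forall>u\<in>U. L2_inner (\<lambda>x. f x - g x) u = 0))"

definition cos_angle ::
  "('a::euclidean_space \<Rightarrow> complex) set \<Rightarrow> ('a \<Rightarrow> complex) set \<Rightarrow> real" where
  "cos_angle U V = (INF u \<in> {u \<in> U. L2_nrm u = 1}. L2_nrm (orth_proj V u))"

function gram_schmidt :: "(nat \<Rightarrow> real \<Rightarrow> complex) \<Rightarrow> nat \<Rightarrow> real \<Rightarrow> complex" where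
  "gram_schmidt f k =
     (let r = (\<lambda>x. f k x - (\<Sum>i<k. L2_inner (f k) (gram_schmidt f i) * gram_schmidt f i x))
      in (\<lambda>x. r x / complex_of_real (L2_nrm r)))"
  by pat_completeness auto
termination
  by (relation "Wellfounded.measure snd") auto

declare gram_schmidt.simps [simp del]


section \<open>Daubechies scaling functions and wavelets\<close>

text \<open>
  The support of an \<open>L\<^sup>2\<close> function: the complement of the largest open set on which it vanishes
  almost everywhere.
\<close>

definition ess_support :: "(real \<Rightarrow> real) \<Rightarrow> real set" where
  "ess_support f = {x. \<forall>e>0. \<not> (AE y in lborel. y \<in> ball x e \<longrightarrow> f y = 0)}"

text \<open>
  \<open>\<phi>\<close> is an orthonormal scaling function with real refinement filter \<open>h\<close>, \<open>\<psi>\<close> is the wavelet with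
  the conjugate mirror filter \<open>(-1)\<^sup>k h (1 - k)\<close>, \<open>\<psi>\<close> has \<open>p\<close> vanishing moments, and
  the supports have the length \<open>2 p - 1\<close>, which is minimal for \<open>p\<close> vanishing moments and thus
  characterises the Daubechies family. The normalisation \<open>\<integral> \<phi> = 1\<close> makes \<open>\<phi>\<close> generate a
  multiresolution analysis of the whole of \<open>L\<^sup>2(\<real>)\<close>.
\<close>

definition daubechies_pair :: "nat \<Rightarrow> (real \<Rightarrow> real) \<Rightarrow> (real \<Rightarrow> real) \<Rightarrow> bool" where
  "daubechies_pair p \<phi> \<psi> \<longleftrightarrow>
     p \<ge> 1 \<and>
     \<phi> \<in> borel_measurable borel \<and> integrable lborel (\<lambda>x. (\<phi> x)\<^sup>2) \<and>
     \<psi> \<in> borel_measurable borel \<and> integrable lborel (\<lambda>x. (\<psi> x)\<^sup>2) \<and>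
     ess_support \<phi> = {1 - real p..real p} \<and>
     ess_support \<psi> = {1 - real p..real p} \<and>
     (LINT x|lborel. \<phi> x) = 1 \<and>
     (\<forall>n::int. (LINT x|lborel. \<phi> x * \<phi> (x - of_int n)) = (if n = 0 then 1 else 0)) \<and>
     (\<exists>h::int \<Rightarrow> real. (\<forall>k. k \<notin> {1 - int p..int p} \<longrightarrow> h k = 0) \<and>
        (AE x in lborel. \<phi> x =
           sqrt 2 * (\<Sum>k\<in>{1 - int p..int p}. h k * \<phi> (2 * x - of_int k))) \<and>
        (AE x in lborel. \<psi> x =
           sqrt 2 * (\<Sum>k\<in>{1 - int p..int p}. (-1) powi k * h (1 - k) * \<phi> (2 * x - of_int k)))) \<and>
     (\<forall>m<p. (LINT x|lborel. x ^ m * \<psi> x) = 0)"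


section \<open>Boundary scaling functions and boundary wavelets on the unit interval\<close>

definition edge_fun :: "nat \<Rightarrow> (real \<Rightarrow> real) \<Rightarrow> nat \<Rightarrow> real \<Rightarrow> complex" where
  "edge_fun p \<phi> k x = (if x \<ge> 0
     then complex_of_real (\<Sum>n=0..2*p-2. real (n choose k) * \<phi> (x + real n - real p + 1)) else 0)"

definition phi_left :: "nat \<Rightarrow> (real \<Rightarrow> real) \<Rightarrow> nat \<Rightarrow> real \<Rightarrow> complex" where
  "phi_left p \<phi> = gram_schmidt (edge_fun p \<phi>)"

definition phi_right :: "nat \<Rightarrow> (real \<Rightarrow> real) \<Rightarrow> nat \<Rightarrow> real \<Rightarrow> complex" where
  "phi_right p \<phi> k x = phi_left p (\<lambda>y. \<phi> (1 - y)) k (- x)"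

text \<open>
  The system on \<open>[0,1]\<close> at scale \<open>j\<close>, \<open>2 p \<le> 2\<^sup>j\<close>, made of the dilates of \<open>p\<close> left functions \<open>L\<close>, of
  \<open>p\<close> right functions \<open>R\<close> and of the interior translates of \<open>f\<close>.
\<close>

definition interval_system ::
  "nat \<Rightarrow> (real \<Rightarrow> real) \<Rightarrow> (nat \<Rightarrow> real \<Rightarrow> complex) \<Rightarrow> (nat \<Rightarrow> real \<Rightarrow> complex) \<Rightarrow>
   nat \<Rightarrow> nat \<Rightarrow> real \<Rightarrow> complex" where
  "interval_system p f L R j n x =
     (if x \<in> {0..1} then
        complex_of_real (2 powr (real j / 2)) *
        (if n < p then L n (2 ^ j * x)
         else if n < 2 ^ j - p then complex_of_real (f (2 ^ j * x - real n))
         else R (2 ^ j - 1 - n) (2 ^ j * (x - 1)))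
      else 0)"

definition phi_b :: "nat \<Rightarrow> (real \<Rightarrow> real) \<Rightarrow> nat \<Rightarrow> nat \<Rightarrow> real \<Rightarrow> complex" where
  "phi_b p \<phi> = interval_system p \<phi> (phi_left p \<phi>) (phi_right p \<phi>)"

definition V_b :: "nat \<Rightarrow> (real \<Rightarrow> real) \<Rightarrow> nat \<Rightarrow> (real \<Rightarrow> complex) set" where
  "V_b p \<phi> j = L2_span (phi_b p \<phi> j ` {..<2 ^ j})"

definition W_b :: "nat \<Rightarrow> (real \<Rightarrow> real) \<Rightarrow> nat \<Rightarrow> (real \<Rightarrow> complex) set" where
  "W_b p \<phi> j = {f \<in> V_b p \<phi> (j + 1). \<forall>g\<in>V_b p \<phi> j. L2_inner f g = 0}"

definition J_0 :: "nat \<Rightarrow> nat" where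
  "J_0 p = (LEAST j. 2 * p \<le> 2 ^ j)"

text \<open>
  The boundary wavelets \<open>\<psi>l\<close>, \<open>\<psi>r\<close> are only determined up to the choice of an orthonormal basis;
  what is required of them is that their dilates complete the interior wavelets to an orthonormal basis of \<open>W_b\<close> at every scale.
\<close>

definition cdv_wavelets ::
  "nat \<Rightarrow> (real \<Rightarrow> real) \<Rightarrow> (real \<Rightarrow> real) \<Rightarrow>
   (nat \<Rightarrow> real \<Rightarrow> complex) \<Rightarrow> (nat \<Rightarrow> real \<Rightarrow> complex) \<Rightarrow> bool" where
  "cdv_wavelets p \<phi> \<psi> \<psi>l \<psi>r \<longleftrightarrow>
     (\<forall>j\<ge>J_0 p. L2_orthonormal {..<2 ^ j} (interval_system p \<psi> \<psi>l \<psi>r j) \<and>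
                L2_span (interval_system p \<psi> \<psi>l \<psi>r j ` {..<2 ^ j}) = W_b p \<phi> j)"


section \<open>Reconstruction and sampling spaces\<close>

definition tensor :: "(real \<Rightarrow> complex) \<Rightarrow> (real \<Rightarrow> complex) \<Rightarrow> real \<times> real \<Rightarrow> complex"
    (infixr "\<otimes>\<^sub>f" 70) where
  "(f \<otimes>\<^sub>f g) x = f (fst x) * g (snd x)"

definition psi_b2 ::
  "(nat \<Rightarrow> nat \<Rightarrow> real \<Rightarrow> complex) \<Rightarrow> (nat \<Rightarrow> nat \<Rightarrow> real \<Rightarrow> complex) \<Rightarrow>
   nat \<Rightarrow> nat \<Rightarrow> nat \<Rightarrow> nat \<Rightarrow> real \<times> real \<Rightarrow> complex" where
  "psi_b2 \<Phi> \<Psi> k j n1 n2 =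
     (if k = 1 then \<Phi> j n1 \<otimes>\<^sub>f \<Psi> j n2
      else if k = 2 then \<Psi> j n1 \<otimes>\<^sub>f \<Phi> j n2
      else \<Psi> j n1 \<otimes>\<^sub>f \<Psi> j n2)"

definition recon_space ::
  "nat \<Rightarrow> (real \<Rightarrow> real) \<Rightarrow> (real \<Rightarrow> real) \<Rightarrow>
   (nat \<Rightarrow> real \<Rightarrow> complex) \<Rightarrow> (nat \<Rightarrow> real \<Rightarrow> complex) \<Rightarrow> nat \<Rightarrow> (real \<times> real \<Rightarrow> complex) set" where
  "recon_space p \<phi> \<psi> \<psi>l \<psi>r J =
     (let \<Phi> = phi_b p \<phi>; \<Psi> = interval_system p \<psi> \<psi>l \<psi>r; J0 = J_0 p in
      L2_span
        ({\<Phi> J0 n1 \<otimes>\<^sub>f \<Phi> J0 n2 | n1 n2. n1 < 2 ^ J0 \<and> n2 < 2 ^ J0} \<union>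
         {psi_b2 \<Phi> \<Psi> k j n1 n2 | k j n1 n2.
            k \<in> {1, 2, 3} \<and> J0 \<le> j \<and> j < J \<and> n1 < 2 ^ j \<and> n2 < 2 ^ j}))"

definition recon_dim :: "nat \<Rightarrow> nat" where
  "recon_dim J = 2 ^ (2 * J)"

definition sampling_fun :: "real \<Rightarrow> int \<times> int \<Rightarrow> real \<times> real \<Rightarrow> complex" where
  "sampling_fun \<epsilon> l x =
     (if x \<in> {0..1} \<times> {0..1} then
        complex_of_real \<epsilon> *
        exp (2 * complex_of_real pi * \<i> *
             complex_of_real (\<epsilon> * (of_int (fst l) * fst x + of_int (snd l) * snd x)))
      else 0)"

definition sampling_index :: "nat \<times> nat \<Rightarrow> (int \<times> int) set" where
  "sampling_index M = {- int (fst M)..int (fst M)} \<times> {- int (snd M)..int (snd M)}"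

definition sampling_space :: "real \<Rightarrow> nat \<times> nat \<Rightarrow> (real \<times> real \<Rightarrow> complex) set" where
  "sampling_space \<epsilon> M = L2_span (sampling_fun \<epsilon> ` sampling_index M)"

text \<open>The values are extended so that the constant is \<open>\<infinity>\<close> if the cosine vanishes.\<close>

definition recon_constant ::
  "('a::euclidean_space \<Rightarrow> complex) set \<Rightarrow> ('a \<Rightarrow> complex) set \<Rightarrow> ennreal" where
  "recon_constant U V = 1 / ennreal (cos_angle U V)"

text \<open>The value is \<open>\<infinity>\<close> if no number of samples suffices; otherwise the infimum is a minimum.\<close>

definition stable_sampling_rate ::
  "real \<Rightarrow> (real \<times> real \<Rightarrow> complex) set \<Rightarrow> real \<Rightarrow> enat" where
  "stable_sampling_rate \<epsilon> U \<theta> =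
     (INF M \<in> {M. recon_constant U (sampling_space \<epsilon> M) < ennreal \<theta>}. enat (card (sampling_index M)))"

end

theory Submission
  imports Defs "HOL-Computational_Algebra.Polynomial"
begin

text \<open>
  The vanishing moments of \<open>\<psi>\<close> turn into sum rules of the filter, which show that the edge functions
  are refinable; hence \<open>V\<^sub>j \<subseteq> V\<^sub>J\<close> for \<open>j \<le> J\<close>, and every element of the reconstruction space is a
  combination of the orthonormal functions \<open>\<phi>\<^sub>J\<^sub>,\<^sub>n \<otimes> \<phi>\<^sub>J\<^sub>,\<^sub>m\<close> at the finest scale. These are dilates of
  finitely many \<open>L\<^sup>2\<close> functions with bounded overlap, so translation by \<open>t\<close> moves a unit vector of \<open>V\<^sub>J\<close>
  by an amount that is small as soon as \<open>2\<^sup>J t\<close> is small, uniformly in \<open>J\<close>. Consequently the Fejer mean of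
  degree \<open>M\<close> with period \<open>1 / \<epsilon>\<close> is close to the identity on \<open>V\<^sub>J\<close> once \<open>\<epsilon> M \<ge> S 2\<^sup>J\<close>. Applied in both
  variables it yields an element of the sampling space close to a given unit vector \<open>u\<close> of the
  reconstruction space, and this bounds the projection of \<open>u\<close> from below.
\<close>

section \<open>The space \<open>L\<^sup>2\<close>\<close>

text \<open>In each variable the sampling exponentials are orthogonal over a length
  \<open>1 / \<epsilon>\<close>, in general not on [0,1]. Hence the projection is not computed but
  compared with one explicit element: for every \<open>q\<close> in the space, the squared norm of
  the projection of \<open>u\<close> is at least that of \<open>u\<close> minus that of
  \<open>u - q\<close>. The Fejer mean suits as \<open>q\<close> because its kernel is a probability
  density on one period, so that its error is an average of translation errors. The kernel has mass
  of order \<open>1 / (\<epsilon> * M * d)\<close> beyond \<open>d\<close>; with \<open>d\<close>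
  proportional to \<open>1 / 2 ^ J\<close> and \<open>M\<close> to \<open>2 ^ J\<close> the scale
  cancels, which makes \<open>S\<close> independent of \<open>J\<close>.

  The Gram-Schmidt functions are shown to be orthogonal and each either of norm 1 or zero. Upper
  bounds use Bessel's inequality; where norms must be exact the zero functions are discarded.

  In two variables the error splits into two tensor sums with one small factor each, bounded by
  \<open>\<delta>\<close> and \<open>4 * \<delta>\<close>; this gives \<open>10 * \<delta>\<close>
  and the choice \<open>\<delta> = (1 - 1 / \<theta>\<^sup>2) / 10\<close>.\<close>

lemma borel_measurable_cnj [measurable]:
  "f \<in> borel_measurable M \<Longrightarrow> (\<lambda>x. cnj (f x)) \<in> borel_measurable M"
  by (rule borel_measurable_continuous_on[where f=cnj]) (auto intro: continuous_intros)

lemma L2_fun_measurable [measurable_dest]: "f \<in> L2_fun \<Longrightarrow> f \<in> borel_measurable borel"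
  by (simp add: L2_fun_def)

lemma L2_funD: "f \<in> L2_fun \<Longrightarrow> integrable lborel (\<lambda>x. (norm (f x))\<^sup>2)"
  by (simp add: L2_fun_def)

lemma L2_funI:
  assumes "f \<in> borel_measurable borel" "integrable lborel g" "AE x in lborel. (norm (f x))\<^sup>2 \<le> g x"
  shows "f \<in> L2_fun"
  unfolding L2_fun_def using assms
  by (auto intro!: Bochner_Integration.integrable_bound[OF assms(2)])

lemma L2_fun_cong_AE:
  assumes "f \<in> L2_fun" "g \<in> borel_measurable borel" "AE x in lborel. f x = g x"
  shows "g \<in> L2_fun"
  by (rule L2_funI[OF assms(2) L2_funD[OF assms(1)]]) (use assms(3) in auto)

lemma L2_fun_0 [simp]: "(\<lambda>x. 0) \<in> L2_fun"
  by (simp add: L2_fun_def)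

lemma norm_add_sq_le: "(norm (a + b))\<^sup>2 \<le> 2 * (norm a)\<^sup>2 + 2 * (norm (b::'a::real_normed_vector))\<^sup>2"
proof -
  have "(norm (a + b))\<^sup>2 \<le> (norm a + norm b)\<^sup>2"
    by (intro power_mono norm_triangle_ineq) auto
  also have "\<dots> \<le> 2 * (norm a)\<^sup>2 + 2 * (norm b)\<^sup>2"
    using zero_le_power2[of "norm a - norm b"] by (simp add: power2_eq_square algebra_simps)
  finally show ?thesis .
qed

lemma L2_fun_add:
  assumes "f \<in> L2_fun" "g \<in> L2_fun" shows "(\<lambda>x. f x + g x) \<in> L2_fun"
  by (rule L2_funI[where g="\<lambda>x. 2 * (norm (f x))\<^sup>2 + 2 * (norm (g x))\<^sup>2"])
     (use assms in \<open>auto intro!: norm_add_sq_le L2_funD L2_fun_measurable borel_measurable_add\<close>)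

lemma L2_fun_mult: 
  assumes "f \<in> L2_fun" shows "(\<lambda>x. c * f x) \<in> L2_fun"
  by (rule L2_funI[where g="\<lambda>x. (norm c)\<^sup>2 * (norm (f x))\<^sup>2"])
     (use assms in \<open>auto intro!: L2_funD L2_fun_measurable borel_measurable_times simp: norm_mult power_mult_distrib\<close>)

lemma L2_fun_diff:
  assumes "f \<in> L2_fun" "g \<in> L2_fun" shows "(\<lambda>x. f x - g x) \<in> L2_fun"
  using L2_fun_add[OF assms(1) L2_fun_mult[OF assms(2), of "-1"]] by simp

lemma L2_fun_sum:
  "(\<And>i. i \<in> I \<Longrightarrow> F i \<in> L2_fun) \<Longrightarrow> (\<lambda>x. \<Sum>i\<in>I. F i x) \<in> L2_fun"
  by (induction I rule: infinite_finite_induct) (auto intro: L2_fun_add)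

lemma L2_fun_lincomb:
  "(\<And>i. i \<in> I \<Longrightarrow> F i \<in> L2_fun) \<Longrightarrow> (\<lambda>x. \<Sum>i\<in>I. c i * F i x) \<in> L2_fun"
  by (intro L2_fun_sum L2_fun_mult)

lemma L2_inner_integrable:
  assumes "f \<in> L2_fun" "g \<in> L2_fun" shows "integrable lborel (\<lambda>x. f x * cnj (g x))"
proof (rule Bochner_Integration.integrable_bound[where f="\<lambda>x. (norm (f x))\<^sup>2 + (norm (g x))\<^sup>2"])
  show "integrable lborel (\<lambda>x. (norm (f x))\<^sup>2 + (norm (g x))\<^sup>2)"
    using assms by (intro Bochner_Integration.integrable_add L2_funD)
  have "norm (f x * cnj (g x)) \<le> norm ((norm (f x))\<^sup>2 + (norm (g x))\<^sup>2)" for x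
  proof -
    have "2 * (norm (f x) * norm (g x)) \<le> (norm (f x))\<^sup>2 + (norm (g x))\<^sup>2"
      using zero_le_power2[of "norm (f x) - norm (g x)"] by (simp add: power2_eq_square algebra_simps)
    moreover have "0 \<le> norm (f x) * norm (g x)" by simp
    ultimately have "norm (f x) * norm (g x) \<le> (norm (f x))\<^sup>2 + (norm (g x))\<^sup>2" by linarith
    then show ?thesis by (simp add: norm_mult)
  qed
  then show "AE x in lborel. norm (f x * cnj (g x)) \<le> norm ((norm (f x))\<^sup>2 + (norm (g x))\<^sup>2)" by simp
  have [measurable]: "f \<in> borel_measurable borel" "g \<in> borel_measurable borel"
    using assms by (auto dest: L2_fun_measurable)
  show "(\<lambda>x. f x * cnj (g x)) \<in> borel_measurable lborel" by measurable
qed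

lemma L2_inner_add_left:
  assumes "f \<in> L2_fun" "g \<in> L2_fun" "h \<in> L2_fun"
  shows "L2_inner (\<lambda>x. f x + g x) h = L2_inner f h + L2_inner g h"
  unfolding L2_inner_def distrib_right
  by (intro Bochner_Integration.integral_add L2_inner_integrable assms)

lemma L2_inner_mult_left: "L2_inner (\<lambda>x. c * f x) h = c * L2_inner f h"
  unfolding L2_inner_def by (simp add: mult.assoc)

lemma L2_inner_diff_left:
  assumes "f \<in> L2_fun" "g \<in> L2_fun" "h \<in> L2_fun"
  shows "L2_inner (\<lambda>x. f x - g x) h = L2_inner f h - L2_inner g h"
  unfolding L2_inner_def left_diff_distrib
  by (intro Bochner_Integration.integral_diff L2_inner_integrable assms)

lemma L2_inner_sum_left:
  assumes "\<And>i. i \<in> I \<Longrightarrow> F i \<in> L2_fun" "h \<in> L2_fun"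
  shows "L2_inner (\<lambda>x. \<Sum>i\<in>I. c i * F i x) h = (\<Sum>i\<in>I. c i * L2_inner (F i) h)"
proof -
  have "L2_inner (\<lambda>x. \<Sum>i\<in>I. c i * F i x) h = (LINT x|lborel. (\<Sum>i\<in>I. c i * (F i x * cnj (h x))))"
    unfolding L2_inner_def sum_distrib_right mult.assoc ..
  also have "\<dots> = (\<Sum>i\<in>I. LINT x|lborel. c i * (F i x * cnj (h x)))"
    by (intro Bochner_Integration.integral_sum integrable_mult_right L2_inner_integrable assms)
  finally show ?thesis by (simp add: L2_inner_def)
qed

lemma L2_inner_cnj: "cnj (L2_inner f g) = L2_inner g f"
proof -
  have "cnj (L2_inner f g) = (LINT x|lborel. cnj (f x * cnj (g x)))"
    unfolding L2_inner_def by (rule Bochner_Integration.integral_cnj[symmetric])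
  then show ?thesis by (simp add: L2_inner_def mult.commute)
qed

lemma L2_inner_eq_0_commute: "L2_inner f g = 0 \<longleftrightarrow> L2_inner g f = 0"
  by (metis L2_inner_cnj complex_cnj_zero_iff)

lemma L2_inner_sum_right:
  assumes "\<And>i. i \<in> I \<Longrightarrow> F i \<in> L2_fun" "h \<in> L2_fun"
  shows "L2_inner h (\<lambda>x. \<Sum>i\<in>I. c i * F i x) = (\<Sum>i\<in>I. cnj (c i) * L2_inner h (F i))"
  using arg_cong[OF L2_inner_sum_left[OF assms, of I "\<lambda>i. i" c], of cnj]
  by (simp add: L2_inner_cnj)

lemma L2_inner_cong_AE:
  assumes "AE x in lborel. f x = f' x" "AE x in lborel. g x = g' x"
    "f \<in> borel_measurable borel" "f' \<in> borel_measurable borel"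
    "g \<in> borel_measurable borel" "g' \<in> borel_measurable borel"
  shows "L2_inner f g = L2_inner f' g'"
proof -
  note [measurable] = assms(3-6)
  show ?thesis unfolding L2_inner_def
    by (intro integral_cong_AE) (measurable, use assms(1,2) in auto)
qed

lemma L2_nrm_nonneg [simp]: "0 \<le> L2_nrm f"
  by (simp add: L2_nrm_def)

lemma L2_nrm_sq: "(L2_nrm f)\<^sup>2 = (LINT x|lborel. (norm (f x))\<^sup>2)"
  by (simp add: L2_nrm_def)

lemma L2_inner_self: "L2_inner f f = complex_of_real ((L2_nrm f)\<^sup>2)"
  unfolding L2_nrm_sq L2_inner_def
  by (simp add: complex_norm_square[symmetric] flip: of_real_power)

lemma L2_nrm_cong_AE:
  assumes "AE x in lborel. f x = g x" "f \<in> borel_measurable borel" "g \<in> borel_measurable borel"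
  shows "L2_nrm f = L2_nrm g"
proof -
  note [measurable] = assms(2,3)
  show ?thesis unfolding L2_nrm_def
    by (intro arg_cong[where f=sqrt] integral_cong_AE) (measurable, use assms(1) in auto)
qed

text \<open>The squared norm with values in \<open>ennreal\<close>: it is defined for every
  measurable function, so that monotonicity and Tonelli apply without integrability side
  conditions.\<close>

abbreviation energy :: "('a::euclidean_space \<Rightarrow> complex) \<Rightarrow> ennreal" where
  "energy f \<equiv> \<integral>\<^sup>+x. ennreal ((norm (f x))\<^sup>2) \<partial>lborel"

lemma L2_nrm_sq_nn:
  assumes "f \<in> L2_fun"
  shows "ennreal ((L2_nrm f)\<^sup>2) = energy f"
  unfolding L2_nrm_sq by (intro nn_integral_eq_integral[symmetric] L2_funD assms) auto

lemma L2_nrm_eq_0_AE: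
  assumes "f \<in> L2_fun" "L2_nrm f = 0" shows "AE x in lborel. f x = 0"
proof -
  have [measurable]: "f \<in> borel_measurable borel" using assms by (simp add: L2_fun_measurable)
  have "energy f = 0"
    using L2_nrm_sq_nn[OF assms(1)] assms(2) by simp
  then show ?thesis by (subst (asm) nn_integral_0_iff_AE) auto
qed

lemma L2_inner_0_right_if_nrm_0:
  assumes "f \<in> L2_fun" "g \<in> L2_fun" "L2_nrm g = 0" shows "L2_inner f g = 0"
proof -
  have "L2_inner f g = L2_inner f (\<lambda>x. 0)"
    using assms by (intro L2_inner_cong_AE) (auto intro: L2_nrm_eq_0_AE L2_fun_measurable)
  then show ?thesis by (simp add: L2_inner_def)
qed

lemma L2_pythagoras:
  assumes "f \<in> L2_fun" "g \<in> L2_fun" "L2_inner f g = 0"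
  shows "(L2_nrm (\<lambda>x. f x + g x))\<^sup>2 = (L2_nrm f)\<^sup>2 + (L2_nrm g)\<^sup>2"
proof -
  have gf: "L2_inner g f = 0" using assms(3) by (simp add: L2_inner_eq_0_commute)
  have "L2_inner (\<lambda>x. f x + g x) (\<lambda>x. f x + g x) =
    L2_inner f (\<lambda>x. f x + g x) + L2_inner g (\<lambda>x. f x + g x)"
    by (intro L2_inner_add_left assms L2_fun_add)
  also have "L2_inner f (\<lambda>x. f x + g x) = cnj (L2_inner f f + L2_inner g f)"
    by (subst L2_inner_cnj[symmetric], subst L2_inner_add_left) (use assms in auto)
  also have "L2_inner g (\<lambda>x. f x + g x) = cnj (L2_inner f g + L2_inner g g)"
    by (subst L2_inner_cnj[symmetric], subst L2_inner_add_left) (use assms in auto)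
  finally have "complex_of_real ((L2_nrm (\<lambda>x. f x + g x))\<^sup>2) =
      complex_of_real ((L2_nrm f)\<^sup>2 + (L2_nrm g)\<^sup>2)"
    unfolding L2_inner_self using gf assms(3) by (simp add: L2_inner_self)
  then show ?thesis using of_real_eq_iff by blast
qed

lemma L2_nrm_orthogonal_sum:
  assumes "finite I" "\<And>i. i \<in> I \<Longrightarrow> F i \<in> L2_fun"
    "\<And>i k. i \<in> I \<Longrightarrow> k \<in> I \<Longrightarrow> i \<noteq> k \<Longrightarrow> L2_inner (F i) (F k) = 0"
  shows "(L2_nrm (\<lambda>x. \<Sum>i\<in>I. c i * F i x))\<^sup>2 = (\<Sum>i\<in>I. (norm (c i))\<^sup>2 * (L2_nrm (F i))\<^sup>2)"
proof -
  let ?s = "\<lambda>x. \<Sum>i\<in>I. c i * F i x"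
  have "L2_inner ?s ?s = (\<Sum>i\<in>I. c i * L2_inner (F i) ?s)"
    by (intro L2_inner_sum_left L2_fun_lincomb assms)
  also have "\<dots> = (\<Sum>i\<in>I. c i * (\<Sum>k\<in>I. cnj (c k) * L2_inner (F i) (F k)))"
    by (intro sum.cong refl arg_cong2[where f="(*)"] L2_inner_sum_right assms)
  also have "\<dots> = (\<Sum>i\<in>I. c i * (\<Sum>k\<in>I. if k = i then cnj (c i) * L2_inner (F i) (F i) else 0))"
    by (intro sum.cong refl arg_cong2[where f="(*)"]) (use assms(3) in auto)
  also have "\<dots> = (\<Sum>i\<in>I. complex_of_real ((norm (c i))\<^sup>2 * (L2_nrm (F i))\<^sup>2))"
    using assms(1) by (intro sum.cong refl) (simp add: L2_inner_self complex_norm_square mult.assoc flip: of_real_power)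
  finally have "complex_of_real ((L2_nrm ?s)\<^sup>2) = complex_of_real (\<Sum>i\<in>I. (norm (c i))\<^sup>2 * (L2_nrm (F i))\<^sup>2)"
    unfolding L2_inner_self by simp
  then show ?thesis using of_real_eq_iff by blast
qed

section \<open>Finite spans and the orthogonal projections onto them\<close>

lemma L2_span_subset_L2_fun: "L2_span B \<subseteq> L2_fun"
  by (auto simp: L2_span_def)

text \<open>\<open>L2_span\<close> sums over a set of functions, whereas a family may take the same
  value at several indices. The coefficients of equal functions are therefore added up.\<close>

lemma L2_spanI:
  assumes "f \<in> L2_fun" "finite I" "AE x in lborel. f x = (\<Sum>i\<in>I. c i * F i x)"
  shows "f \<in> L2_span (F ` I)"
proof -
  have "(\<Sum>i\<in>I. c i * F i x) = (\<Sum>b\<in>F`I. (\<Sum>i\<in>{i\<in>I. F i = b}. c i) * b x)" for x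
    by (subst sum.image_gen[OF assms(2), of _ F], intro sum.cong refl)
       (auto simp: sum_distrib_right intro!: sum.cong)
  with assms show ?thesis unfolding L2_span_def
    by (auto intro!: exI[of _ "F`I"] exI[of _ "\<lambda>b. \<Sum>i\<in>{i\<in>I. F i = b}. c i"])
qed

text \<open>Conversely, one index is selected for each function that occurs, and all other indices
  get the coefficient 0.\<close>

lemma L2_spanE:
  assumes "f \<in> L2_span (F ` I)" "finite I"
  obtains c where "AE x in lborel. f x = (\<Sum>i\<in>I. c i * F i x)"
proof -
  obtain T c where T: "finite T" "T \<subseteq> F ` I" "AE x in lborel. f x = (\<Sum>b\<in>T. c b * b x)"
    using assms by (auto simp: L2_span_def)
  obtain I' where I': "I' \<subseteq> I" "inj_on F I'" "T = F ` I'"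
    using T(2) by (auto simp: subset_image_inj)
  have "(\<Sum>b\<in>T. c b * b x) = (\<Sum>i\<in>I. (if i \<in> I' then c (F i) else 0) * F i x)" for x
  proof -
    have "(\<Sum>b\<in>T. c b * b x) = (\<Sum>i\<in>I'. c (F i) * F i x)"
      using I' by (simp add: sum.reindex)
    also have "\<dots> = (\<Sum>i\<in>I. (if i \<in> I' then c (F i) else 0) * F i x)"
      by (intro sum.mono_neutral_cong_left assms I') auto
    finally show ?thesis .
  qed
  with T(3) that show ?thesis by auto
qed

lemma L2_orth_lincomb:
  assumes "\<And>i. i \<in> I \<Longrightarrow> F i \<in> L2_fun" "h \<in> L2_fun" "\<And>i. i \<in> I \<Longrightarrow> L2_inner h (F i) = 0"
    "g \<in> borel_measurable borel" "AE x in lborel. g x = (\<Sum>i\<in>I. c i * F i x)"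
  shows "L2_inner h g = 0"
proof -
  have "L2_inner h g = L2_inner h (\<lambda>x. \<Sum>i\<in>I. c i * F i x)"
    using assms L2_fun_lincomb[of I F c]
    by (intro L2_inner_cong_AE) (auto intro: L2_fun_measurable)
  also have "\<dots> = 0" by (subst L2_inner_sum_right) (use assms in auto)
  finally show ?thesis .
qed

text \<open>One Gram-Schmidt step per generator, dependent generators included: once
  \<open>f\<close> and the new \<open>F a\<close> are both reduced modulo the old generators, to
  \<open>g\<close> and \<open>r\<close>, only the component of \<open>g\<close> along
  \<open>r\<close> is left to remove.\<close>

lemma orthogonal_decomposition:
  assumes "finite I" "\<And>i. i \<in> I \<Longrightarrow> F i \<in> L2_fun" "f \<in> L2_fun"
  shows "\<exists>c. \<forall>k\<in>I. L2_inner (\<lambda>x. f x - (\<Sum>i\<in>I. c i * F i x)) (F k) = 0"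
  using assms
proof (induction I arbitrary: f rule: finite_induct)
  case (insert a I)
  have Fa: "F a \<in> L2_fun" and FI: "\<And>i. i \<in> I \<Longrightarrow> F i \<in> L2_fun" using insert by auto
  obtain c where c: "\<forall>k\<in>I. L2_inner (\<lambda>x. f x - (\<Sum>i\<in>I. c i * F i x)) (F k) = 0"
    using insert.IH[of f] FI insert.prems(2) by blast
  obtain d where d: "\<forall>k\<in>I. L2_inner (\<lambda>x. F a x - (\<Sum>i\<in>I. d i * F i x)) (F k) = 0"
    using insert.IH[of "F a"] FI Fa by blast
  define r where "r = (\<lambda>x. F a x - (\<Sum>i\<in>I. d i * F i x))"
  define g where "g = (\<lambda>x. f x - (\<Sum>i\<in>I. c i * F i x))"
  have r: "r \<in> L2_fun" and g: "g \<in> L2_fun"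
    unfolding r_def g_def by (intro L2_fun_diff L2_fun_lincomb FI Fa insert.prems; simp)+
  \<comment> \<open>If \<open>r\<close> has norm 0, every inner product with it is 0, so any
    \<open>t\<close> works; 0 is taken.\<close>
  define t where "t = (if L2_nrm r = 0 then 0 else L2_inner g r / complex_of_real ((L2_nrm r)\<^sup>2))"
  have rr: "L2_inner (\<lambda>x. g x - t * r x) r = 0"
  proof (cases "L2_nrm r = 0")
    case True
    then show ?thesis by (intro L2_inner_0_right_if_nrm_0 L2_fun_diff L2_fun_mult g r)
  next
    case False
    then show ?thesis
      by (subst L2_inner_diff_left[OF g L2_fun_mult[OF r] r]) (use False in \<open>simp add: L2_inner_mult_left[of t] L2_inner_self, simp add: t_def\<close>)
  qed
  have rk: "L2_inner (\<lambda>x. g x - t * r x) (F k) = 0" if "k \<in> I" for k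
    using c d that unfolding g_def[symmetric] r_def[symmetric]
    by (subst L2_inner_diff_left) (auto intro: g r L2_fun_mult FI simp: L2_inner_mult_left)
  have ra: "L2_inner (\<lambda>x. g x - t * r x) (F a) = 0"
  proof -
    have "L2_inner (\<lambda>x. g x - t * r x) (F a) = L2_inner (\<lambda>x. g x - t * r x) (\<lambda>x. r x + (\<Sum>i\<in>I. d i * F i x))"
      by (simp add: r_def)
    also have "\<dots> = cnj (L2_inner r (\<lambda>x. g x - t * r x) + L2_inner (\<lambda>x. \<Sum>i\<in>I. d i * F i x) (\<lambda>x. g x - t * r x))"
      by (subst L2_inner_cnj[symmetric], subst L2_inner_add_left)
         (auto intro!: g r L2_fun_mult L2_fun_diff FI L2_fun_lincomb simp del: complex_cnj_add)
    also have "L2_inner r (\<lambda>x. g x - t * r x) = 0" using rr by (simp add: L2_inner_eq_0_commute)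
    also have "L2_inner (\<lambda>x. \<Sum>i\<in>I. d i * F i x) (\<lambda>x. g x - t * r x) = 0"
      by (subst L2_inner_eq_0_commute, rule L2_orth_lincomb[where I=I and F=F])
         (auto intro!: g r L2_fun_mult L2_fun_diff FI L2_fun_lincomb L2_fun_measurable rk)
    finally show ?thesis by simp
  qed
  have eq: "(\<lambda>x. f x - (\<Sum>i\<in>insert a I. (if i = a then t else c i - t * d i) * F i x)) = (\<lambda>x. g x - t * r x)"
  proof
    fix x
    have "(\<Sum>i\<in>insert a I. (if i = a then t else c i - t * d i) * F i x) =
      t * F a x + (\<Sum>i\<in>I. (c i - t * d i) * F i x)"
      using insert.hyps by (subst sum.insert) (auto intro!: sum.cong)
    then show "f x - (\<Sum>i\<in>insert a I. (if i = a then t else c i - t * d i) * F i x) = g x - t * r x"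
      by (simp add: g_def r_def sum_subtractf algebra_simps sum_distrib_left)
  qed
  show ?case
    by (rule exI[of _ "\<lambda>i. if i = a then t else c i - t * d i"]) (use eq ra rk in auto)
qed auto

text \<open>\<open>orth_proj\<close> selects by \<open>SOME\<close>; the combination found by
  \<open>orthogonal_decomposition\<close> shows that for finitely many generators there is something
  to select.\<close>

lemma orth_proj_finite_span:
  assumes "finite I" "\<And>i. i \<in> I \<Longrightarrow> F i \<in> L2_fun" "f \<in> L2_fun"
  defines "U \<equiv> L2_span (F ` I)"
  shows "orth_proj U f \<in> U" "\<And>u. u \<in> U \<Longrightarrow> L2_inner (\<lambda>x. f x - orth_proj U f x) u = 0"
proof -
  obtain c where c: "\<forall>k\<in>I. L2_inner (\<lambda>x. f x - (\<Sum>i\<in>I. c i * F i x)) (F k) = 0"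
    using orthogonal_decomposition[of I F f] assms(1-3) by blast
  let ?g = "\<lambda>x. \<Sum>i\<in>I. c i * F i x"
  have g: "?g \<in> L2_fun" by (intro L2_fun_lincomb assms)
  have "?g \<in> U" unfolding U_def by (rule L2_spanI[OF g assms(1)]) auto
  moreover have "L2_inner (\<lambda>x. f x - ?g x) u = 0" if uU: "u \<in> U" for u
  proof -
    obtain d where d: "AE x in lborel. u x = (\<Sum>i\<in>I. d i * F i x)"
      using L2_spanE[of u F I] uU assms(1) unfolding U_def by blast
    have "u \<in> L2_fun" using that L2_span_subset_L2_fun unfolding U_def by blast
    then show ?thesis
      by (intro L2_orth_lincomb[OF assms(2) _ _ _ d]) (use c in \<open>auto intro!: L2_fun_diff g assms L2_fun_measurable\<close>)
  qed
  ultimately have "\<exists>g. g \<in> U \<and> (\<forall>u\<in>U. L2_inner (\<lambda>x. f x - g x) u = 0)" by blast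
  from someI_ex[OF this] show "orth_proj U f \<in> U" "\<And>u. u \<in> U \<Longrightarrow> L2_inner (\<lambda>x. f x - orth_proj U f x) u = 0"
    unfolding orth_proj_def by auto
qed

lemma L2_span_diff:
  assumes "f \<in> L2_span (F ` I)" "g \<in> L2_span (F ` I)" "finite I"
  shows "(\<lambda>x. f x - g x) \<in> L2_span (F ` I)"
proof -
  obtain c where c: "AE x in lborel. f x = (\<Sum>i\<in>I. c i * F i x)" using L2_spanE assms by metis
  obtain d where d: "AE x in lborel. g x = (\<Sum>i\<in>I. d i * F i x)" using L2_spanE assms by metis
  have "(\<lambda>x. f x - g x) \<in> L2_fun"
    using assms L2_span_subset_L2_fun by (intro L2_fun_diff) auto
  then show ?thesis
    by (rule L2_spanI[OF _ assms(3), where c="\<lambda>i. c i - d i"])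
       (use c d in eventually_elim, simp add: algebra_simps sum_subtractf)
qed

text \<open>Two right triangles share the leg \<open>f - g\<close>, where \<open>g\<close> is the
  projection: \<open>f = (f - g) + g\<close> and \<open>f - q = (f - g) + (g - q)\<close>. Any
  competitor \<open>q\<close> thus bounds the norm of the projection from below.\<close>

lemma L2_nrm_orth_proj_ge:
  assumes "finite I" "\<And>i. i \<in> I \<Longrightarrow> F i \<in> L2_fun" "f \<in> L2_fun" "q \<in> L2_span (F ` I)"
  shows "(L2_nrm f)\<^sup>2 - (L2_nrm (\<lambda>x. f x - q x))\<^sup>2 \<le> (L2_nrm (orth_proj (L2_span (F ` I)) f))\<^sup>2"
proof -
  define U where "U = L2_span (F ` I)"
  define g where "g = orth_proj U f"
  have gU: "g \<in> U" and orth: "\<And>u. u \<in> U \<Longrightarrow> L2_inner (\<lambda>x. f x - g x) u = 0"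
    using orth_proj_finite_span[OF assms(1-3)] unfolding U_def g_def by auto
  have U: "U \<subseteq> L2_fun" unfolding U_def by (rule L2_span_subset_L2_fun)
  have fg: "(\<lambda>x. f x - g x) \<in> L2_fun" using gU U assms by (intro L2_fun_diff) auto
  have "(L2_nrm (\<lambda>x. (f x - g x) + g x))\<^sup>2 = (L2_nrm (\<lambda>x. f x - g x))\<^sup>2 + (L2_nrm g)\<^sup>2"
    by (rule L2_pythagoras) (use gU U fg orth in auto)
  moreover have gq: "(\<lambda>x. g x - q x) \<in> U"
    using gU assms unfolding U_def by (intro L2_span_diff) auto
  have "(L2_nrm (\<lambda>x. (f x - g x) + (g x - q x)))\<^sup>2 = (L2_nrm (\<lambda>x. f x - g x))\<^sup>2 + (L2_nrm (\<lambda>x. g x - q x))\<^sup>2"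
    by (rule L2_pythagoras) (use gq U fg orth in auto)
  ultimately show ?thesis unfolding g_def U_def by simp
qed

text \<open>If a residual has norm \<open>0\<close>, division by \<open>0\<close> makes the corresponding output identically zero. This is
  harmless: the family stays orthogonal with the same span, whether or not \<open>f\<close> is independent.\<close>

lemma gram_schmidt_props:
  assumes f: "\<And>k. f k \<in> L2_fun"
  shows "gram_schmidt f k \<in> L2_fun \<and>
    (\<forall>i<k. L2_inner (gram_schmidt f k) (gram_schmidt f i) = 0) \<and>
    (L2_nrm (gram_schmidt f k) = 1 \<or> gram_schmidt f k = (\<lambda>x. 0)) \<and>
    (\<exists>c. \<forall>x. gram_schmidt f k x = (\<Sum>i\<le>k. c i * f i x)) \<and>
    (\<exists>c. AE x in lborel. f k x = (\<Sum>i\<le>k. c i * gram_schmidt f i x))"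
proof (induction k rule: less_induct)
  case (less k)
  define g where "g = gram_schmidt f"
  have gL: "g i \<in> L2_fun" if "i < k" for i using less[OF that] by (simp add: g_def)
  have orth: "L2_inner (g i) (g j) = 0" if "i < k" "j < k" "i \<noteq> j" for i j
    using less[of i] less[of j] that L2_inner_eq_0_commute[of "g i" "g j"]
    by (cases "i < j") (auto simp: g_def)
  have nrm: "L2_nrm (g i) = 1 \<or> g i = (\<lambda>x. 0)" if "i < k" for i using less[OF that] by (simp add: g_def)
  define r where "r = (\<lambda>x. f k x - (\<Sum>i<k. L2_inner (f k) (g i) * g i x))"
  have gk: "g k = (\<lambda>x. r x / complex_of_real (L2_nrm r))"
    unfolding g_def r_def by (subst gram_schmidt.simps) (simp add: Let_def)
  have r: "r \<in> L2_fun" unfolding r_def by (intro L2_fun_diff f L2_fun_lincomb gL) simp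
  have gk': "g k = (\<lambda>x. (1 / complex_of_real (L2_nrm r)) * r x)" unfolding gk by auto
  have gkL: "g k \<in> L2_fun" unfolding gk' by (intro L2_fun_mult r)
  have ri: "L2_inner r (g i) = 0" if i: "i < k" for i
  proof -
    have "L2_inner r (g i) = L2_inner (f k) (g i) - L2_inner (\<lambda>x. \<Sum>l<k. L2_inner (f k) (g l) * g l x) (g i)"
      unfolding r_def by (intro L2_inner_diff_left f L2_fun_lincomb gL i) simp
    also have "L2_inner (\<lambda>x. \<Sum>l<k. L2_inner (f k) (g l) * g l x) (g i) =
       (\<Sum>l<k. L2_inner (f k) (g l) * L2_inner (g l) (g i))"
      by (intro L2_inner_sum_left gL i) simp
    also have "\<dots> = (\<Sum>l<k. if l = i then L2_inner (f k) (g i) * L2_inner (g i) (g i) else 0)"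
      by (intro sum.cong refl) (use orth i in auto)
    also have "\<dots> = L2_inner (f k) (g i) * L2_inner (g i) (g i)" using i by simp
    \<comment> \<open>The last factor is 1 if \<open>g i\<close> is normalised; if
      \<open>g i\<close> vanishes, both sides are 0.\<close>
    also have "\<dots> = L2_inner (f k) (g i)"
      using nrm[OF i] by (auto simp: L2_inner_self) (simp add: L2_inner_def)
    finally show ?thesis by simp
  qed
  have o: "\<forall>i<k. L2_inner (g k) (g i) = 0"
    unfolding gk' using ri by (simp only: L2_inner_mult_left) simp
  have n: "L2_nrm (g k) = 1 \<or> g k = (\<lambda>x. 0)"
  proof (cases "L2_nrm r = 0")
    case False
    then have "0 < L2_nrm r" using L2_nrm_nonneg[of r] by linarith
    have "(L2_nrm (g k))\<^sup>2 = (LINT x|lborel. (norm (r x))\<^sup>2 / (L2_nrm r)\<^sup>2)"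
      unfolding gk by (subst L2_nrm_sq) (simp add: norm_divide power_divide del: integral_divide_zero)
    also have "\<dots> = 1" using False by (simp add: L2_nrm_sq[symmetric])
    finally have "L2_nrm (g k) = 1"
      using L2_nrm_nonneg[of "g k"] by (metis abs_of_nonneg one_power2 power2_eq_iff_nonneg zero_le_one)
    then show ?thesis ..
  qed (auto simp: gk)
  have c1: "\<exists>c. \<forall>x. g k x = (\<Sum>i\<le>k. c i * f i x)"
  proof -
    have "\<forall>i\<in>{..<k}. \<exists>c. \<forall>x. g i x = (\<Sum>j\<le>i. c j * f j x)" using less by (auto simp: g_def)
    then obtain c where c: "\<And>i x. i < k \<Longrightarrow> g i x = (\<Sum>j\<le>i. c i j * f j x)"
      by (metis lessThan_iff)
    define d where "d = (\<lambda>i j. if j \<le> i then c i j else 0)"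
    have d: "g i x = (\<Sum>j<k. d i j * f j x)" if "i < k" for i x
      unfolding c[OF that] d_def using that by (intro sum.mono_neutral_cong_left) auto
    define A where "A = (\<lambda>j. \<Sum>i<k. L2_inner (f k) (g i) * d i j)"
    have "r x = f k x - (\<Sum>j<k. A j * f j x)" for x
      unfolding r_def A_def by (subst sum_distrib_right, subst sum.swap) (auto simp: d sum_distrib_left mult.assoc)
    then have "g k x = (\<Sum>i\<le>k. (if i = k then 1 / complex_of_real (L2_nrm r) else
       - A i / complex_of_real (L2_nrm r)) * f i x)" for x
      unfolding gk lessThan_Suc_atMost[symmetric] sum.lessThan_Suc
      by (simp add: diff_divide_distrib sum_divide_distrib sum_negf)
    then show ?thesis
      by (intro exI[of _ "\<lambda>i. if i = k then 1 / complex_of_real (L2_nrm r) else - A i / complex_of_real (L2_nrm r)"] allI)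
  qed
  have c2: "\<exists>c. AE x in lborel. f k x = (\<Sum>i\<le>k. c i * g i x)"
  proof -
    \<comment> \<open>A residual of norm 0 need only vanish almost everywhere. This is why this
      triangular relation is an AE statement, while the one in \<open>c1\<close> holds
      everywhere.\<close>
    have "AE x in lborel. r x = complex_of_real (L2_nrm r) * g k x"
    proof (cases "L2_nrm r = 0")
      case True then show ?thesis using L2_nrm_eq_0_AE[OF r] by simp
    qed (auto simp: gk)
    then have "AE x in lborel. f k x = (\<Sum>i\<le>k. (if i = k then complex_of_real (L2_nrm r) else L2_inner (f k) (g i)) * g i x)"
    proof eventually_elim
      case (elim x)
      then have "f k x = complex_of_real (L2_nrm r) * g k x + (\<Sum>i<k. L2_inner (f k) (g i) * g i x)"
        by (simp add: r_def algebra_simps)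
      then show ?case
        unfolding lessThan_Suc_atMost[symmetric] sum.lessThan_Suc by simp
    qed
    then show ?thesis
      by (intro exI[of _ "\<lambda>i. if i = k then complex_of_real (L2_nrm r) else L2_inner (f k) (g i)"])
  qed
  show ?case using gkL o n c1 c2 by (simp add: g_def)
qed

section \<open>Continuity of translations\<close>

definition L1_shift_cont :: "(real \<Rightarrow> real) \<Rightarrow> bool" where
  "L1_shift_cont f \<longleftrightarrow> ((\<lambda>t. LINT x|lborel. \<bar>f x - f (x - t)\<bar>) \<longlongrightarrow> 0) (at 0)"

lemma integrable_shift:
  fixes f :: "real \<Rightarrow> 'a::{banach, second_countable_topology}"
  shows "integrable lborel f \<Longrightarrow> integrable lborel (\<lambda>x. f (x - t))"
  using lborel_integrable_real_affine[of f 1 "-t"] by simp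

lemma integral_shift:
  fixes f :: "real \<Rightarrow> 'a::{banach, second_countable_topology}"
  shows "(LINT x|lborel. f (x - t)) = (LINT x|lborel. f x)"
  using lborel_integral_real_affine[of 1 f "-t"] by simp

text \<open>The usual three-term estimate. By translation invariance the approximation error counts
  twice, with \<open>e / 4\<close> each, and the modulus of \<open>g\<close> takes the remaining
  \<open>e / 2\<close>.\<close>

lemma L1_shift_cont_lim:
  assumes "\<And>e. 0 < e \<Longrightarrow> \<exists>g. integrable lborel g \<and> L1_shift_cont g \<and> (LINT x|lborel. \<bar>f x - g x\<bar>) < e"
    and f: "integrable lborel f"
  shows "L1_shift_cont f"
  unfolding L1_shift_cont_def
proof (rule tendstoI)
  fix e :: real assume "0 < e"
  then obtain g where g: "integrable lborel g" "L1_shift_cont g" "(LINT x|lborel. \<bar>f x - g x\<bar>) < e / 4"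
    using assms(1)[of "e/4"] by auto
  have "eventually (\<lambda>t. dist (LINT x|lborel. \<bar>g x - g (x - t)\<bar>) 0 < e / 2) (at 0)"
    using g(2) \<open>0 < e\<close> unfolding L1_shift_cont_def by (intro tendstoD) auto
  then show "eventually (\<lambda>t. dist (LINT x|lborel. \<bar>f x - f (x - t)\<bar>) 0 < e) (at 0)"
  proof eventually_elim
    case (elim t)
    note i = f g(1) integrable_shift[OF f] integrable_shift[OF g(1)]
    have "(LINT x|lborel. \<bar>f x - f (x - t)\<bar>) \<le>
       (LINT x|lborel. \<bar>f x - g x\<bar> + \<bar>g x - g (x - t)\<bar> + \<bar>f (x - t) - g (x - t)\<bar>)"
      by (rule integral_mono) (auto intro!: i Bochner_Integration.integrable_add integrable_abs Bochner_Integration.integrable_diff)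
    also have "\<dots> = (LINT x|lborel. \<bar>f x - g x\<bar>) + (LINT x|lborel. \<bar>g x - g (x - t)\<bar>) + (LINT x|lborel. \<bar>f (x - t) - g (x - t)\<bar>)"
      by (subst Bochner_Integration.integral_add Bochner_Integration.integral_add; (intro i Bochner_Integration.integrable_add integrable_abs Bochner_Integration.integrable_diff)?)+ simp
    also have "(LINT x|lborel. \<bar>f (x - t) - g (x - t)\<bar>) = (LINT x|lborel. \<bar>f x - g x\<bar>)"
      by (rule integral_shift)
    finally show ?case using g(3) elim by (simp add: dist_real_def)
  qed
qed

lemma L1_shift_cont_add:
  assumes "integrable lborel f" "integrable lborel g" "L1_shift_cont f" "L1_shift_cont g"
  shows "L1_shift_cont (\<lambda>x. f x + g x)"
  unfolding L1_shift_cont_def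
proof (rule tendsto_sandwich[of "\<lambda>_. 0"])
  note i = assms(1,2) integrable_shift[OF assms(1)] integrable_shift[OF assms(2)]
  show "((\<lambda>t. (LINT x|lborel. \<bar>f x - f (x - t)\<bar>) + (LINT x|lborel. \<bar>g x - g (x - t)\<bar>)) \<longlongrightarrow> 0) (at 0)"
    using tendsto_add[of _ 0 _ _ 0] assms(3,4) unfolding L1_shift_cont_def by fastforce
  show "\<forall>\<^sub>F t in at 0. (LINT x|lborel. \<bar>f x + g x - (f (x - t) + g (x - t))\<bar>)
      \<le> (LINT x|lborel. \<bar>f x - f (x - t)\<bar>) + (LINT x|lborel. \<bar>g x - g (x - t)\<bar>)"
  proof (rule always_eventually, rule allI)
    fix t
    have "(LINT x|lborel. \<bar>f x + g x - (f (x - t) + g (x - t))\<bar>)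
      \<le> (LINT x|lborel. \<bar>f x - f (x - t)\<bar> + \<bar>g x - g (x - t)\<bar>)"
      by (rule integral_mono) (auto intro!: i Bochner_Integration.integrable_add integrable_abs Bochner_Integration.integrable_diff)
    then show "(LINT x|lborel. \<bar>f x + g x - (f (x - t) + g (x - t))\<bar>)
      \<le> (LINT x|lborel. \<bar>f x - f (x - t)\<bar>) + (LINT x|lborel. \<bar>g x - g (x - t)\<bar>)"
      by (subst (asm) Bochner_Integration.integral_add) (auto intro!: i integrable_abs Bochner_Integration.integrable_diff)
  qed
qed auto

lemma L1_shift_cont_mult:
  "L1_shift_cont f \<Longrightarrow> L1_shift_cont (\<lambda>x. f x * c)"
  unfolding L1_shift_cont_def
  by (auto simp flip: left_diff_distrib simp: abs_mult intro: tendsto_mult_left_zero)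

lemma integrable_indicator_interval: "integrable lborel (indicator {a..b::real} :: real \<Rightarrow> real)"
  by (cases "a \<le> b") (auto intro!: integrable_real_indicator)

text \<open>Translation by \<open>t\<close> alters the indicator only within distance
  \<open>\<bar>t\<bar>\<close> of the two endpoints, hence on two intervals of length
  \<open>2 * \<bar>t\<bar>\<close>.\<close>

lemma L1_shift_cont_interval:
  fixes a b :: real
  shows "L1_shift_cont (indicator {a..b})"
proof (cases "a \<le> b")
  case True
  show ?thesis
    unfolding L1_shift_cont_def
  proof (rule tendsto_sandwich[of "\<lambda>_. 0"])
    show "((\<lambda>t. 4 * \<bar>t\<bar>) \<longlongrightarrow> (0::real)) (at 0)"
      by (intro tendsto_eq_intros) auto
    show "\<forall>\<^sub>F t in at 0. (LINT x|lborel. \<bar>indicator {a..b} x - indicator {a..b} (x - t)\<bar>) \<le> 4 * \<bar>t\<bar>"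
    proof (rule always_eventually, rule allI)
      fix t
      have "(LINT x|lborel. \<bar>indicator {a..b} x - indicator {a..b} (x - t)\<bar>) \<le>
        (LINT x|lborel. indicator {a-\<bar>t\<bar>..a+\<bar>t\<bar>} x + indicator {b-\<bar>t\<bar>..b+\<bar>t\<bar>} x :: real)"
      proof (rule integral_mono)
        show "integrable lborel (\<lambda>x. \<bar>indicator {a..b} x - indicator {a..b} (x - t)\<bar> :: real)"
          by (intro integrable_abs Bochner_Integration.integrable_diff integrable_shift integrable_indicator_interval)
        show "integrable lborel (\<lambda>x. indicator {a-\<bar>t\<bar>..a+\<bar>t\<bar>} x + indicator {b-\<bar>t\<bar>..b+\<bar>t\<bar>} x :: real)"
          by (intro Bochner_Integration.integrable_add integrable_indicator_interval)
      qed (use True in \<open>auto simp: indicator_def abs_if\<close>)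
      also have "\<dots> = 4 * \<bar>t\<bar>"
        by (subst Bochner_Integration.integral_add) auto
      finally show "(LINT x|lborel. \<bar>indicator {a..b} x - indicator {a..b} (x - t)\<bar>) \<le> 4 * \<bar>t\<bar>" .
    qed
  qed auto
qed (simp add: L1_shift_cont_def)

text \<open>Dynkin's pi-lambda argument, starting from intervals. The fixed window
  \<open>{-N..N}\<close> keeps complements and countable unions integrable.\<close>

lemma L1_shift_cont_bounded_borel:
  fixes A :: "real set"
  assumes "A \<in> sets borel"
  shows "L1_shift_cont (indicator (A \<inter> {-N..N}))"
proof -
  have sb: "sets borel = sigma_sets UNIV (range (\<lambda>(a,b). {a..b::real}))"
    by (simp add: borel_eq_atLeastAtMost)
  have "Int_stable (range (\<lambda>(a,b). {a..b::real}))"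
    by (auto simp: Int_stable_def)
  moreover have "range (\<lambda>(a,b). {a..b::real}) \<subseteq> Pow UNIV" by simp
  moreover have "A \<in> sigma_sets UNIV (range (\<lambda>(a,b). {a..b::real}))"
    using assms unfolding sb .
  ultimately show ?thesis
  proof (induction A rule: sigma_sets_induct_disjoint)
    case (basic A)
    then obtain a b where A: "A = {a..b}" by auto
    have "A \<inter> {-N..N} = {max a (-N)..min b N}" unfolding A by auto
    then show ?case using L1_shift_cont_interval[of "max a (-N)" "min b N"] by simp
  next
    case (compl A)
    then have A: "A \<in> sets borel" unfolding sb by simp
    have i: "integrable lborel (indicator (A \<inter> {-N..N}) :: real \<Rightarrow> real)"
      by (rule Bochner_Integration.integrable_bound[OF integrable_indicator_interval[of "-N" N]])
         (use A in \<open>auto simp: indicator_def\<close>)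
    have "indicator ((UNIV - A) \<inter> {-N..N}) = (\<lambda>x. indicator {-N..N} x + indicator (A \<inter> {-N..N}) x * (-1::real))"
      by (auto simp: indicator_def fun_eq_iff)
    moreover have "L1_shift_cont (indicator {-N..N})"
      by (rule L1_shift_cont_interval)
    ultimately show ?case
      using L1_shift_cont_add[OF integrable_indicator_interval integrable_mult_left[OF i, of "-1"] _ L1_shift_cont_mult[OF compl(2)]]
      by simp
  next
    case (union A)
    then have A: "A i \<in> sets borel" for i unfolding sb by auto
    let ?B = "\<lambda>i. A i \<inter> {-N..N}"
    have i: "integrable lborel (indicator (B \<inter> {-N..N}) :: real \<Rightarrow> real)" if "B \<in> sets borel" for B
      by (rule Bochner_Integration.integrable_bound[OF integrable_indicator_interval[of "-N" N]])
         (use that in \<open>auto simp: indicator_def\<close>)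
    show ?case
    proof (rule L1_shift_cont_lim)
      have U: "(\<Union>i. A i) \<in> sets borel" using A by auto
      show "integrable lborel (indicator (\<Union> (range A) \<inter> {-N..N}) :: real \<Rightarrow> real)" by (rule i[OF U])
      fix e :: real assume e: "0 < e"
      \<comment> \<open>Finite partial unions: disjointness turns their indicators into sums, and
        dominated convergence makes them approximate the full union in mean.\<close>
      define S where "S n = (\<lambda>x. indicator ((\<Union>i<n. A i) \<inter> {-N..N}) x :: real)" for n
      have "(\<lambda>n. LINT x|lborel. \<bar>indicator (\<Union> (range A) \<inter> {-N..N}) x - S n x\<bar>) \<longlonglongrightarrow> integral\<^sup>L lborel (\<lambda>x::real. 0::real)"
      proof (rule integral_dominated_convergence[where w="indicator (\<Union> (range A) \<inter> {-N..N})"])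
        show "AE x in lborel. (\<lambda>n. \<bar>indicator (\<Union> (range A) \<inter> {-N..N}) x - S n x\<bar>) \<longlonglongrightarrow> 0"
        proof (rule AE_I2)
          fix x
          have "eventually (\<lambda>n. \<bar>indicator (\<Union> (range A) \<inter> {-N..N}) x - S n x\<bar> = 0) sequentially"
          proof (cases "\<exists>i. x \<in> A i")
            case True
            then obtain k where "x \<in> A k" by blast
            then show ?thesis
              by (intro eventually_sequentiallyI[of "Suc k"]) (auto simp: S_def indicator_def Suc_le_eq)
          qed (auto simp: S_def indicator_def)
          then show "(\<lambda>n. \<bar>indicator (\<Union> (range A) \<inter> {-N..N}) x - S n x\<bar>) \<longlonglongrightarrow> 0"
            by (rule tendsto_eventually)
        qed
        show "AE x in lborel. norm \<bar>indicator (\<Union> (range A) \<inter> {-N..N}) x - S n x\<bar> \<le> indicator (\<Union> (range A) \<inter> {-N..N}) x" for n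
          by (auto simp: S_def indicator_def)
      qed (use A i[OF U] in \<open>auto simp: S_def\<close>)
      then have "eventually (\<lambda>n. (LINT x|lborel. \<bar>indicator (\<Union> (range A) \<inter> {-N..N}) x - S n x\<bar>) < e) sequentially"
        using e by (simp add: order_tendstoD)
      then obtain n where n: "(LINT x|lborel. \<bar>indicator (\<Union> (range A) \<inter> {-N..N}) x - S n x\<bar>) < e"
        by (auto simp: eventually_sequentially)
      have "L1_shift_cont (S n)"
      proof (induction n)
        case 0 then show ?case by (simp add: S_def L1_shift_cont_def)
      next
        case (Suc n)
        have "x \<notin> A i" if "i < n" "x \<in> A n" for i x
          using union.hyps(1) that unfolding disjoint_family_on_def by (metis IntI UNIV_I empty_iff less_irrefl)
        then have "S (Suc n) = (\<lambda>x. S n x + indicator (A n \<inter> {-N..N}) x)"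
          by (auto simp: S_def indicator_def fun_eq_iff less_Suc_eq)
        then show ?case
          using Suc union.IH[of n] i A by (auto simp: S_def intro!: L1_shift_cont_add)
      qed
      moreover have "integrable lborel (S n)" using i A unfolding S_def by auto
      ultimately show "\<exists>g. integrable lborel g \<and> L1_shift_cont g \<and>
         (LINT x|lborel. \<bar>indicator (\<Union> (range A) \<inter> {-N..N}) x - g x\<bar>) < e" using n by blast
    qed
  qed (simp add: L1_shift_cont_def)
qed

text \<open>Induction along the construction of the integral; a set of finite measure is first
  reduced to its bounded truncations, where \<open>L1_shift_cont_bounded_borel\<close>
  applies.\<close>

lemma L1_shift_cont_integrable:
  fixes f :: "real \<Rightarrow> real"
  assumes "integrable lborel f" shows "L1_shift_cont f"
  using assms
proof (induction rule: integrable_induct)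
  case (base A c)
  have A: "A \<in> sets borel" using base by simp
  have iA: "integrable lborel (indicator A :: real \<Rightarrow> real)" using base by auto
  have "L1_shift_cont (indicator A)"
  proof (rule L1_shift_cont_lim[OF _ iA])
    fix e :: real assume e: "0 < e"
    have i: "integrable lborel (indicator (A \<inter> {-real n..real n}) :: real \<Rightarrow> real)" for n
      by (rule Bochner_Integration.integrable_bound[OF iA]) (use A in \<open>auto simp: indicator_def\<close>)
    have "(\<lambda>n. LINT x|lborel. \<bar>indicator A x - indicator (A \<inter> {-real n..real n}) x\<bar>) \<longlonglongrightarrow> integral\<^sup>L lborel (\<lambda>x::real. 0::real)"
    proof (rule integral_dominated_convergence[where w="indicator A"])
      show "AE x in lborel. (\<lambda>n. \<bar>indicator A x - indicator (A \<inter> {-real n..real n}) x\<bar> :: real) \<longlonglongrightarrow> 0"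
      proof (rule AE_I2)
        fix x
        obtain k :: nat where "\<bar>x\<bar> \<le> real k" using real_arch_simple by blast
        then show "(\<lambda>n. \<bar>indicator A x - indicator (A \<inter> {-real n..real n}) x\<bar> :: real) \<longlonglongrightarrow> 0"
          by (intro tendsto_eventually eventually_sequentiallyI[of k]) (auto simp: indicator_def abs_le_iff)
      qed
    qed (use A iA in \<open>auto simp: indicator_def\<close>)
    then have "eventually (\<lambda>n. (LINT x|lborel. \<bar>indicator A x - indicator (A \<inter> {-real n..real n}) x\<bar>) < e) sequentially"
      using e by (simp add: order_tendstoD)
    then obtain n where "(LINT x|lborel. \<bar>indicator A x - indicator (A \<inter> {-real n..real n}) x\<bar>) < e"
      by (auto simp: eventually_sequentially)
    then show "\<exists>g. integrable lborel g \<and> L1_shift_cont g \<and> (LINT x|lborel. \<bar>indicator A x - g x\<bar>) < e"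
      using i[of n] L1_shift_cont_bounded_borel[OF A] by blast
  qed
  then show ?case using L1_shift_cont_mult by simp
next
  case (add f g) then show ?case by (intro L1_shift_cont_add)
next
  case (lim f s)
  show ?case
  proof (rule L1_shift_cont_lim[OF _ lim.hyps(4)])
    fix e :: real assume e: "0 < e"
    have [measurable]: "f \<in> borel_measurable borel" "\<And>n. s n \<in> borel_measurable borel" using lim by auto
    have "(\<lambda>n. LINT x|lborel. \<bar>f x - s n x\<bar>) \<longlonglongrightarrow> integral\<^sup>L lborel (\<lambda>x::real. 0::real)"
    proof (rule integral_dominated_convergence[where w="\<lambda>x. 3 * \<bar>f x\<bar>"])
      show "AE x in lborel. (\<lambda>n. \<bar>f x - s n x\<bar>) \<longlonglongrightarrow> 0"
      proof (rule AE_I2)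
        fix x
        have "(\<lambda>n. \<bar>f x - s n x\<bar>) \<longlonglongrightarrow> \<bar>f x - f x\<bar>" using lim.hyps(2)[of x] by (intro tendsto_intros) auto
        then show "(\<lambda>n. \<bar>f x - s n x\<bar>) \<longlonglongrightarrow> 0" by simp
      qed
      show "AE x in lborel. norm \<bar>f x - s n x\<bar> \<le> 3 * \<bar>f x\<bar>" for n
      proof (rule AE_I2)
        fix x show "norm \<bar>f x - s n x\<bar> \<le> 3 * \<bar>f x\<bar>" using lim.hyps(3)[of x n] by auto
      qed
    qed (use lim in auto)
    then have "eventually (\<lambda>n. (LINT x|lborel. \<bar>f x - s n x\<bar>) < e) sequentially"
      using e by (simp add: order_tendstoD)
    then obtain n where "(LINT x|lborel. \<bar>f x - s n x\<bar>) < e"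
      by (auto simp: eventually_sequentially)
    then show "\<exists>g. integrable lborel g \<and> L1_shift_cont g \<and> (LINT x|lborel. \<bar>f x - g x\<bar>) < e"
      using lim by blast
  qed
qed

section \<open>Translation continuity in the mean square\<close>

definition L2_shift_cont :: "(real \<Rightarrow> complex) \<Rightarrow> bool" where
  "L2_shift_cont f \<longleftrightarrow> ((\<lambda>t. (L2_nrm (\<lambda>x. f x - f (x - t)))\<^sup>2) \<longlongrightarrow> 0) (at 0)"

lemma L2_fun_shift: "f \<in> L2_fun \<Longrightarrow> (\<lambda>x::real. f (x - t)) \<in> L2_fun"
  using integrable_shift[of "\<lambda>x. (norm (f x))\<^sup>2" t] by (auto simp: L2_fun_def)

text \<open>For nonnegative functions \<open>L\<^sup>2\<close> continuity follows from \<open>L\<^sup>1\<close> continuity of the square, as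
  \<open>\<bar>a - b\<bar>\<^sup>2 \<le> \<bar>a\<^sup>2 - b\<^sup>2\<bar>\<close> for \<open>a, b \<ge> 0\<close>.\<close>

lemma L2_shift_cont_nonneg:
  fixes f :: "real \<Rightarrow> real"
  assumes "(\<lambda>x. complex_of_real (f x)) \<in> L2_fun" "\<And>x. 0 \<le> f x"
  shows "L2_shift_cont (\<lambda>x. complex_of_real (f x))"
  unfolding L2_shift_cont_def
proof (rule tendsto_sandwich[of "\<lambda>_. 0"])
  have i: "integrable lborel (\<lambda>x. (f x)\<^sup>2)" using L2_funD[OF assms(1)] by simp
  show "((\<lambda>t. LINT x|lborel. \<bar>(f x)\<^sup>2 - (f (x - t))\<^sup>2\<bar>) \<longlongrightarrow> 0) (at 0)"
    using L1_shift_cont_integrable[OF i] by (simp add: L1_shift_cont_def)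
  have ineq: "(a - b)\<^sup>2 \<le> \<bar>a\<^sup>2 - b\<^sup>2\<bar>" if "0 \<le> a" "0 \<le> b" for a b :: real
  proof -
    have "\<bar>a - b\<bar> * \<bar>a - b\<bar> \<le> \<bar>a - b\<bar> * \<bar>a + b\<bar>" using that by (intro mult_left_mono) auto
    then show ?thesis by (simp add: power2_eq_square flip: abs_mult) (simp add: algebra_simps)
  qed
  show "\<forall>\<^sub>F t in at 0. (L2_nrm (\<lambda>x. complex_of_real (f x) - complex_of_real (f (x - t))))\<^sup>2
      \<le> (LINT x|lborel. \<bar>(f x)\<^sup>2 - (f (x - t))\<^sup>2\<bar>)"
  proof (rule always_eventually, rule allI)
    fix t
    show "(L2_nrm (\<lambda>x. complex_of_real (f x) - complex_of_real (f (x - t))))\<^sup>2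
      \<le> (LINT x|lborel. \<bar>(f x)\<^sup>2 - (f (x - t))\<^sup>2\<bar>)"
      unfolding L2_nrm_sq
    proof (rule integral_mono)
      show "integrable lborel (\<lambda>x. (norm (complex_of_real (f x) - complex_of_real (f (x - t))))\<^sup>2)"
        by (intro L2_funD L2_fun_diff assms L2_fun_shift[OF assms(1)])
      show "integrable lborel (\<lambda>x. \<bar>(f x)\<^sup>2 - (f (x - t))\<^sup>2\<bar>)"
        by (intro integrable_abs Bochner_Integration.integrable_diff i integrable_shift[OF i])
    qed (simp add: ineq assms flip: of_real_diff)
  qed
qed auto

lemma L2_shift_cont_add:
  assumes "f \<in> L2_fun" "g \<in> L2_fun" "L2_shift_cont f" "L2_shift_cont g"
  shows "L2_shift_cont (\<lambda>x. f x + g x)"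
  unfolding L2_shift_cont_def
proof (rule tendsto_sandwich[of "\<lambda>_. 0"])
  show "((\<lambda>t. 2 * (L2_nrm (\<lambda>x. f x - f (x - t)))\<^sup>2 + 2 * (L2_nrm (\<lambda>x. g x - g (x - t)))\<^sup>2) \<longlongrightarrow> 0) (at 0)"
    using assms(3,4) unfolding L2_shift_cont_def
    by (intro tendsto_eq_intros) auto
  show "\<forall>\<^sub>F t in at 0. (L2_nrm (\<lambda>x. f x + g x - (f (x - t) + g (x - t))))\<^sup>2 \<le>
     2 * (L2_nrm (\<lambda>x. f x - f (x - t)))\<^sup>2 + 2 * (L2_nrm (\<lambda>x. g x - g (x - t)))\<^sup>2"
  proof (rule always_eventually, rule allI)
    fix t
    note l = L2_fun_diff[OF assms(1) L2_fun_shift[OF assms(1)], of t] L2_fun_diff[OF assms(2) L2_fun_shift[OF assms(2)], of t]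
    have "(L2_nrm (\<lambda>x. f x + g x - (f (x - t) + g (x - t))))\<^sup>2 = 
      (L2_nrm (\<lambda>x. (f x - f (x - t)) + (g x - g (x - t))))\<^sup>2"
      by (simp add: algebra_simps)
    also have "\<dots> \<le> (LINT x|lborel. 2 * (norm (f x - f (x - t)))\<^sup>2 + 2 * (norm (g x - g (x - t)))\<^sup>2)"
      unfolding L2_nrm_sq
      by (intro integral_mono norm_add_sq_le L2_funD L2_fun_add l Bochner_Integration.integrable_add integrable_mult_right)
    also have "\<dots> = 2 * (L2_nrm (\<lambda>x. f x - f (x - t)))\<^sup>2 + 2 * (L2_nrm (\<lambda>x. g x - g (x - t)))\<^sup>2"
      unfolding L2_nrm_sq
      by (subst Bochner_Integration.integral_add) (use l in \<open>auto intro!: L2_funD integrable_mult_right\<close>)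
    finally show "(L2_nrm (\<lambda>x. f x + g x - (f (x - t) + g (x - t))))\<^sup>2 \<le>
     2 * (L2_nrm (\<lambda>x. f x - f (x - t)))\<^sup>2 + 2 * (L2_nrm (\<lambda>x. g x - g (x - t)))\<^sup>2" .
  qed
qed auto

lemma L2_shift_cont_mult:
  "L2_shift_cont f \<Longrightarrow> L2_shift_cont (\<lambda>x. c * f x)"
  unfolding L2_shift_cont_def L2_nrm_sq
  by (auto simp flip: right_diff_distrib simp: norm_mult power_mult_distrib intro: tendsto_mult_right_zero)

text \<open>\<open>L2_shift_cont_nonneg\<close> asks for nonnegative functions, so the real and the
  imaginary part are each split into positive and negative part; all four are dominated by
  \<open>norm (f x)\<close>.\<close>

lemma L2_shift_cont_L2_fun:
  assumes f: "f \<in> L2_fun" shows "L2_shift_cont f"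
proof -
  have m [measurable]: "f \<in> borel_measurable borel" using f by (simp add: L2_fun_measurable)
  have part: "(\<lambda>x. complex_of_real (g x)) \<in> L2_fun \<and> L2_shift_cont (\<lambda>x. complex_of_real (g x))"
    if "g \<in> borel_measurable borel" "\<And>x. 0 \<le> g x" "\<And>x. g x \<le> norm (f x)" for g
  proof -
    have "(\<lambda>x. complex_of_real (g x)) \<in> L2_fun"
      by (rule L2_funI[OF _ L2_funD[OF f]]) (use that in \<open>auto intro!: power_mono\<close>)
    then show ?thesis using that L2_shift_cont_nonneg by blast
  qed
  define P where "P g = (\<lambda>x. complex_of_real (max 0 (g (f x))))" for g :: "complex \<Rightarrow> real"
  have P: "P g \<in> L2_fun \<and> L2_shift_cont (P g)"
    if "g \<in> borel_measurable borel" "\<And>z. \<bar>g z\<bar> \<le> norm z" for g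
    unfolding P_def
    by (rule part) (use that m in \<open>auto intro: order_trans[OF abs_ge_self]\<close>)
  have P4: "P Re \<in> L2_fun \<and> L2_shift_cont (P Re)" "P (\<lambda>z. - Re z) \<in> L2_fun \<and> L2_shift_cont (P (\<lambda>z. - Re z))"
    "P Im \<in> L2_fun \<and> L2_shift_cont (P Im)" "P (\<lambda>z. - Im z) \<in> L2_fun \<and> L2_shift_cont (P (\<lambda>z. - Im z))"
    by (intro P; auto simp: abs_Re_le_cmod abs_Im_le_cmod)+
  have "f = (\<lambda>x. (P Re x + (-1) * P (\<lambda>z. - Re z) x) + (\<i> * P Im x + (- \<i>) * P (\<lambda>z. - Im z) x))"
    by (auto simp: P_def fun_eq_iff complex_eq_iff)
  then show ?thesis
    using P4 by (subst \<open>f = _\<close>) (intro L2_shift_cont_add L2_shift_cont_mult L2_fun_add L2_fun_mult; auto)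
qed

section \<open>The Fejer kernel\<close>

text \<open>The Fejer kernel with period \<open>1 / \<epsilon>\<close> and integral 1 over a period:
  \<open>\<epsilon>\<close> times the sum of \<open>(1 - \<bar>d\<bar> / (M + 1)) * cis (2 * pi *
  \<epsilon> * d * t)\<close> over \<open>\<bar>d\<bar> \<le> M\<close>. Written as a square it is
  visibly nonnegative.\<close>

definition fejer_kernel :: "real \<Rightarrow> nat \<Rightarrow> real \<Rightarrow> real" where
  "fejer_kernel \<epsilon> M t = \<epsilon> / (real M + 1) * (cmod (\<Sum>k\<le>M. cis (2 * pi * \<epsilon> * real k * t)))\<^sup>2"

text \<open>The triangular weights are hidden in the double sum: each frequency
  \<open>d = k - l\<close> occurs \<open>M + 1 - \<bar>d\<bar>\<close> times. It runs through
  \<open>-M..M\<close>, which matches \<open>sampling_index\<close>.\<close>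

definition fejer_mean :: "real \<Rightarrow> nat \<Rightarrow> (real \<Rightarrow> complex) \<Rightarrow> real \<Rightarrow> complex" where
  "fejer_mean \<epsilon> M f x = (\<Sum>k\<le>M. \<Sum>l\<le>M. complex_of_real (\<epsilon> / (real M + 1)) *
     (LINT y|lborel. cis (- (2 * pi * \<epsilon> * (real k - real l) * y)) * f y) *
     cis (2 * pi * \<epsilon> * (real k - real l) * x))"

lemma cmod_sum_cis_sq:
  "complex_of_real ((cmod (\<Sum>k\<in>A. cis (a k)))\<^sup>2) = (\<Sum>k\<in>A. \<Sum>l\<in>A. cis (a k - a l))"
  unfolding complex_norm_square cnj_sum cis_cnj sum_product by (simp add: cis_mult)

lemma fejer_kernel_expand:
  "complex_of_real (fejer_kernel \<epsilon> M t) = (\<Sum>k\<le>M. \<Sum>l\<le>M. complex_of_real (\<epsilon> / (real M + 1)) *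
     cis (2 * pi * \<epsilon> * (real k - real l) * t))"
  unfolding fejer_kernel_def of_real_mult cmod_sum_cis_sq
  by (simp add: sum_distrib_left algebra_simps)

lemma fejer_kernel_cos:
  "fejer_kernel \<epsilon> M t = (\<Sum>k\<le>M. \<Sum>l\<le>M. \<epsilon> / (real M + 1) * cos (2 * pi * \<epsilon> * (real k - real l) * t))"
  using arg_cong[OF fejer_kernel_expand[of \<epsilon> M t], of Re] by simp

lemma fejer_kernel_nonneg: "0 \<le> \<epsilon> \<Longrightarrow> 0 \<le> fejer_kernel \<epsilon> M t"
  by (simp add: fejer_kernel_def)

lemma fejer_kernel_measurable [measurable]: "fejer_kernel \<epsilon> M \<in> borel_measurable borel"
  unfolding fejer_kernel_cos by measurable

lemma fejer_kernel_periodic: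
  assumes "0 < \<epsilon>" shows "fejer_kernel \<epsilon> M (t + of_int m / \<epsilon>) = fejer_kernel \<epsilon> M t"
proof -
  have "cis (2 * pi * \<epsilon> * real k * (t + of_int m / \<epsilon>)) = cis (2 * pi * \<epsilon> * real k * t)" for k
  proof -
    have "2 * pi * \<epsilon> * real k * (t + of_int m / \<epsilon>) = 2 * pi * \<epsilon> * real k * t + 2 * pi * of_int (int k * m)"
      using assms by (simp add: field_simps)
    then show ?thesis by (simp only: cis_mult[symmetric] cis_multiple_2pi[of "of_int _", OF Ints_of_int] mult_1_right)
  qed
  then show ?thesis by (simp add: fejer_kernel_def)
qed

lemma integral_cos_period:
  assumes e: "0 < \<epsilon>"
  shows "(LINT t|lborel. indicator {- (1 / (2 * \<epsilon>))..1 / (2 * \<epsilon>)} t * cos (2 * pi * \<epsilon> * (real k - real l) * t)) =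
     (if k = l then 1 / \<epsilon> else 0)"
proof (cases "k = l")
  case True then show ?thesis using e by simp
next
  case False
  define c where "c = 2 * pi * \<epsilon> * (real k - real l)"
  have c: "c \<noteq> 0" using False e by (simp add: c_def)
  have "(LINT t|lborel. cos (c * t) * indicator {- (1 / (2 * \<epsilon>))..1 / (2 * \<epsilon>)} t) =
     sin (c * (1 / (2 * \<epsilon>))) / c - sin (c * (- (1 / (2 * \<epsilon>)))) / c"
    by (rule integral_FTC_Icc_real) (use c e in \<open>auto intro!: derivative_eq_intros continuous_intros\<close>)
  moreover have "c * (1 / (2 * \<epsilon>)) = pi * of_int (int k - int l)"
    using e by (simp add: c_def)
  moreover have "sin (pi * of_int (int k - int l)) = 0" by (rule sin_npi_int)
  ultimately have "(LINT t|lborel. cos (c * t) * indicator {- (1 / (2 * \<epsilon>))..1 / (2 * \<epsilon>)} t) = 0"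
    by (simp only: mult_minus_right sin_minus)
  then show ?thesis using False by (simp add: c_def mult.commute)
qed

lemma fejer_kernel_integral:
  assumes e: "0 < \<epsilon>"
  shows "(LINT t|lborel. indicator {- (1 / (2 * \<epsilon>))..1 / (2 * \<epsilon>)} t * fejer_kernel \<epsilon> M t) = 1"
    "integrable lborel (\<lambda>t. indicator {- (1 / (2 * \<epsilon>))..1 / (2 * \<epsilon>)} t * fejer_kernel \<epsilon> M t)"
proof -
  let ?I = "indicator {- (1 / (2 * \<epsilon>))..1 / (2 * \<epsilon>)} :: real \<Rightarrow> real"
  have i: "integrable lborel (\<lambda>t. ?I t * cos (c * t))" for c
    by (rule Bochner_Integration.integrable_bound[OF integrable_indicator_interval])
       (auto simp: indicator_def)
  have eq: "?I t * fejer_kernel \<epsilon> M t = (\<Sum>k\<le>M. \<Sum>l\<le>M. \<epsilon> / (real M + 1) * (?I t * cos (2 * pi * \<epsilon> * (real k - real l) * t)))" for t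
    unfolding fejer_kernel_cos sum_distrib_left by (simp add: mult_ac)
  show "integrable lborel (\<lambda>t. ?I t * fejer_kernel \<epsilon> M t)"
    unfolding eq by (intro Bochner_Integration.integrable_sum integrable_mult_right i)
  have "(LINT t|lborel. ?I t * fejer_kernel \<epsilon> M t) = (\<Sum>k\<le>M. \<Sum>l\<le>M. \<epsilon> / (real M + 1) * (if k = l then 1 / \<epsilon> else 0))"
    unfolding eq integral_cos_period[OF e, symmetric]
    by (simp add: Bochner_Integration.integral_sum Bochner_Integration.integrable_sum i)
  also have "\<dots> = (\<Sum>k\<le>M. \<Sum>l\<le>M. if k = l then 1 / (real M + 1) else 0)"
    using e by (intro sum.cong) auto
  also have "\<dots> = 1" by (simp add: divide_simps)
  finally show "(LINT t|lborel. ?I t * fejer_kernel \<epsilon> M t) = 1" .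
qed

text \<open>Half-open periods tile the line without overlap, as the wrapping of the convolution will
  require; the missing endpoint is a null set.\<close>

lemma fejer_kernel_nn_integral:
  assumes e: "0 < \<epsilon>"
  shows "(\<integral>\<^sup>+t. ennreal (indicator {- (1 / (2 * \<epsilon>))..<1 / (2 * \<epsilon>)} t * fejer_kernel \<epsilon> M t) \<partial>lborel) = 1"
proof -
  have "(\<integral>\<^sup>+t. ennreal (indicator {- (1 / (2 * \<epsilon>))..<1 / (2 * \<epsilon>)} t * fejer_kernel \<epsilon> M t) \<partial>lborel) =
     (\<integral>\<^sup>+t. ennreal (indicator {- (1 / (2 * \<epsilon>))..1 / (2 * \<epsilon>)} t * fejer_kernel \<epsilon> M t) \<partial>lborel)"
    using AE_lborel_singleton[of "1 / (2 * \<epsilon>)"]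
    by (intro nn_integral_cong_AE) (auto simp: indicator_def)
  also have "\<dots> = ennreal (LINT t|lborel. indicator {- (1 / (2 * \<epsilon>))..1 / (2 * \<epsilon>)} t * fejer_kernel \<epsilon> M t)"
    by (intro nn_integral_eq_integral fejer_kernel_integral e)
       (use e fejer_kernel_nonneg in \<open>auto simp: indicator_def\<close>)
  finally show ?thesis by (simp add: fejer_kernel_integral[OF e])
qed

text \<open>Jordan's inequality: \<open>sin\<close> is concave on this interval and lies above its
  chord.\<close>

lemma jordan_sin:
  assumes "0 \<le> x" "x \<le> pi / 2" shows "2 / pi * x \<le> sin x"
proof -
  have "convex_on {0..pi/2} (\<lambda>x. - sin x)"
    by (rule f''_ge0_imp_convex[where f'="\<lambda>x. - cos x" and f''="sin"])
       (auto intro!: derivative_eq_intros sin_ge_zero)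
  from convex_onD_Icc[OF this, of "2 / pi * x"] assms show ?thesis
    by (simp add: field_simps)
qed

text \<open>Geometric series: the sum times \<open>1 - z\<close> has modulus at most 2, while
  \<open>cmod (1 - z) = 2 * sin (pi * \<epsilon> * \<bar>t\<bar>)\<close> is at least
  \<open>4 * \<epsilon> * \<bar>t\<bar>\<close> by \<open>jordan_sin\<close>, applicable within half
  a period.\<close>

lemma fejer_kernel_decay:
  assumes e: "0 < \<epsilon>" and t: "t \<noteq> 0" "\<bar>t\<bar> \<le> 1 / (2 * \<epsilon>)"
  shows "fejer_kernel \<epsilon> M t \<le> 1 / (4 * \<epsilon> * (real M + 1)) * (1 / t\<^sup>2)"
proof -
  define z where "z = cis (2 * pi * \<epsilon> * t)"
  have zk: "cis (2 * pi * \<epsilon> * real k * t) = z ^ k" for k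
    by (simp only: z_def Complex.DeMoivre mult_ac)
  have "(1 - z) * (\<Sum>k\<le>M. z ^ k) = 1 - z ^ Suc M" 
    using one_diff_power_eq[of z "Suc M"] by (simp only: lessThan_Suc_atMost)
  then have "cmod (1 - z) * cmod (\<Sum>k\<le>M. z ^ k) = cmod (1 - z ^ Suc M)"
    by (simp flip: norm_mult)
  also have "\<dots> \<le> cmod 1 + cmod (z ^ Suc M)" by (rule norm_triangle_ineq4)
  also have "\<dots> = 2" by (simp add: z_def norm_mult norm_power)
  finally have 1: "cmod (1 - z) * cmod (\<Sum>k\<le>M. z ^ k) \<le> 2" .
  have "(cmod (1 - z))\<^sup>2 = (1 - cos (2 * (pi * \<epsilon> * t)))\<^sup>2 + (sin (2 * (pi * \<epsilon> * t)))\<^sup>2"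
    by (simp add: z_def cmod_power2 mult_ac)
  also have "\<dots> = (2 * sin (pi * \<epsilon> * t))\<^sup>2"
    unfolding sin_double cos_double_sin
    using sin_cos_squared_add[of "pi * \<epsilon> * t"] by (simp add: power2_eq_square) algebra
  also have "\<dots> = (2 * sin (pi * \<epsilon> * \<bar>t\<bar>))\<^sup>2" by (simp add: abs_if)
  finally have 2: "(cmod (1 - z))\<^sup>2 = (2 * sin (pi * \<epsilon> * \<bar>t\<bar>))\<^sup>2" .
  have "2 / pi * (pi * \<epsilon> * \<bar>t\<bar>) \<le> sin (pi * \<epsilon> * \<bar>t\<bar>)"
    by (rule jordan_sin) (use e t in \<open>auto simp: field_simps\<close>)
  then have 3: "(4 * \<epsilon> * \<bar>t\<bar>)\<^sup>2 \<le> (cmod (1 - z))\<^sup>2"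
    unfolding 2 using e by (intro power_mono) auto
  have "(4 * \<epsilon> * \<bar>t\<bar>)\<^sup>2 * (cmod (\<Sum>k\<le>M. z ^ k))\<^sup>2 \<le> (cmod (1 - z))\<^sup>2 * (cmod (\<Sum>k\<le>M. z ^ k))\<^sup>2"
    by (intro mult_right_mono 3) auto
  also have "\<dots> \<le> 2\<^sup>2" unfolding power_mult_distrib[symmetric] by (intro power_mono 1) auto
  finally have "(cmod (\<Sum>k\<le>M. z ^ k))\<^sup>2 \<le> 1 / (4 * \<epsilon>\<^sup>2 * t\<^sup>2)"
    using e t by (simp add: field_simps power_mult_distrib)
  then have "\<epsilon> / (real M + 1) * (cmod (\<Sum>k\<le>M. z ^ k))\<^sup>2 \<le> \<epsilon> / (real M + 1) * (1 / (4 * \<epsilon>\<^sup>2 * t\<^sup>2))"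
    using e by (intro mult_left_mono) auto
  also have "\<dots> = 1 / (4 * \<epsilon> * (real M + 1)) * (1 / t\<^sup>2)"
    using e t by (simp add: divide_simps power2_eq_square)
  finally show ?thesis by (simp add: fejer_kernel_def zk)
qed

lemma nn_integral_inverse_square_tail:
  assumes "0 < (d::real)"
  shows "(\<integral>\<^sup>+t. ennreal (1 / t\<^sup>2) * indicator {d..} t \<partial>lborel) = ennreal (1 / d)"
proof -
  have "(\<integral>\<^sup>+t. ennreal (1 / t\<^sup>2) * indicator {d..} t \<partial>lborel) = ennreal (0 - (- 1 / d))"
  proof (rule nn_integral_FTC_atLeast)
    show "((\<lambda>x::real. - 1 / x) \<longlongrightarrow> 0) at_top" using tendsto_minus[OF tendsto_inverse_0_at_top[OF filterlim_ident]] by (simp add: divide_inverse)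
  qed (use assms in \<open>auto intro!: derivative_eq_intros simp: power2_eq_square\<close>)
  then show ?thesis by simp
qed

lemma fejer_kernel_tail:
  assumes e: "0 < \<epsilon>" and d: "0 < d"
  shows "(\<integral>\<^sup>+t. ennreal (indicator {- (1 / (2 * \<epsilon>))..<1 / (2 * \<epsilon>)} t * fejer_kernel \<epsilon> M t) * indicator {t. d < \<bar>t\<bar>} t \<partial>lborel)
     \<le> ennreal (1 / (2 * \<epsilon> * (real M + 1) * d))"
proof -
  let ?c = "1 / (4 * \<epsilon> * (real M + 1))"
  \<comment> \<open>\<open>?g (0 + (-1) * t)\<close> below is the reflected copy for negative
    \<open>t\<close>, written as an affine map so that the substitution rule applies.\<close>
  let ?g = "\<lambda>t::real. ennreal (1 / t\<^sup>2) * indicator {d..} t"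
  have "(\<integral>\<^sup>+t. ennreal (indicator {- (1 / (2 * \<epsilon>))..<1 / (2 * \<epsilon>)} t * fejer_kernel \<epsilon> M t) * indicator {t. d < \<bar>t\<bar>} t \<partial>lborel)
    \<le> (\<integral>\<^sup>+t. ennreal ?c * (?g t + ?g (0 + (-1) * t)) \<partial>lborel)"
  proof (rule nn_integral_mono)
    fix t
    show "ennreal (indicator {- (1 / (2 * \<epsilon>))..<1 / (2 * \<epsilon>)} t * fejer_kernel \<epsilon> M t) * indicator {t. d < \<bar>t\<bar>} t
       \<le> ennreal ?c * (?g t + ?g (0 + (-1) * t))"
    proof (cases "d < \<bar>t\<bar> \<and> t \<in> {- (1 / (2 * \<epsilon>))..<1 / (2 * \<epsilon>)}")
      case True
      then have "ennreal (fejer_kernel \<epsilon> M t) \<le> ennreal (?c * (1 / t\<^sup>2))"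
        by (intro ennreal_leI fejer_kernel_decay e) (use d in auto)
      also have "\<dots> = ennreal ?c * ennreal (1 / t\<^sup>2)" using e by (intro ennreal_mult) auto
      also have "\<dots> \<le> ennreal ?c * (?g t + ?g (0 + (-1) * t))"
        using True by (intro mult_left_mono) (auto simp: indicator_def abs_if split: if_splits)
      finally show ?thesis using True by simp
    qed (auto simp: indicator_def)
  qed
  also have "\<dots> = ennreal ?c * ((\<integral>\<^sup>+t. ?g t \<partial>lborel) + (\<integral>\<^sup>+t. ?g (0 + (-1) * t) \<partial>lborel))"
    by (subst nn_integral_cmult, measurable, subst nn_integral_add) auto
  also have "(\<integral>\<^sup>+t. ?g (0 + (-1) * t) \<partial>lborel) = (\<integral>\<^sup>+t. ?g t \<partial>lborel)"
    by (subst (2) nn_integral_real_affine[where c="-1" and t=0]) auto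
  also have "(\<integral>\<^sup>+t. ?g t \<partial>lborel) = ennreal (1 / d)" by (rule nn_integral_inverse_square_tail[OF d])
  also have "ennreal ?c * (ennreal (1 / d) + ennreal (1 / d)) = ennreal (?c * (1 / d + 1 / d))"
    using e d by (subst ennreal_plus[symmetric], simp, simp, subst ennreal_mult[symmetric]) auto
  also have "?c * (1 / d + 1 / d) = 1 / (2 * \<epsilon> * (real M + 1) * d)"
    using e d by (simp add: divide_simps)
  finally show ?thesis .
qed

text \<open>On the bounded interval \<open>norm (f x)\<close> is dominated by
  \<open>1 + (norm (f x))\<^sup>2\<close>.\<close>

lemma L2_fun_integrable_bounded_support:
  fixes f :: "real \<Rightarrow> complex"
  assumes f: "f \<in> L2_fun" and s: "AE x in lborel. x \<notin> {a..b} \<longrightarrow> f x = 0"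
  shows "integrable lborel f"
proof (rule Bochner_Integration.integrable_bound)
  show "integrable lborel (\<lambda>x. indicator {a..b} x + (norm (f x))\<^sup>2)"
    by (intro Bochner_Integration.integrable_add integrable_indicator_interval L2_funD f)
  have "norm (f x) \<le> norm (indicator {a..b} x + (norm (f x))\<^sup>2)" if "x \<notin> {a..b} \<longrightarrow> f x = 0" for x
  proof (cases "x \<in> {a..b}")
    case True
    have "norm (f x) \<le> 1 + (norm (f x))\<^sup>2"
      using zero_le_power2[of "norm (f x) - 1/2"] by (simp add: power2_eq_square algebra_simps)
    then show ?thesis using True by simp
  qed (use that in simp)
  with s show "AE x in lborel. norm (f x) \<le> norm (indicator {a..b} x + (norm (f x))\<^sup>2)"
    by auto
qed (use f in \<open>auto dest: L2_fun_measurable\<close>)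

text \<open>The kernel at \<open>x - y\<close> is a finite sum of products of a function of
  \<open>x\<close> and one of \<open>y\<close>. The convolution extends over the whole line, where
  the periodic kernel is merely bounded and integrability comes from \<open>f\<close>.\<close>

lemma fejer_mean_convolution:
  assumes f: "integrable lborel f"
  shows "fejer_mean \<epsilon> M f x = (LINT s|lborel. complex_of_real (fejer_kernel \<epsilon> M s) * f (x - s))"
    and "integrable lborel (\<lambda>s. complex_of_real (fejer_kernel \<epsilon> M s) * f (x - s))"
proof -
  have [measurable]: "f \<in> borel_measurable borel" using f by auto
  let ?e = "\<lambda>k l y. cis (2 * pi * \<epsilon> * (real k - real l) * y)"
  have cm [measurable]: "(\<lambda>y. cis (c * y)) \<in> borel_measurable borel" for c
    by (intro borel_measurable_continuous_onI continuous_intros)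
  have cm' [measurable]: "(\<lambda>y. cis (- (c * y))) \<in> borel_measurable borel" for c
    by (intro borel_measurable_continuous_onI continuous_intros)
  have i: "integrable lborel (\<lambda>y. cis (- (2 * pi * \<epsilon> * (real k - real l) * y)) * f y)" for k l
    by (rule Bochner_Integration.integrable_bound[OF f]) (auto simp: norm_mult)
  have K: "complex_of_real (fejer_kernel \<epsilon> M (x - y)) * f y =
     (\<Sum>k\<le>M. \<Sum>l\<le>M. complex_of_real (\<epsilon> / (real M + 1)) *
     (cis (- (2 * pi * \<epsilon> * (real k - real l) * y)) * f y) * ?e k l x)" for y
  proof -
    have "?e k l (x - y) = cis (- (2 * pi * \<epsilon> * (real k - real l) * y)) * ?e k l x" for k l
      by (simp add: cis_mult algebra_simps)
    then show ?thesis unfolding fejer_kernel_expand sum_distrib_right by (simp add: mult_ac)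
  qed
  have I: "integrable lborel (\<lambda>y. complex_of_real (fejer_kernel \<epsilon> M (x - y)) * f y)"
    unfolding K by (intro Bochner_Integration.integrable_sum integrable_mult_left integrable_mult_right i)
  have "fejer_mean \<epsilon> M f x = (LINT y|lborel. complex_of_real (fejer_kernel \<epsilon> M (x - y)) * f y)"
    unfolding K fejer_mean_def
    by (subst Bochner_Integration.integral_sum, intro Bochner_Integration.integrable_sum integrable_mult_left integrable_mult_right i,
        rule sum.cong[OF refl], subst Bochner_Integration.integral_sum, intro integrable_mult_left integrable_mult_right i) simp
  also have "\<dots> = (LINT s|lborel. complex_of_real (fejer_kernel \<epsilon> M s) * f (x - s))"
    using lborel_integral_real_affine[of "-1" "\<lambda>y. complex_of_real (fejer_kernel \<epsilon> M (x - y)) * f y" x] by simp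
  finally show "fejer_mean \<epsilon> M f x = (LINT s|lborel. complex_of_real (fejer_kernel \<epsilon> M s) * f (x - s))" .
  show "integrable lborel (\<lambda>s. complex_of_real (fejer_kernel \<epsilon> M s) * f (x - s))"
    using lborel_integrable_real_affine[OF I, of "-1" x] by simp
qed

lemma norm_sum_sq_le:
  "(norm (\<Sum>i\<in>I. a i :: 'a::real_normed_vector))\<^sup>2 \<le> real (card I) * (\<Sum>i\<in>I. (norm (a i))\<^sup>2)"
proof -
  have "(norm (\<Sum>i\<in>I. a i))\<^sup>2 \<le> (\<Sum>i\<in>I. 1 * norm (a i))\<^sup>2"
    by (intro power_mono) (auto intro: norm_sum)
  also have "\<dots> \<le> (\<Sum>i\<in>I. 1\<^sup>2) * (\<Sum>i\<in>I. (norm (a i))\<^sup>2)"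
    by (rule Cauchy_Schwarz_ineq_sum)
  finally show ?thesis by simp
qed

abbreviation fejer_weight :: "real \<Rightarrow> nat \<Rightarrow> real \<Rightarrow> real" where
  "fejer_weight \<epsilon> M t \<equiv> indicator {- (1 / (2 * \<epsilon>))..<1 / (2 * \<epsilon>)} t * fejer_kernel \<epsilon> M t"

text \<open>For \<open>f\<close> supported in \<open>[0, 1]\<close> and period \<open>1 / \<epsilon> \<ge> 1\<close>, the three terms are all that contribute at
  \<open>x - t\<close> with \<open>x \<in> [0, 1]\<close> and \<open>\<bar>t\<bar> \<le> 1 / (2 \<epsilon>)\<close>.\<close>

definition periodized :: "real \<Rightarrow> (real \<Rightarrow> complex) \<Rightarrow> real \<Rightarrow> complex" where
  "periodized \<epsilon> f z = (\<Sum>m\<in>{-1,0,1::int}. f (z + of_int m / \<epsilon>))"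

text \<open>For \<open>x\<close> in the unit interval only \<open>\<bar>s\<bar> < 1\<close>
  contributes to the convolution, and each such \<open>s\<close> lies in exactly one of three
  neighbouring periods. Moving these pieces into one period leaves the kernel unchanged and wraps
  \<open>f\<close>; since the weight integrates to 1, the error becomes an average of
  differences.\<close>

lemma fejer_mean_periodized:
  assumes f: "integrable lborel f" and supp: "\<forall>x. x \<notin> {0..1} \<longrightarrow> f x = 0"
    and e: "0 < \<epsilon>" "\<epsilon> \<le> 1" and x: "x \<in> {0<..<1}"
  shows "f x - fejer_mean \<epsilon> M f x = (LINT t|lborel. complex_of_real (fejer_weight \<epsilon> M t) *
      (periodized \<epsilon> f x - periodized \<epsilon> f (x - t)))" (is ?eq)
    and "integrable lborel (\<lambda>t. complex_of_real (fejer_weight \<epsilon> M t) *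
      (periodized \<epsilon> f x - periodized \<epsilon> f (x - t)))" (is ?int)
proof -
  have [measurable]: "f \<in> borel_measurable borel" using f by auto
  have P: "1 \<le> 1 / \<epsilon>" using e by simp
  define A where "A = {- (1 / (2 * \<epsilon>))..<1 / (2 * \<epsilon>)}"
  define g where "g m = (\<lambda>s. complex_of_real (indicator A (s + of_int m / \<epsilon>) * fejer_kernel \<epsilon> M s) * f (x - s))" for m :: int
  note I = fejer_mean_convolution[OF f, of \<epsilon> M x]
  have [measurable]: "A \<in> sets borel" by (simp add: A_def)
  have gi: "integrable lborel (g m)" for m
  proof (rule Bochner_Integration.integrable_bound[OF I(2)])
    show "g m \<in> borel_measurable lborel" unfolding g_def by measurable
  qed (auto simp: g_def indicator_def)
  have gsum: "complex_of_real (fejer_kernel \<epsilon> M s) * f (x - s) = (\<Sum>m\<in>{-1,0,1}. g m s)" for s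
  proof (cases "x - s \<in> {0..1}")
    case True
    then have s: "-1 < s" "s < 1" using x by auto
    define H where "H = 1 / (2 * \<epsilon>)"
    have H: "1 / \<epsilon> = 2 * H" "1 / 2 \<le> H" using e P by (auto simp: H_def field_simps)
    \<comment> \<open>Here \<open>A\<close> is \<open>{-H..<H}\<close>, so its three translates tile
      \<open>{-3 * H..<3 * H}\<close>, which contains \<open>s\<close> because
      \<open>1 / 2 \<le> H\<close>.\<close>
    have "indicator A (s - 2 * H) + indicator A s + indicator A (s + 2 * H) = (1::real)"
      unfolding A_def H_def[symmetric] using s H by (auto simp: indicator_def)
    then have "(\<Sum>m\<in>{-1,0,1::int}. indicator A (s + of_int m / \<epsilon>)) = (1::real)"
      using H(1) by (simp add: algebra_simps)
    then have "fejer_kernel \<epsilon> M s = (\<Sum>m\<in>{-1,0,1::int}. indicator A (s + of_int m / \<epsilon>) * fejer_kernel \<epsilon> M s)"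
      by (metis mult_1 sum_distrib_right)
    then show ?thesis unfolding g_def by (metis of_real_sum sum_distrib_right)
  qed (simp add: supp g_def)
  have gshift: "g m (t - of_int m / \<epsilon>) = complex_of_real (fejer_weight \<epsilon> M t) * f (x - t + of_int m / \<epsilon>)" for m t
    using fejer_kernel_periodic[OF e(1), of M t "-m"] by (simp add: g_def A_def algebra_simps)
  have "fejer_mean \<epsilon> M f x = (\<Sum>m\<in>{-1,0,1}. LINT s|lborel. g m s)"
    unfolding I(1) gsum by (intro Bochner_Integration.integral_sum gi)
  also have "\<dots> = (\<Sum>m\<in>{-1,0,1}. LINT t|lborel. complex_of_real (fejer_weight \<epsilon> M t) * f (x - t + of_int m / \<epsilon>))"
    unfolding gshift[symmetric] by (simp only: integral_shift)
  also have "\<dots> = (LINT t|lborel. complex_of_real (fejer_weight \<epsilon> M t) * periodized \<epsilon> f (x - t))"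
    unfolding periodized_def sum_distrib_left
    by (rule Bochner_Integration.integral_sum[symmetric])
       (unfold gshift[symmetric], intro integrable_shift gi)
  finally have T: "fejer_mean \<epsilon> M f x = (LINT t|lborel. complex_of_real (fejer_weight \<epsilon> M t) * periodized \<epsilon> f (x - t))" .
  have i1: "integrable lborel (\<lambda>t. complex_of_real (fejer_weight \<epsilon> M t) * periodized \<epsilon> f (x - t))"
    unfolding periodized_def sum_distrib_left
    by (rule Bochner_Integration.integrable_sum) (unfold gshift[symmetric], intro integrable_shift gi)
  have wi: "integrable lborel (fejer_weight \<epsilon> M)"
    by (rule Bochner_Integration.integrable_bound[OF fejer_kernel_integral(2)[OF e(1), of M]]) (auto simp: indicator_def)
  have "ennreal (LINT t|lborel. fejer_weight \<epsilon> M t) = 1"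
    unfolding fejer_kernel_nn_integral[OF e(1), of M, symmetric]
    by (intro nn_integral_eq_integral[symmetric] wi) (use e fejer_kernel_nonneg in \<open>auto simp: indicator_def\<close>)
  then have w1: "(LINT t|lborel. fejer_weight \<epsilon> M t) = 1" by simp
  have i2: "integrable lborel (\<lambda>t. complex_of_real (fejer_weight \<epsilon> M t) * periodized \<epsilon> f x)"
    by (intro integrable_mult_left integrable_of_real wi)
  \<comment> \<open>This needs \<open>x\<close> in the open interval: for
    \<open>\<epsilon> = 1\<close> and \<open>x\<close> an endpoint, a neighbouring copy of
    \<open>f\<close> could contribute.\<close>
  have "f (x - 1 / \<epsilon>) = 0" "f (x + 1 / \<epsilon>) = 0" using x P supp by auto
  then have px: "periodized \<epsilon> f x = f x" by (simp add: periodized_def)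
  have "(LINT t|lborel. complex_of_real (fejer_weight \<epsilon> M t) * periodized \<epsilon> f x) =
     complex_of_real (LINT t|lborel. fejer_weight \<epsilon> M t) * periodized \<epsilon> f x"
    by (simp only: integral_mult_left_zero integral_complex_of_real)
  then have F: "(LINT t|lborel. complex_of_real (fejer_weight \<epsilon> M t) * periodized \<epsilon> f x) = f x"
    unfolding w1 px by simp
  show ?int using Bochner_Integration.integrable_diff[OF i2 i1] by (simp add: right_diff_distrib)
  show ?eq using Bochner_Integration.integral_diff[OF i2 i1] unfolding F T[symmetric] by (simp add: right_diff_distrib)
qed

text \<open>Jensen's inequality for the probability density \<open>fejer_weight\<close>: the weight
  is split into two square roots, and the first factor in Cauchy-Schwarz integrates to 1.\<close>

lemma fejer_mean_pointwise_error:
  assumes f: "integrable lborel f" and supp: "\<forall>x. x \<notin> {0..1} \<longrightarrow> f x = 0"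
    and e: "0 < \<epsilon>" "\<epsilon> \<le> 1" and x: "x \<in> {0<..<1}"
  shows "ennreal ((norm (f x - fejer_mean \<epsilon> M f x))\<^sup>2) \<le> (\<integral>\<^sup>+t. ennreal (fejer_weight \<epsilon> M t) *
      ennreal ((norm (periodized \<epsilon> f x - periodized \<epsilon> f (x - t)))\<^sup>2) \<partial>lborel)"
proof -
  have [measurable]: "f \<in> borel_measurable borel" using f by auto
  have [measurable]: "periodized \<epsilon> f \<in> borel_measurable borel" unfolding periodized_def by measurable
  let ?w = "\<lambda>t. fejer_weight \<epsilon> M t" let ?d = "\<lambda>t. norm (periodized \<epsilon> f x - periodized \<epsilon> f (x - t))"
  have w0: "0 \<le> ?w t" for t using e fejer_kernel_nonneg by (simp add: indicator_def)
  have "ennreal (norm (f x - fejer_mean \<epsilon> M f x)) \<le> (\<integral>\<^sup>+t. ennreal (norm (complex_of_real (?w t) * (periodized \<epsilon> f x - periodized \<epsilon> f (x - t)))) \<partial>lborel)"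
    using integral_norm_bound_ennreal[OF fejer_mean_periodized(2)[OF assms, of M]]
    by (simp only: fejer_mean_periodized(1)[OF assms, of M])
  also have "\<dots> = (\<integral>\<^sup>+t. ennreal (sqrt (?w t)) * ennreal (sqrt (?w t) * ?d t) \<partial>lborel)"
  proof (intro nn_integral_cong)
    fix t
    have "norm (complex_of_real (?w t) * (periodized \<epsilon> f x - periodized \<epsilon> f (x - t))) = sqrt (?w t) * (sqrt (?w t) * ?d t)"
      unfolding norm_mult norm_of_real abs_of_nonneg[OF w0] using w0[of t] by (simp only: mult.assoc[symmetric] real_sqrt_mult_self abs_of_nonneg)
    then show "ennreal (norm (complex_of_real (?w t) * (periodized \<epsilon> f x - periodized \<epsilon> f (x - t)))) =
        ennreal (sqrt (?w t)) * ennreal (sqrt (?w t) * ?d t)"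
      using w0[of t] by (simp only:) (rule ennreal_mult; simp)
  qed
  finally have "(ennreal (norm (f x - fejer_mean \<epsilon> M f x)))\<^sup>2 \<le> (\<integral>\<^sup>+t. ennreal (sqrt (?w t)) * ennreal (sqrt (?w t) * ?d t) \<partial>lborel)\<^sup>2"
    by (intro power_mono) auto
  also have "\<dots> \<le> (\<integral>\<^sup>+t. (ennreal (sqrt (?w t)))\<^sup>2 \<partial>lborel) * (\<integral>\<^sup>+t. (ennreal (sqrt (?w t) * ?d t))\<^sup>2 \<partial>lborel)"
    by (rule Cauchy_Schwarz_nn_integral) measurable
  also have "(\<integral>\<^sup>+t. (ennreal (sqrt (?w t)))\<^sup>2 \<partial>lborel) = 1"
    using w0 by (simp add: ennreal_power fejer_kernel_nn_integral[OF e(1)])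
  also have "(\<integral>\<^sup>+t. (ennreal (sqrt (?w t) * ?d t))\<^sup>2 \<partial>lborel) = (\<integral>\<^sup>+t. ennreal (?w t) * ennreal ((?d t)\<^sup>2) \<partial>lborel)"
    using w0 by (intro nn_integral_cong) (simp add: ennreal_power power_mult_distrib ennreal_mult[symmetric])
  finally show ?thesis by (simp add: ennreal_power)
qed

text \<open>Squaring a sum of three copies costs the factor 3. The translates of
  \<open>{0<..<1}\<close> by multiples of \<open>1 / \<epsilon> \<ge> 1\<close> are disjoint, so
  together the copies see every part of \<open>u\<close> at most once.\<close>

lemma periodized_modulus:
  assumes f: "f \<in> L2_fun" and e: "0 < \<epsilon>" "\<epsilon> \<le> 1"
  shows "(\<integral>\<^sup>+x. indicator {0<..<1} x * ennreal ((norm (periodized \<epsilon> f x - periodized \<epsilon> f (x - t)))\<^sup>2) \<partial>lborel)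
    \<le> ennreal (3 * (L2_nrm (\<lambda>x. f x - f (x - t)))\<^sup>2)"
proof -
  have [measurable]: "f \<in> borel_measurable borel" using f by (simp add: L2_fun_measurable)
  define u where "u x = f x - f (x - t)" for x
  have [measurable]: "u \<in> borel_measurable borel" unfolding u_def by measurable
  have uL: "u \<in> L2_fun" unfolding u_def by (intro L2_fun_diff f L2_fun_shift)
  have P: "1 \<le> 1 / \<epsilon>" using e by simp
  let ?S = "{-1,0,1::int}"
  have "(\<integral>\<^sup>+x. indicator {0<..<1} x * ennreal ((norm (periodized \<epsilon> f x - periodized \<epsilon> f (x - t)))\<^sup>2) \<partial>lborel)
    \<le> (\<integral>\<^sup>+x. (\<Sum>m\<in>?S. ennreal 3 * (indicator {0<..<1} x * ennreal ((norm (u (x + of_int m / \<epsilon>)))\<^sup>2))) \<partial>lborel)"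
  proof (rule nn_integral_mono)
    fix x
    have "periodized \<epsilon> f x - periodized \<epsilon> f (x - t) = (\<Sum>m\<in>?S. u (x + of_int m / \<epsilon>))"
      by (simp add: periodized_def u_def algebra_simps)
    then have "(norm (periodized \<epsilon> f x - periodized \<epsilon> f (x - t)))\<^sup>2 \<le> 3 * (\<Sum>m\<in>?S. (norm (u (x + of_int m / \<epsilon>)))\<^sup>2)"
      using norm_sum_sq_le[of "\<lambda>m. u (x + of_int m / \<epsilon>)" ?S] by simp
    then have "ennreal ((norm (periodized \<epsilon> f x - periodized \<epsilon> f (x - t)))\<^sup>2) \<le> ennreal (\<Sum>m\<in>?S. 3 * (norm (u (x + of_int m / \<epsilon>)))\<^sup>2)"
      by (intro ennreal_leI) (simp add: sum_distrib_left)
    also have "\<dots> = (\<Sum>m\<in>?S. ennreal 3 * ennreal ((norm (u (x + of_int m / \<epsilon>)))\<^sup>2))"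
      by (subst sum_ennreal[symmetric]) (auto simp: ennreal_mult)
    finally show "indicator {0<..<1} x * ennreal ((norm (periodized \<epsilon> f x - periodized \<epsilon> f (x - t)))\<^sup>2) \<le>
        (\<Sum>m\<in>?S. ennreal 3 * (indicator {0<..<1} x * ennreal ((norm (u (x + of_int m / \<epsilon>)))\<^sup>2)))"
      by (cases "x \<in> {0<..<1}") auto
  qed
  also have "\<dots> = (\<Sum>m\<in>?S. ennreal 3 * (\<integral>\<^sup>+x. indicator {0<..<1} x * ennreal ((norm (u (x + of_int m / \<epsilon>)))\<^sup>2) \<partial>lborel))"
    by (subst nn_integral_sum, measurable, intro sum.cong refl nn_integral_cmult) measurable
  also have "\<dots> = (\<Sum>m\<in>?S. ennreal 3 * (\<integral>\<^sup>+y. indicator {0<..<1} (y - of_int m / \<epsilon>) * ennreal ((norm (u y))\<^sup>2) \<partial>lborel))"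
  proof (intro sum.cong refl arg_cong2[where f="(*)"])
    fix m :: int
    show "(\<integral>\<^sup>+x. indicator {0<..<1} x * ennreal ((norm (u (x + of_int m / \<epsilon>)))\<^sup>2) \<partial>lborel) =
       (\<integral>\<^sup>+y. indicator {0<..<1} (y - of_int m / \<epsilon>) * ennreal ((norm (u y))\<^sup>2) \<partial>lborel)"
      using nn_integral_real_affine[of "\<lambda>x. indicator {0<..<1} x * ennreal ((norm (u (x + of_int m / \<epsilon>)))\<^sup>2)" 1 "- of_int m / \<epsilon>"]
      by simp
  qed
  also have "\<dots> = ennreal 3 * (\<integral>\<^sup>+y. (\<Sum>m\<in>?S. indicator {0<..<1} (y - of_int m / \<epsilon>) * ennreal ((norm (u y))\<^sup>2)) \<partial>lborel)"
  proof -
    have "(\<integral>\<^sup>+y. (\<Sum>m\<in>?S. indicator {0<..<1} (y - of_int m / \<epsilon>) * ennreal ((norm (u y))\<^sup>2)) \<partial>lborel) =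
      (\<Sum>m\<in>?S. \<integral>\<^sup>+y. indicator {0<..<1} (y - of_int m / \<epsilon>) * ennreal ((norm (u y))\<^sup>2) \<partial>lborel)"
      by (rule nn_integral_sum) measurable
    then show ?thesis by (simp only: sum_distrib_left)
  qed
  also have "\<dots> \<le> ennreal 3 * energy u"
  proof (intro mult_left_mono nn_integral_mono)
    fix y
    have "(\<Sum>m\<in>?S. indicator {0<..<1} (y - of_int m / \<epsilon>)) \<le> (1::ennreal)"
    proof -
      have "indicator {0<..<1} (y - r) + indicator {0<..<1} y + indicator {0<..<1} (y + r) \<le> (1::ennreal)" if "1 \<le> r" for r
        using that by (auto simp: indicator_def)
      from this[OF P] show ?thesis by (simp add: algebra_simps)
    qed
    from mult_right_mono[OF this, of "ennreal ((norm (u y))\<^sup>2)"]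
    show "(\<Sum>m\<in>?S. indicator {0<..<1} (y - of_int m / \<epsilon>) * ennreal ((norm (u y))\<^sup>2)) \<le> ennreal ((norm (u y))\<^sup>2)"
      by (simp only: sum_distrib_right mult_1) simp
  qed simp
  also have "\<dots> = ennreal (3 * (L2_nrm (\<lambda>x. f x - f (x - t)))\<^sup>2)"
    unfolding L2_nrm_sq_nn[OF uL, symmetric] by (simp add: ennreal_mult flip: u_def)
  finally show ?thesis .
qed

lemma L2_nrm_shift: "L2_nrm (\<lambda>x::real. f (x - t)) = L2_nrm f"
  unfolding L2_nrm_def by (subst integral_shift[of "\<lambda>x. (norm (f x))\<^sup>2"]) simp

lemma L2_nrm_diff_sq_le:
  assumes "f \<in> L2_fun" "g \<in> L2_fun"
  shows "(L2_nrm (\<lambda>x. f x - g x))\<^sup>2 \<le> 2 * (L2_nrm f)\<^sup>2 + 2 * (L2_nrm g)\<^sup>2"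
proof -
  have "(L2_nrm (\<lambda>x. f x - g x))\<^sup>2 \<le> (LINT x|lborel. 2 * (norm (f x))\<^sup>2 + 2 * (norm (g x))\<^sup>2)"
    unfolding L2_nrm_sq
    by (intro integral_mono L2_funD L2_fun_diff assms Bochner_Integration.integrable_add integrable_mult_right)
       (use norm_add_sq_le[of "f _" "- g _"] in simp)
  also have "\<dots> = 2 * (L2_nrm f)\<^sup>2 + 2 * (L2_nrm g)\<^sup>2"
    unfolding L2_nrm_sq
    by (subst Bochner_Integration.integral_add) (use assms in \<open>auto intro!: L2_funD integrable_mult_right\<close>)
  finally show ?thesis .
qed

lemma fejer_mean_measurable [measurable]: "fejer_mean \<epsilon> M f \<in> borel_measurable borel"
proof -
  have [measurable]: "(\<lambda>y. cis (c * y)) \<in> borel_measurable borel" for c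
    by (intro borel_measurable_continuous_onI continuous_intros)
  show ?thesis unfolding fejer_mean_def by measurable
qed

text \<open>Integrating the pointwise error over \<open>x\<close> and exchanging the integrals
  leaves an average over \<open>t\<close> of translation errors. Shifts up to \<open>d\<close> are
  controlled by \<open>A\<close>; longer ones by the trivial bound
  \<open>4 * (L2_nrm f)\<^sup>2\<close> and the small mass of the kernel beyond
  \<open>d\<close>.\<close>

proposition fejer_mean_error:
  assumes f: "f \<in> L2_fun" and supp: "\<forall>x. x \<notin> {0..1} \<longrightarrow> f x = 0"
    and e: "0 < \<epsilon>" "\<epsilon> \<le> 1" and d: "0 < d" and A: "0 \<le> A"
    and mod: "\<And>t. \<bar>t\<bar> \<le> d \<Longrightarrow> (L2_nrm (\<lambda>x. f x - f (x - t)))\<^sup>2 \<le> A"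
  shows "(\<integral>\<^sup>+x. indicator {0..1} x * ennreal ((norm (f x - fejer_mean \<epsilon> M f x))\<^sup>2) \<partial>lborel)
    \<le> ennreal (3 * (A + 2 * (L2_nrm f)\<^sup>2 / (\<epsilon> * (real M + 1) * d)))"
proof -
  have fm [measurable]: "f \<in> borel_measurable borel" using f by (simp add: L2_fun_measurable)
  have [measurable]: "periodized \<epsilon> f \<in> borel_measurable borel" unfolding periodized_def by measurable
  have fi: "integrable lborel f"
    by (rule L2_fun_integrable_bounded_support[OF f, of 0 1]) (use supp in auto)
  let ?w = "\<lambda>t. ennreal (fejer_weight \<epsilon> M t)"
  let ?D = "\<lambda>x t. ennreal ((norm (periodized \<epsilon> f x - periodized \<epsilon> f (x - t)))\<^sup>2)"
  let ?N = "(L2_nrm f)\<^sup>2"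
  have "(\<integral>\<^sup>+x. indicator {0..1} x * ennreal ((norm (f x - fejer_mean \<epsilon> M f x))\<^sup>2) \<partial>lborel)
    \<le> (\<integral>\<^sup>+x. (\<integral>\<^sup>+t. indicator {0<..<1} x * (?w t * ?D x t) \<partial>lborel) \<partial>lborel)"
  proof (rule nn_integral_mono_AE)
    have "AE x in lborel. x \<noteq> (0::real)" "AE x in lborel. x \<noteq> (1::real)" by (rule AE_lborel_singleton)+
    then show "AE x in lborel. indicator {0..1} x * ennreal ((norm (f x - fejer_mean \<epsilon> M f x))\<^sup>2) \<le>
       (\<integral>\<^sup>+t. indicator {0<..<1} x * (?w t * ?D x t) \<partial>lborel)"
    proof eventually_elim
      case (elim x)
      then show ?case using fejer_mean_pointwise_error[OF fi supp e, of x M]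
        by (cases "x \<in> {0<..<1}") (auto simp: indicator_def)
    qed
  qed
  also have "\<dots> = (\<integral>\<^sup>+t. (\<integral>\<^sup>+x. indicator {0<..<1} x * (?w t * ?D x t) \<partial>lborel) \<partial>lborel)"
    by (rule lborel_pair.Fubini') measurable
  also have "\<dots> = (\<integral>\<^sup>+t. ?w t * (\<integral>\<^sup>+x. indicator {0<..<1} x * ?D x t \<partial>lborel) \<partial>lborel)"
    by (subst nn_integral_cmult[symmetric], measurable, simp only: mult_ac)
  also have "\<dots> \<le> (\<integral>\<^sup>+t. ennreal (3 * A) * ?w t + ennreal (3 * (4 * ?N)) * (?w t * indicator {t. d < \<bar>t\<bar>} t) \<partial>lborel)"
  proof (rule nn_integral_mono)
    fix t
    have le: "(\<integral>\<^sup>+x. indicator {0<..<1} x * ?D x t \<partial>lborel) \<le> ennreal (3 * (L2_nrm (\<lambda>x. f x - f (x - t)))\<^sup>2)"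
      by (rule periodized_modulus[OF f e])
    show "?w t * (\<integral>\<^sup>+x. indicator {0<..<1} x * ?D x t \<partial>lborel) \<le>
       ennreal (3 * A) * ?w t + ennreal (3 * (4 * ?N)) * (?w t * indicator {t. d < \<bar>t\<bar>} t)"
    proof (cases "d < \<bar>t\<bar>")
      case True
      have "(L2_nrm (\<lambda>x. f x - f (x - t)))\<^sup>2 \<le> 4 * ?N"
        using L2_nrm_diff_sq_le[OF f L2_fun_shift[OF f, of t]] by (simp add: L2_nrm_shift)
      then have "ennreal (3 * (L2_nrm (\<lambda>x. f x - f (x - t)))\<^sup>2) \<le> ennreal (3 * (4 * ?N))" by (intro ennreal_leI) simp
      with le have "?w t * (\<integral>\<^sup>+x. indicator {0<..<1} x * ?D x t \<partial>lborel) \<le> ?w t * ennreal (3 * (4 * ?N))"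
        by (intro mult_left_mono) (auto elim: order_trans)
      also have "\<dots> \<le> ennreal (3 * A) * ?w t + ennreal (3 * (4 * ?N)) * (?w t * indicator {t. d < \<bar>t\<bar>} t)"
        using True by (simp add: mult.commute)
      finally show ?thesis .
    next
      case False
      then have "ennreal (3 * (L2_nrm (\<lambda>x. f x - f (x - t)))\<^sup>2) \<le> ennreal (3 * A)"
        using mod by (intro ennreal_leI) simp
      with le have "?w t * (\<integral>\<^sup>+x. indicator {0<..<1} x * ?D x t \<partial>lborel) \<le> ?w t * ennreal (3 * A)"
        by (intro mult_left_mono) (auto elim: order_trans)
      also have "\<dots> \<le> ennreal (3 * A) * ?w t + ennreal (3 * (4 * ?N)) * (?w t * indicator {t. d < \<bar>t\<bar>} t)"
        by (simp add: mult.commute)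
      finally show ?thesis .
    qed
  qed
  also have "\<dots> = ennreal (3 * A) * (\<integral>\<^sup>+t. ?w t \<partial>lborel) + ennreal (3 * (4 * ?N)) * (\<integral>\<^sup>+t. ?w t * indicator {t. d < \<bar>t\<bar>} t \<partial>lborel)"
    by (subst nn_integral_add, measurable, subst nn_integral_cmult, measurable, subst nn_integral_cmult) auto
  also have "\<dots> \<le> ennreal (3 * A) * 1 + ennreal (3 * (4 * ?N)) * ennreal (1 / (2 * \<epsilon> * (real M + 1) * d))"
    unfolding fejer_kernel_nn_integral[OF e(1)]
    by (intro add_mono mult_left_mono fejer_kernel_tail e d order_refl) auto
  also have "\<dots> = ennreal (3 * A + 3 * (4 * ?N) * (1 / (2 * \<epsilon> * (real M + 1) * d)))"
    using A e d by (simp only: mult_1_right) (subst ennreal_mult[symmetric], simp, simp, subst ennreal_plus[symmetric], auto)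
  also have "3 * A + 3 * (4 * ?N) * (1 / (2 * \<epsilon> * (real M + 1) * d)) = 3 * (A + 2 * ?N / (\<epsilon> * (real M + 1) * d))"
    using e d by (simp add: divide_simps)
  finally show ?thesis .
qed

section \<open>Sum rules of the scaling filter\<close>

lemma AE_lborel_null_set:
  assumes "AE x in lborel. P x"
  obtains N where "N \<in> sets borel" "emeasure lborel N = 0" "{x. \<not> P x} \<subseteq> N"
proof (rule AE_E[OF assms])
  fix N assume N: "{x \<in> space lborel. \<not> P x} \<subseteq> N" "emeasure lborel N = 0" "N \<in> sets lborel"
  show thesis
  proof (rule that)
    show "N \<in> sets borel" using N(3) by simp
    show "emeasure lborel N = 0" by (rule N(2))
    show "{x. \<not> P x} \<subseteq> N" using N(1) by simp
  qed
qed

lemma AE_lborel_affine: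
  fixes P :: "real \<Rightarrow> bool"
  assumes "AE x in lborel. P x" "c \<noteq> 0"
  shows "AE x in lborel. P (t + c * x)"
proof -
  obtain N where N [measurable]: "N \<in> sets borel" and N0: "emeasure lborel N = 0" and PN: "{x. \<not> P x} \<subseteq> N"
    by (rule AE_lborel_null_set[OF assms(1)])
  have "(\<integral>\<^sup>+x. indicator N x \<partial>lborel) = 0" using N0 by simp
  then have "(\<integral>\<^sup>+x. indicator N (t + c * x) \<partial>lborel) = 0"
    using nn_integral_real_affine[of "indicator N" c t] assms(2) by auto
  then have "AE x in lborel. indicator N (t + c * x) = (0::ennreal)"
    by (subst (asm) nn_integral_0_iff_AE) auto
  then show ?thesis by eventually_elim (use PN in \<open>auto simp: indicator_def split: if_splits\<close>)
qed

text \<open>The balls on which \<open>f\<close> vanishes almost everywhere may be uncountably many.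
  By Lindelof countably many of them have the same union, and their exceptional null sets can be
  collected.\<close>

lemma ess_support_AE: "AE x in lborel. x \<notin> ess_support f \<longrightarrow> f x = 0"
proof -
  define F where "F = {ball x e | x e. 0 < e \<and> (AE y in lborel. y \<in> ball x e \<longrightarrow> f y = 0)}"
  have "\<And>S. S \<in> F \<Longrightarrow> open S" by (auto simp: F_def)
  then obtain F' where F': "F' \<subseteq> F" "countable F'" "\<Union>F' = \<Union>F" by (rule Lindelof)
  have "AE y in lborel. \<forall>B\<in>F'. y \<in> B \<longrightarrow> f y = 0"
    using F' by (subst AE_ball_countable) (auto simp: F_def)
  then show ?thesis
  proof eventually_elim
    case (elim y)
    show ?case
    proof
      assume "y \<notin> ess_support f"
      then obtain e where "e > 0" "AE z in lborel. z \<in> ball y e \<longrightarrow> f z = 0"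
        by (auto simp: ess_support_def)
      then have "ball y e \<in> F" unfolding F_def by blast
      then have "y \<in> \<Union>F" using \<open>e > 0\<close> by (auto intro!: bexI[of _ "ball y e"])
      then show "f y = 0" using elim F'(3) by blast
    qed
  qed
qed

text \<open>An indexed form of span membership that asks neither for distinct generators nor for
  square integrability, so that refinements chain by \<open>ae_comb_trans\<close>.\<close>

definition ae_comb :: "('i \<Rightarrow> 'a::euclidean_space \<Rightarrow> complex) \<Rightarrow> 'i set \<Rightarrow> ('a \<Rightarrow> complex) \<Rightarrow> bool" where
  "ae_comb F I f \<longleftrightarrow> (\<exists>c. AE x in lborel. f x = (\<Sum>i\<in>I. c i * F i x))"

lemma ae_comb_trans:
  assumes "finite I" "\<And>i. i \<in> I \<Longrightarrow> ae_comb G K (F i)" "ae_comb F I f"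
  shows "ae_comb G K f"
proof -
  obtain c where c: "AE x in lborel. f x = (\<Sum>i\<in>I. c i * F i x)" using assms by (auto simp: ae_comb_def)
  have "\<forall>i\<in>I. \<exists>d. AE x in lborel. F i x = (\<Sum>k\<in>K. d k * G k x)" using assms by (auto simp: ae_comb_def)
  then obtain d where d: "\<And>i. i \<in> I \<Longrightarrow> AE x in lborel. F i x = (\<Sum>k\<in>K. d i k * G k x)" by metis
  have "AE x in lborel. \<forall>i\<in>I. F i x = (\<Sum>k\<in>K. d i k * G k x)"
    using assms(1) d by (subst AE_finite_all) auto
  with c have "AE x in lborel. f x = (\<Sum>k\<in>K. (\<Sum>i\<in>I. c i * d i k) * G k x)"
  proof eventually_elim
    case (elim x)
    have "f x = (\<Sum>i\<in>I. \<Sum>k\<in>K. c i * d i k * G k x)"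
      using elim by (simp add: sum_distrib_left mult.assoc)
    also have "\<dots> = (\<Sum>k\<in>K. (\<Sum>i\<in>I. c i * d i k) * G k x)"
      by (subst sum.swap) (simp add: sum_distrib_right)
    finally show ?case .
  qed
  then show ?thesis unfolding ae_comb_def by (intro exI)
qed

lemma ae_comb_base: "finite K \<Longrightarrow> k \<in> K \<Longrightarrow> AE x in lborel. f x = G k x \<Longrightarrow> ae_comb G K f"
  unfolding ae_comb_def
  by (intro exI[of _ "\<lambda>i. if i = k then 1 else 0"]) (auto simp: if_distrib[of "\<lambda>c. c * _"] cong: if_cong)

lemma ae_comb_mono:
  assumes "ae_comb F I f" "I \<subseteq> K" "finite K"
  shows "ae_comb F K f"
  by (rule ae_comb_trans[OF _ _ assms(1)]) (use assms finite_subset in \<open>auto intro: ae_comb_base\<close>)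

section \<open>Polynomials in the binomial basis and sum rules from vanishing moments\<close>

lemma poly_gbinomial: "\<exists>B::real poly. degree B = k \<and> (\<forall>x. poly B x = x gchoose k)"
proof -
  let ?P = "\<Prod>i<k. [:- real i, 1:]"
  have "degree (smult (1 / fact k) ?P) = k"
    by (simp add: degree_prod_eq_sum_degree)
  moreover have "poly (smult (1 / fact k) ?P) x = x gchoose k" for x
    by (simp add: poly_prod gbinomial_prod_rev atLeast0LessThan)
  ultimately show ?thesis by blast
qed

text \<open>The binomial polynomial of index \<open>i\<close> has exact degree \<open>i\<close>, so
  subtracting a multiple of the top one lowers the degree. Binomials are the basis wanted because
  they are the weights in \<open>edge_fun\<close>.\<close>

lemma poly_gbinomial_basis:
  fixes q :: "real poly"
  assumes "degree q \<le> k"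
  shows "\<exists>a. \<forall>x. poly q x = (\<Sum>i\<le>k. a i * (x gchoose i))"
  using assms
proof (induction k arbitrary: q)
  case 0
  then obtain c where "q = [:c:]" by (metis degree_0_id le_zero_eq)
  then show ?case by (intro exI[of _ "\<lambda>_. c"]) simp
next
  case (Suc k)
  obtain B :: "real poly" where B: "degree B = Suc k" "\<And>x. poly B x = x gchoose Suc k"
    using poly_gbinomial by blast
  define c where "c = coeff q (Suc k) / coeff B (Suc k)"
  have B0: "coeff B (Suc k) \<noteq> 0" using B(1) by (metis Zero_neq_Suc degree_0 leading_coeff_0_iff)
  have "degree (q - smult c B) \<le> k"
  proof (rule degree_le, intro allI impI)
    fix i assume "k < i"
    then show "coeff (q - smult c B) i = 0"
      using Suc.prems B(1) B0 by (cases "i = Suc k") (auto simp: c_def coeff_eq_0)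
  qed
  from Suc.IH[OF this] obtain a where a: "\<And>x. poly (q - smult c B) x = (\<Sum>i\<le>k. a i * (x gchoose i))" by blast
  have "poly q x = (\<Sum>i\<le>Suc k. (a(Suc k := c)) i * (x gchoose i))" for x
    using a[of x] B(2)[of x] by (simp add: algebra_simps)
  then show ?case by blast
qed

definition parity_sign :: "int \<Rightarrow> real" where
  "parity_sign k = (if even k then 1 else -1)"

lemma parity_sign_powi: "(-1) powi k = parity_sign k"
  by (simp add: parity_sign_def power_int_minus_left)

text \<open>The facts about \<open>\<phi>\<close> are collected in a form that is stable under the
  reflection \<open>\<phi> (1 - x)\<close>, so that results on the left boundary can be interpreted
  again for the right one. The vanishing moments of the wavelet appear as
  \<open>sum_rule\<close>.\<close>

locale scaling_function =
  fixes p :: nat and \<phi> :: "real \<Rightarrow> real" and h :: "int \<Rightarrow> real"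
  assumes p_pos: "1 \<le> p"
    and meas [measurable]: "\<phi> \<in> borel_measurable borel"
    and sq: "integrable lborel (\<lambda>x. (\<phi> x)\<^sup>2)"
    and supp: "AE x in lborel. x \<notin> {1 - real p..real p} \<longrightarrow> \<phi> x = 0"
    and orth: "\<And>n::int. (LINT x|lborel. \<phi> x * \<phi> (x - of_int n)) = (if n = 0 then 1 else 0)"
    and h_supp: "\<And>k. k \<notin> {1 - int p..int p} \<Longrightarrow> h k = 0"
    and refine: "AE x in lborel. \<phi> x = sqrt 2 * (\<Sum>k\<in>{1 - int p..int p}. h k * \<phi> (2 * x - of_int k))"
    and sum_rule: "\<And>q::real poly. degree q < p \<Longrightarrow> (\<Sum>k\<in>{1 - int p..int p}. parity_sign k * h k * poly q (of_int k)) = 0"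

text \<open>By the two-scale equation, the \<open>m\<close>-th moment of \<open>\<psi>\<close> is a
  combination of the discrete moments of \<open>g\<close> of order at most \<open>m\<close>. By
  induction the lower ones vanish, and the one of order \<open>m\<close> carries the factor
  \<open>\<mu> 0\<close>, which is nonzero.\<close>

lemma sum_rule_of_vanishing_moments:
  fixes \<phi> \<psi> :: "real \<Rightarrow> real" and g :: "int \<Rightarrow> real"
  assumes sq: "(\<lambda>x. complex_of_real (\<phi> x)) \<in> L2_fun" and supp: "AE x in lborel. x \<notin> {a..b} \<longrightarrow> \<phi> x = 0"
    and m0: "(LINT x|lborel. \<phi> x) \<noteq> 0" and fin: "finite D" and m\<psi>: "\<psi> \<in> borel_measurable borel"
    and \<psi>: "AE x in lborel. \<psi> x = sqrt 2 * (\<Sum>k\<in>D. g k * \<phi> (2 * x - of_int k))"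
    and van: "\<And>m. m < p \<Longrightarrow> (LINT x|lborel. x ^ m * \<psi> x) = 0"
    and q: "degree q < p"
  shows "(\<Sum>k\<in>D. g k * poly q (of_int k)) = 0"
proof -
  have m [measurable]: "\<phi> \<in> borel_measurable borel" using L2_fun_measurable[OF sq] by (simp add: borel_measurable_complex_iff)
  have i1: "integrable lborel \<phi>"
    using L2_fun_integrable_bounded_support[OF sq, of a b] supp by (auto simp: complex_of_real_integrable_eq)
  have i: "integrable lborel (\<lambda>x. x ^ m * \<phi> x)" for m
  proof (rule Bochner_Integration.integrable_bound)
    show "integrable lborel (\<lambda>x. (max \<bar>a\<bar> \<bar>b\<bar>) ^ m * \<phi> x)" by (intro integrable_mult_right i1)
    have le: "\<bar>x\<bar> \<le> max \<bar>a\<bar> \<bar>b\<bar>" if "x \<in> {a..b}" for x using that by auto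
    show "AE x in lborel. norm (x ^ m * \<phi> x) \<le> norm ((max \<bar>a\<bar> \<bar>b\<bar>) ^ m * \<phi> x)"
      using supp
    proof eventually_elim
      case (elim x)
      then show ?case using le[of x]
        by (cases "x \<in> {a..b}") (auto simp: abs_mult power_abs intro!: mult_right_mono power_mono)
    qed
  qed measurable
  define \<mu> where "\<mu> m = (LINT x|lborel. x ^ m * \<phi> x)" for m
  have scaled: "(LINT x|lborel. x ^ m * \<phi> (2 * x - of_int k)) = 1 / 2 ^ Suc m * (\<Sum>l\<le>m. real (m choose l) * of_int k ^ l * \<mu> (m - l))"
    "integrable lborel (\<lambda>x. x ^ m * \<phi> (2 * x - of_int k))" for m and k :: int
  proof -
    \<comment> \<open>The substitution \<open>x = (k + y) / 2\<close> moves the translate to the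
      origin; the binomial theorem then separates \<open>k\<close> from \<open>y\<close>.\<close>
    have eq: "(of_int k / 2 + 1 / 2 * y) ^ m * \<phi> (2 * (of_int k / 2 + 1 / 2 * y) - of_int k) =
       1 / 2 ^ m * (\<Sum>l\<le>m. real (m choose l) * of_int k ^ l * (y ^ (m - l) * \<phi> y))" for y
    proof -
      have "(of_int k / 2 + 1 / 2 * y) ^ m = (1 / 2) ^ m * (of_int k + y) ^ m"
        by (subst power_mult_distrib[symmetric]) (simp add: add_divide_distrib)
      then show ?thesis
        by (simp add: binomial_ring sum_distrib_right power_one_over mult.assoc)
    qed
    have ii: "integrable lborel (\<lambda>y. 1 / 2 ^ m * (\<Sum>l\<le>m. real (m choose l) * of_int k ^ l * (y ^ (m - l) * \<phi> y)))"
      by (intro integrable_mult_right Bochner_Integration.integrable_sum i)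
    show "(LINT x|lborel. x ^ m * \<phi> (2 * x - of_int k)) = 1 / 2 ^ Suc m * (\<Sum>l\<le>m. real (m choose l) * of_int k ^ l * \<mu> (m - l))"
      unfolding \<mu>_def
      by (subst lborel_integral_real_affine[of "1/2" _ "of_int k / 2"], simp, unfold eq)
         (simp add: i Bochner_Integration.integral_sum integrable_mult_right del: of_int_mult)
    show "integrable lborel (\<lambda>x. x ^ m * \<phi> (2 * x - of_int k))"
      using ii unfolding eq[symmetric]
      by (subst (asm) lborel_integrable_real_affine_iff[of "1/2" _ "of_int k / 2"]) simp
  qed
  have mom: "(\<Sum>k\<in>D. g k * of_int k ^ m) = 0" if "m < p" for m
    using that
  proof (induction m rule: less_induct)
    case (less m)
    have "0 = (LINT x|lborel. x ^ m * \<psi> x)" using van less.prems by simp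
    also have "\<dots> = (LINT x|lborel. (\<Sum>k\<in>D. sqrt 2 * g k * (x ^ m * \<phi> (2 * x - of_int k))))"
    proof (rule integral_cong_AE)
      show "AE x in lborel. x ^ m * \<psi> x = (\<Sum>k\<in>D. sqrt 2 * g k * (x ^ m * \<phi> (2 * x - of_int k)))"
        using \<psi> by eventually_elim (simp add: sum_distrib_left mult_ac)
    qed (use m\<psi> in measurable)
    also have "\<dots> = (\<Sum>k\<in>D. sqrt 2 * g k * (1 / 2 ^ Suc m * (\<Sum>l\<le>m. real (m choose l) * of_int k ^ l * \<mu> (m - l))))"
      by (subst Bochner_Integration.integral_sum) (auto intro!: scaled integrable_mult_right simp: scaled)
    also have "\<dots> = sqrt 2 / 2 ^ Suc m * (\<Sum>l\<le>m. real (m choose l) * \<mu> (m - l) * (\<Sum>k\<in>D. g k * of_int k ^ l))"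
      unfolding sum_distrib_left by (subst sum.swap) (simp add: mult_ac)
    also have "(\<Sum>l\<le>m. real (m choose l) * \<mu> (m - l) * (\<Sum>k\<in>D. g k * of_int k ^ l)) =
        \<mu> 0 * (\<Sum>k\<in>D. g k * of_int k ^ m) + (\<Sum>l<m. real (m choose l) * \<mu> (m - l) * (\<Sum>k\<in>D. g k * of_int k ^ l))"
      unfolding lessThan_Suc_atMost[symmetric] by simp
    also have "(\<Sum>l<m. real (m choose l) * \<mu> (m - l) * (\<Sum>k\<in>D. g k * of_int k ^ l)) = 0"
      by (rule sum.neutral) (use less in auto)
    finally show ?case using m0 by (simp add: \<mu>_def)
  qed
  have "(\<Sum>k\<in>D. g k * poly q (of_int k)) = (\<Sum>i\<le>degree q. coeff q i * (\<Sum>k\<in>D. g k * of_int k ^ i))"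
    unfolding poly_altdef sum_distrib_left by (subst sum.swap) (simp add: mult_ac)
  also have "\<dots> = 0" by (rule sum.neutral) (use mom q in auto)
  finally show ?thesis .
qed

lemma sum_reflect_int:
  "(\<Sum>k\<in>{1 - int p..int p}. F (1 - k)) = (\<Sum>k\<in>{1 - int p..int p}. F k)"
  by (rule sum.reindex_bij_witness[of _ "\<lambda>k. 1 - k" "\<lambda>k. 1 - k"]) auto

lemma daubechies_scaling_function:
  assumes "daubechies_pair p \<phi> \<psi>"
  shows "\<exists>h. scaling_function p \<phi> h"
proof -
  note D = assms[unfolded daubechies_pair_def]
  obtain h where h: "\<forall>k. k \<notin> {1 - int p..int p} \<longrightarrow> h k = 0"
    "AE x in lborel. \<phi> x = sqrt 2 * (\<Sum>k\<in>{1 - int p..int p}. h k * \<phi> (2 * x - of_int k))"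
    "AE x in lborel. \<psi> x = sqrt 2 * (\<Sum>k\<in>{1 - int p..int p}. (-1) powi k * h (1 - k) * \<phi> (2 * x - of_int k))"
    using D by blast
  have supp: "AE x in lborel. x \<notin> {1 - real p..real p} \<longrightarrow> \<phi> x = 0"
    using ess_support_AE[of \<phi>] D by simp
  have m\<phi> [measurable]: "\<phi> \<in> borel_measurable borel" and i\<phi>: "integrable lborel (\<lambda>x. (\<phi> x)\<^sup>2)"
    and m\<psi>: "\<psi> \<in> borel_measurable borel" and m0: "(LINT x|lborel. \<phi> x) = 1" and p: "p \<ge> 1"
    and orth: "\<forall>n::int. (LINT x|lborel. \<phi> x * \<phi> (x - of_int n)) = (if n = 0 then 1 else 0)"
    and van: "\<forall>m<p. (LINT x|lborel. x ^ m * \<psi> x) = 0"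
    using D by blast+
  have L2: "(\<lambda>x. complex_of_real (\<phi> x)) \<in> L2_fun" using i\<phi> by (simp add: L2_fun_def)
  have "(\<Sum>k\<in>{1 - int p..int p}. parity_sign k * h k * poly q (of_int k)) = 0" if q: "degree q < p" for q :: "real poly"
  proof -
    \<comment> \<open>Composing \<open>q\<close> with \<open>1 - x\<close> undoes the index reversal
      of the mirror filter; as \<open>k\<close> and \<open>1 - k\<close> have opposite parity, only
      a global minus sign remains.\<close>
    have "(\<Sum>k\<in>{1 - int p..int p}. ((-1) powi k * h (1 - k)) * poly (pcompose q [:1, -1:]) (of_int k)) = 0"
      by (rule sum_rule_of_vanishing_moments[OF L2 supp, of _ \<psi> _ p])
         (use m0 m\<psi> van h(3) q in \<open>auto simp: degree_pcompose\<close>)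
    also have "(\<Sum>k\<in>{1 - int p..int p}. ((-1) powi k * h (1 - k)) * poly (pcompose q [:1, -1:]) (of_int k)) =
       (\<Sum>k\<in>{1 - int p..int p}. - (parity_sign (1 - k) * h (1 - k) * poly q (of_int (1 - k))))"
      by (intro sum.cong refl) (auto simp: parity_sign_powi poly_pcompose parity_sign_def)
    also have "\<dots> = - (\<Sum>k\<in>{1 - int p..int p}. parity_sign k * h k * poly q (of_int k))"
      using sum_reflect_int[of "\<lambda>k. parity_sign k * h k * poly q (of_int k)" p] by (simp add: sum_negf)
    finally show ?thesis by simp
  qed
  then have "scaling_function p \<phi> h"
    using p m\<phi> i\<phi> supp orth h by unfold_locales auto
  then show ?thesis by (rule exI[of "scaling_function p \<phi>"])
qed

context scaling_function
begin

text \<open>The support and the index range of the filter are symmetric under the map from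
  \<open>x\<close> to \<open>1 - x\<close>. It flips parity, so the sum rules change by a global
  sign only.\<close>

lemma reflected: "scaling_function p (\<lambda>x. \<phi> (1 - x)) (\<lambda>k. h (1 - k))"
proof
  show "1 \<le> p" by (rule p_pos)
  show "(\<lambda>x. \<phi> (1 - x)) \<in> borel_measurable borel" by measurable
  show "integrable lborel (\<lambda>x. (\<phi> (1 - x))\<^sup>2)"
    using lborel_integrable_real_affine[OF sq, of "-1" 1] by simp
  show "AE x in lborel. x \<notin> {1 - real p..real p} \<longrightarrow> \<phi> (1 - x) = 0"
    using AE_lborel_affine[OF supp, of "-1" 1] by auto
  show "(LINT x|lborel. \<phi> (1 - x) * \<phi> (1 - (x - of_int n))) = (if n = 0 then 1 else 0)" for n
  proof -
    have "(LINT x|lborel. \<phi> (1 - x) * \<phi> (1 - (x - of_int n))) = (LINT x|lborel. \<phi> x * \<phi> (x - of_int (- n)))"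
      using lborel_integral_real_affine[of "-1" "\<lambda>x. \<phi> x * \<phi> (x - of_int (- n))" 1] by (simp add: algebra_simps)
    then show ?thesis using orth[of "- n"] by simp
  qed
  show "k \<notin> {1 - int p..int p} \<Longrightarrow> h (1 - k) = 0" for k by (rule h_supp) auto
  show "AE x in lborel. \<phi> (1 - x) = sqrt 2 * (\<Sum>k\<in>{1 - int p..int p}. h (1 - k) * \<phi> (1 - (2 * x - of_int k)))"
  proof -
    have "AE x in lborel. \<phi> (1 + (-1) * x) = sqrt 2 * (\<Sum>k\<in>{1 - int p..int p}. h k * \<phi> (2 * (1 + (-1) * x) - of_int k))"
      by (rule AE_lborel_affine[OF refine]) simp
    then show ?thesis
    proof eventually_elim
      case (elim x)
      have "(\<Sum>k\<in>{1 - int p..int p}. h (1 - k) * \<phi> (1 - (2 * x - of_int k))) =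
        (\<Sum>k\<in>{1 - int p..int p}. h (1 - k) * \<phi> (2 * (1 + (-1) * x) - of_int (1 - k)))"
        by (intro sum.cong refl) (simp add: algebra_simps)
      also have "\<dots> = (\<Sum>k\<in>{1 - int p..int p}. h k * \<phi> (2 * (1 + (-1) * x) - of_int k))"
        by (rule sum_reflect_int)
      finally show ?case using elim by simp
    qed
  qed
  fix q :: "real poly" assume q: "degree q < p"
  have "(\<Sum>k\<in>{1 - int p..int p}. parity_sign k * h (1 - k) * poly q (of_int k)) =
     (\<Sum>k\<in>{1 - int p..int p}. - (parity_sign (1 - k) * h (1 - k) * poly (pcompose q [:1, -1:]) (of_int (1 - k))))"
    by (intro sum.cong refl) (auto simp: poly_pcompose parity_sign_def)
  also have "\<dots> = - (\<Sum>k\<in>{1 - int p..int p}. parity_sign k * h k * poly (pcompose q [:1, -1:]) (of_int k))"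
    using sum_reflect_int[of "\<lambda>k. parity_sign k * h k * poly (pcompose q [:1, -1:]) (of_int k)" p] by (simp add: sum_negf)
  also have "\<dots> = 0" by (subst sum_rule) (use q in \<open>auto simp: degree_pcompose\<close>)
  finally show "(\<Sum>k\<in>{1 - int p..int p}. parity_sign k * h (1 - k) * poly q (of_int k)) = 0" .
qed

text \<open>By the sum rules the filter does not distinguish even from odd positions on polynomials of
  degree below \<open>p\<close>, so that subsampling maps polynomials to polynomials.\<close>

lemma subsampled_filter_poly:
  assumes B: "degree B < p"
  shows "\<exists>Q::real poly. degree Q \<le> degree B \<and> (\<forall>(q::int) N. finite N \<longrightarrow> {n. 2 * n - q \<in> {1 - int p..int p}} \<subseteq> N \<longrightarrow>
     (\<Sum>n\<in>N. poly B (of_int n) * h (2 * n - q)) = poly Q (of_int q))"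
proof -
  let ?D = "{1 - int p..int p}"
  \<comment> \<open>Half the sum over all taps, evidently a polynomial in \<open>q\<close>. The sum
    wanted runs only over the taps with \<open>l + q\<close> even.\<close>
  define Q where "Q = (\<Sum>l\<in>?D. smult (h l / 2) (pcompose B [:of_int l / 2, 1 / 2:]))"
  have Q: "poly Q (of_int q) = (\<Sum>l\<in>?D. h l / 2 * poly B (of_int (l + q) / 2))" for q
    unfolding Q_def by (simp add: poly_sum poly_pcompose add_divide_distrib)
  have "degree Q \<le> degree B" unfolding Q_def
    by (intro degree_sum_le) (auto intro!: order_trans[OF degree_smult_le] simp: degree_pcompose)
  moreover have "(\<Sum>n\<in>N. poly B (of_int n) * h (2 * n - q)) = poly Q (of_int q)"
    if N: "finite N" "{n. 2 * n - q \<in> ?D} \<subseteq> N" for q :: int and N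
  proof -
    have "(\<Sum>n\<in>N. poly B (of_int n) * h (2 * n - q)) = (\<Sum>n\<in>{n. 2 * n - q \<in> ?D}. poly B (of_int n) * h (2 * n - q))"
      by (rule sum.mono_neutral_right) (use N h_supp in auto)
    also have "\<dots> = (\<Sum>l\<in>{l\<in>?D. even (l + q)}. poly B (of_int (l + q) / 2) * h l)"
      by (rule sum.reindex_bij_witness[of _ "\<lambda>l. (l + q) div 2" "\<lambda>n. 2 * n - q"])
         (auto elim!: evenE)
    also have "\<dots> = (\<Sum>l\<in>?D. if even (l + q) then poly B (of_int (l + q) / 2) * h l else 0)"
      by (rule sum.inter_filter) simp
    \<comment> \<open>The indicator of \<open>even (l + q)\<close> is
      \<open>(1 + parity_sign l * parity_sign q) / 2\<close>; its second half leads to an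
      alternating sum against a polynomial of degree below \<open>p\<close>.\<close>
    also have "\<dots> = (\<Sum>l\<in>?D. h l / 2 * poly B (of_int (l + q) / 2) +
        parity_sign q / 2 * (parity_sign l * h l * poly (pcompose B [:of_int q / 2, 1 / 2:]) (of_int l)))"
      by (intro sum.cong refl) (auto simp: parity_sign_def poly_pcompose add_divide_distrib add.commute)
    also have "\<dots> = poly Q (of_int q) + parity_sign q / 2 * (\<Sum>l\<in>?D. parity_sign l * h l * poly (pcompose B [:of_int q / 2, 1 / 2:]) (of_int l))"
      by (simp add: Q sum.distrib sum_distrib_left)
    also have "(\<Sum>l\<in>?D. parity_sign l * h l * poly (pcompose B [:of_int q / 2, 1 / 2:]) (of_int l)) = 0"
      by (rule sum_rule) (use B in \<open>auto simp: degree_pcompose\<close>)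
    finally show ?thesis by simp
  qed
  ultimately show ?thesis by blast
qed

end

section \<open>Refinement of the edge functions\<close>

context scaling_function
begin

lemma L2_phi: "(\<lambda>x. complex_of_real (\<phi> x)) \<in> L2_fun"
  using sq by (simp add: L2_fun_def)

lemma AE_phi_affine:
  assumes "c \<noteq> 0"
  shows "AE x in lborel. t + c * x \<notin> {1 - real p..real p} \<longrightarrow> \<phi> (t + c * x) = 0"
  by (rule AE_lborel_affine[OF supp assms])

lemma AE_phi_zoom: "AE x in lborel. 2 * x - a \<notin> {1 - real p..real p} \<longrightarrow> \<phi> (2 * x - a) = 0"
  using AE_phi_affine[of 2 "- a"] by simp

lemma edge_measurable [measurable]: "edge_fun p \<phi> k \<in> borel_measurable borel"
  unfolding edge_fun_def by measurable

lemma L2_edge: "edge_fun p \<phi> k \<in> L2_fun"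
proof -
  let ?S = "\<lambda>x. \<Sum>n=0..2*p-2. complex_of_real (real (n choose k)) * complex_of_real (\<phi> (x - (real p - real n - 1)))"
  have S: "?S \<in> L2_fun"
    using L2_fun_shift[OF L2_phi] by (intro L2_fun_lincomb) auto
  have "edge_fun p \<phi> k x = (if x \<ge> 0 then ?S x else 0)" for x
    by (simp add: edge_fun_def algebra_simps)
  then show ?thesis
    by (intro L2_funI[OF edge_measurable L2_funD[OF S]]) auto
qed

lemma phi_left_gram_schmidt:
  shows "phi_left p \<phi> k \<in> L2_fun"
    and "\<forall>i<k. L2_inner (phi_left p \<phi> k) (phi_left p \<phi> i) = 0"
    and "L2_nrm (phi_left p \<phi> k) = 1 \<or> phi_left p \<phi> k = (\<lambda>x. 0)"
    and "\<exists>c. \<forall>x. phi_left p \<phi> k x = (\<Sum>i\<le>k. c i * edge_fun p \<phi> i x)"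
    and "\<exists>c. AE x in lborel. edge_fun p \<phi> k x = (\<Sum>i\<le>k. c i * phi_left p \<phi> i x)"
proof -
  have "\<And>k. edge_fun p \<phi> k \<in> L2_fun" by (rule L2_edge)
  note g = gram_schmidt_props[of "edge_fun p \<phi>" k, OF this, folded phi_left_def]
  from g show "phi_left p \<phi> k \<in> L2_fun" by (rule conjunct1)
  note g = g[THEN conjunct2]
  from g show "\<forall>i<k. L2_inner (phi_left p \<phi> k) (phi_left p \<phi> i) = 0" by (rule conjunct1)
  note g = g[THEN conjunct2]
  from g show "L2_nrm (phi_left p \<phi> k) = 1 \<or> phi_left p \<phi> k = (\<lambda>x. 0)" by (rule conjunct1)
  note g = g[THEN conjunct2]
  from g show "\<exists>c. \<forall>x. phi_left p \<phi> k x = (\<Sum>i\<le>k. c i * edge_fun p \<phi> i x)" by (rule conjunct1)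
  from g show "\<exists>c. AE x in lborel. edge_fun p \<phi> k x = (\<Sum>i\<le>k. c i * phi_left p \<phi> i x)" by (rule conjunct2)
qed

lemma phi_left_comb_edge:
  assumes "k < p" shows "ae_comb (edge_fun p \<phi>) {..<p} (phi_left p \<phi> k)"
proof -
  obtain c where "\<And>x. phi_left p \<phi> k x = (\<Sum>i\<le>k. c i * edge_fun p \<phi> i x)" using phi_left_gram_schmidt(4) by metis
  then have "ae_comb (edge_fun p \<phi>) {..k} (phi_left p \<phi> k)"
    unfolding ae_comb_def by (intro exI[of _ c] AE_I2)
  then show ?thesis by (rule ae_comb_mono) (use assms in auto)
qed

lemma edge_comb_phi_left:
  assumes "k < p" shows "ae_comb (phi_left p \<phi>) {..<p} (edge_fun p \<phi> k)"
proof -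
  have "ae_comb (phi_left p \<phi>) {..k} (edge_fun p \<phi> k)" unfolding ae_comb_def by (rule phi_left_gram_schmidt(5))
  then show ?thesis by (rule ae_comb_mono) (use assms in auto)
qed

text \<open>The functions of the next finer scale near the left end, not yet normalised: left
  functions followed by interior translates. \<open>edge_zoom_system\<close> starts with the raw
  edge functions instead, for which the refinement can be read off.\<close>

definition zoom_system :: "nat \<Rightarrow> real \<Rightarrow> complex" where
  "zoom_system i x = (if i < p then phi_left p \<phi> i (2 * x) else complex_of_real (\<phi> (2 * x - real i)))"

definition edge_zoom_system :: "nat \<Rightarrow> real \<Rightarrow> complex" where
  "edge_zoom_system i x = (if i < p then edge_fun p \<phi> i (2 * x) else complex_of_real (\<phi> (2 * x - real i)))"

text \<open>The index \<open>r\<close> gives the fine translates the argument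
  \<open>2 * x + r - p + 1\<close>, the shape of the terms of \<open>edge_fun\<close> at
  \<open>2 * x\<close>.\<close>

lemma filter_reindex:
  "(\<Sum>l\<in>{1 - int p..int p}. h l * \<phi> (2 * (x + real n - real p + 1) - of_int l)) =
   (\<Sum>r\<in>{2 * int n - 2 * int p + 1..2 * int n}. h (2 * int n - int p + 1 - r) * \<phi> (2 * x + of_int r - real p + 1))"
  by (rule sum.reindex_bij_witness[of _ "\<lambda>r. 2 * int n - int p + 1 - r" "\<lambda>l. 2 * int n - int p + 1 - l"])
     (auto simp: algebra_simps)

text \<open>The reason for the binomial weights: they are polynomial in \<open>n\<close>, and by the
  sum rules the filter turns them into a polynomial in \<open>r\<close> of no larger degree, hence
  again into a combination of binomials.\<close>

lemma edge_filter_coeff: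
  assumes k: "k < p"
  obtains a where "\<And>r. 0 \<le> r \<Longrightarrow> r \<le> 2 * int p - 2 \<Longrightarrow>
    (\<Sum>n\<in>{0..2*p-2}. real (n choose k) * h (2 * int n - int p + 1 - r)) = (\<Sum>i<p. a i * real (nat r choose i))"
proof -
  obtain B :: "real poly" where B: "degree B = k" "\<And>x. poly B x = x gchoose k" using poly_gbinomial by blast
  have "degree B < p" using B k by simp
  from subsampled_filter_poly[OF this] obtain Q :: "real poly" where Q: "degree Q \<le> k"
    "\<And>q N. finite N \<Longrightarrow> {n. 2 * n - q \<in> {1 - int p..int p}} \<subseteq> N \<Longrightarrow>
     (\<Sum>n\<in>N. poly B (of_int n) * h (2 * n - q)) = poly Q (of_int q)"
    using B(1) by blast
  have "degree (pcompose Q [:real p - 1, 1:]) \<le> k" using Q(1) by (simp add: degree_pcompose)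
  then obtain a where a: "\<And>x. poly (pcompose Q [:real p - 1, 1:]) x = (\<Sum>i\<le>k. a i * (x gchoose i))"
    using poly_gbinomial_basis by blast
  show ?thesis
  proof (rule that[of "\<lambda>i. if i \<le> k then a i else 0"])
    fix r :: int assume r: "0 \<le> r" "r \<le> 2 * int p - 2"
    have "(\<Sum>n\<in>{0..2*p-2}. real (n choose k) * h (2 * int n - int p + 1 - r)) =
       (\<Sum>n\<in>{0..2 * int p - 2}. poly B (of_int n) * h (2 * n - (int p - 1 + r)))"
      by (rule sum.reindex_bij_witness[of _ nat int])
         (use p_pos in \<open>auto simp: B(2) binomial_gbinomial algebra_simps\<close>)
    \<comment> \<open>An \<open>n\<close> whose tap lies in the filter range satisfies
      \<open>r \<le> 2 * n\<close> and \<open>2 * n \<le> 2 * p - 1 + r\<close>. For these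
      \<open>r\<close> it lies in \<open>0..2 * p - 2\<close>, so truncating the sum over
      \<open>n\<close> loses nothing.\<close>
    also have "\<dots> = poly Q (of_int (int p - 1 + r))"
      by (rule Q(2)) (use r p_pos in auto)
    also have "\<dots> = (\<Sum>i\<le>k. a i * (of_int r gchoose i))"
      using a[of "of_int r"] by (simp add: poly_pcompose algebra_simps)
    also have "\<dots> = (\<Sum>i<p. (if i \<le> k then a i else 0) * real (nat r choose i))"
      using k r by (intro sum.mono_neutral_cong_left) (auto simp: binomial_gbinomial)
    finally show "(\<Sum>n\<in>{0..2*p-2}. real (n choose k) * h (2 * int n - int p + 1 - r)) = \<dots>" .
  qed
qed

text \<open>After refining each term, the fine positions \<open>r\<close> fall into three groups.
  For \<open>0 \<le> r \<le> 2 * p - 2\<close> the coefficients recombine to edge functions; for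
  \<open>r < 0\<close> the translates are \<open>\<phi> (2 * x - i)\<close> with
  \<open>i \<ge> p\<close>; for \<open>r \<ge> 2 * p - 1\<close> they vanish when
  \<open>x > 0\<close>.\<close>

lemma edge_refine:
  assumes k: "k < p"
  shows "ae_comb edge_zoom_system {..<3 * p} (edge_fun p \<phi> k)"
proof -
  obtain a where a: "\<And>r. 0 \<le> r \<Longrightarrow> r \<le> 2 * int p - 2 \<Longrightarrow>
    (\<Sum>n\<in>{0..2*p-2}. real (n choose k) * h (2 * int n - int p + 1 - r)) = (\<Sum>i<p. a i * real (nat r choose i))"
    using edge_filter_coeff[OF k] by blast
  define c where "c r = (\<Sum>n\<in>{0..2*p-2}. real (n choose k) * h (2 * int n - int p + 1 - r))" for r
  \<comment> \<open>One range that covers the positions \<open>2 * n - 2 * p + 1..2 * n\<close> for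
    every \<open>n \<le> 2 * p - 2\<close>, so that the sums over \<open>n\<close> and
    \<open>r\<close> can be exchanged.\<close>
  let ?R = "{1 - 2 * int p..4 * int p}"
  let ?f = "\<lambda>x r. \<phi> (2 * x + of_int r - real p + 1)"
  \<comment> \<open>For \<open>i \<ge> p\<close> the translate \<open>\<phi> (2 * x - i)\<close> is
    the one at position \<open>r = p - 1 - i\<close>.\<close>
  define b where "b i = (if i < p then sqrt 2 * a i else sqrt 2 * c (int p - 1 - int i))" for i
  have "AE x in lborel. \<forall>n\<in>{0..2*p-2}. \<phi> (x + real n - real p + 1) =
      sqrt 2 * (\<Sum>l\<in>{1 - int p..int p}. h l * \<phi> (2 * (x + real n - real p + 1) - of_int l))"
  proof (subst AE_finite_all, simp, intro ballI)
    fix n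
    show "AE x in lborel. \<phi> (x + real n - real p + 1) =
      sqrt 2 * (\<Sum>l\<in>{1 - int p..int p}. h l * \<phi> (2 * (x + real n - real p + 1) - of_int l))"
      using AE_lborel_affine[OF refine, of 1 "real n - real p + 1"] by (simp add: algebra_simps)
  qed
  moreover have "AE x in lborel. \<forall>r\<in>?R. 2 * x + of_int r - real p + 1 \<notin> {1 - real p..real p} \<longrightarrow> ?f x r = 0"
  proof (subst AE_finite_all, simp, intro ballI)
    fix r :: int
    show "AE x in lborel. 2 * x + of_int r - real p + 1 \<notin> {1 - real p..real p} \<longrightarrow> ?f x r = 0"
      using AE_phi_zoom[of "- of_int r + real p - 1"] by (simp add: algebra_simps)
  qed
  moreover have "AE x in lborel. x \<noteq> (0::real)" by (rule AE_lborel_singleton)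
  ultimately have "AE x in lborel. edge_fun p \<phi> k x = (\<Sum>i\<in>{..<3*p}. complex_of_real (b i) * edge_zoom_system i x)"
  proof eventually_elim
    case (elim x)
    have split: "(\<Sum>i\<in>{..<3*p}. complex_of_real (b i) * edge_zoom_system i x) =
       (\<Sum>i<p. complex_of_real (sqrt 2 * a i) * edge_fun p \<phi> i (2 * x)) +
       complex_of_real (\<Sum>i\<in>{p..<3*p}. sqrt 2 * c (int p - 1 - int i) * \<phi> (2 * x - real i))"
    proof -
      have "{..<3*p} = {..<p} \<union> {p..<3*p}" by auto
      then have "(\<Sum>i\<in>{..<3*p}. complex_of_real (b i) * edge_zoom_system i x) =
        (\<Sum>i<p. complex_of_real (b i) * edge_zoom_system i x) + (\<Sum>i\<in>{p..<3*p}. complex_of_real (b i) * edge_zoom_system i x)"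
        by (simp add: sum.union_disjoint ivl_disj_int)
      then show ?thesis by (simp add: b_def edge_zoom_system_def)
    qed
    \<comment> \<open>The indices \<open>p..<3 * p\<close> correspond to \<open>r\<close> from
      \<open>-2 * p\<close> to \<open>-1\<close>. The position \<open>-2 * p\<close> lies just
      outside all filters and has \<open>c r = 0\<close>.\<close>
    have inner: "(\<Sum>i\<in>{p..<3*p}. sqrt 2 * c (int p - 1 - int i) * \<phi> (2 * x - real i)) =
       sqrt 2 * (\<Sum>r\<in>{- 2 * int p..-1}. c r * ?f x r)"
      unfolding sum_distrib_left
      by (rule sum.reindex_bij_witness[of _ "\<lambda>r. nat (int p - 1 - r)" "\<lambda>i. int p - 1 - int i"])
         (use p_pos in \<open>auto simp: algebra_simps\<close>)
    show ?case
    proof (cases "0 < x")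
      case False
      \<comment> \<open>Left of 0 both sides vanish: the edge functions by their cut, the interior
        translates by their support.\<close>
      then have x: "x < 0" using elim(3) by auto
      have "(\<Sum>r\<in>{- 2 * int p..-1}. c r * ?f x r) = 0"
      proof (rule sum.neutral, intro ballI)
        fix r assume r: "r \<in> {- 2 * int p..-1}"
        show "c r * ?f x r = 0"
        proof (cases "r \<in> ?R")
          case True
          have "real_of_int r \<le> -1" using r by simp
          then have "2 * x + of_int r - real p + 1 \<notin> {1 - real p..real p}" using x by auto
          then show ?thesis using elim(2) True by auto
        next
          case False
          then have "r = - 2 * int p" using r by auto
          then have "c r = 0" unfolding c_def by (auto intro!: sum.neutral h_supp)
          then show ?thesis by simp
        qed
      qed
      then show ?thesis unfolding split inner using x by (simp add: edge_fun_def)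
    next
      case True
      have cR: "(\<Sum>l\<in>{1 - int p..int p}. h l * \<phi> (2 * (x + real n - real p + 1) - of_int l)) =
         (\<Sum>r\<in>?R. h (2 * int n - int p + 1 - r) * ?f x r)" if "n \<in> {0..2*p-2}" for n
        unfolding filter_reindex
        by (rule sum.mono_neutral_left) (use that p_pos in \<open>auto intro!: h_supp\<close>)
      have "edge_fun p \<phi> k x = complex_of_real (\<Sum>n=0..2*p-2. real (n choose k) * \<phi> (x + real n - real p + 1))"
        using True by (simp add: edge_fun_def)
      also have "(\<Sum>n=0..2*p-2. real (n choose k) * \<phi> (x + real n - real p + 1)) =
         (\<Sum>n=0..2*p-2. \<Sum>r\<in>?R. sqrt 2 * (real (n choose k) * h (2 * int n - int p + 1 - r) * ?f x r))"
      proof (intro sum.cong refl)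
        fix n assume n: "n \<in> {0..2*p-2}"
        have "\<phi> (x + real n - real p + 1) = sqrt 2 * (\<Sum>r\<in>?R. h (2 * int n - int p + 1 - r) * ?f x r)"
          using bspec[OF elim(1) n] unfolding cR[OF n] .
        then show "real (n choose k) * \<phi> (x + real n - real p + 1) =
           (\<Sum>r\<in>?R. sqrt 2 * (real (n choose k) * h (2 * int n - int p + 1 - r) * ?f x r))"
          by (simp add: sum_distrib_left mult_ac)
      qed
      also have "\<dots> = sqrt 2 * (\<Sum>r\<in>?R. c r * ?f x r)"
        by (subst sum.swap) (simp add: c_def sum_distrib_left sum_distrib_right)
      also have "(\<Sum>r\<in>?R. c r * ?f x r) = (\<Sum>r\<in>{0..2 * int p - 2} \<union> {1 - 2 * int p..-1}. c r * ?f x r)"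
      proof (rule sum.mono_neutral_right)
        show "\<forall>r\<in>?R - ({0..2 * int p - 2} \<union> {1 - 2 * int p..-1}). c r * ?f x r = 0"
        proof
          fix r assume r: "r \<in> ?R - ({0..2 * int p - 2} \<union> {1 - 2 * int p..-1})"
          then have "2 * int p - 1 \<le> r" by auto
          then have "2 * real p - 1 \<le> of_int r" by linarith
          then have "2 * x + of_int r - real p + 1 \<notin> {1 - real p..real p}" using True by auto
          then show "c r * ?f x r = 0" using elim(2) r by auto
        qed
      qed (use p_pos in auto)
      also have "\<dots> = (\<Sum>r\<in>{0..2 * int p - 2}. c r * ?f x r) + (\<Sum>r\<in>{1 - 2 * int p..-1}. c r * ?f x r)"
        by (rule sum.union_disjoint) auto
      also have "(\<Sum>r\<in>{1 - 2 * int p..-1}. c r * ?f x r) = (\<Sum>r\<in>{- 2 * int p..-1}. c r * ?f x r)"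
      proof (rule sum.mono_neutral_left)
        show "\<forall>r\<in>{- 2 * int p..-1} - {1 - 2 * int p..-1}. c r * ?f x r = 0"
        proof
          fix r assume "r \<in> {- 2 * int p..-1} - {1 - 2 * int p..-1}"
          then have "r = - 2 * int p" by auto
          then have "c r = 0" unfolding c_def by (auto intro!: sum.neutral h_supp)
          then show "c r * ?f x r = 0" by simp
        qed
      qed auto
      also have "(\<Sum>r\<in>{0..2 * int p - 2}. c r * ?f x r) = (\<Sum>n=0..2*p-2. (\<Sum>i<p. a i * real (n choose i)) * \<phi> (2 * x + real n - real p + 1))"
      proof (rule sum.reindex_bij_witness[of _ int nat])
        fix r :: int assume r: "r \<in> {0..2 * int p - 2}"
        then have "c r = (\<Sum>i<p. a i * real (nat r choose i))" unfolding c_def by (intro a) auto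
        then show "(\<Sum>i<p. a i * real (nat r choose i)) * \<phi> (2 * x + real (nat r) - real p + 1) = c r * ?f x r"
          using r by simp
      qed (use p_pos in auto)
      also have "\<dots> = (\<Sum>i<p. a i * (\<Sum>n=0..2*p-2. real (n choose i) * \<phi> (2 * x + real n - real p + 1)))"
        unfolding sum_distrib_left sum_distrib_right by (subst sum.swap) (simp add: mult.assoc)
      finally have "edge_fun p \<phi> k x = complex_of_real (sqrt 2 * ((\<Sum>i<p. a i * (\<Sum>n=0..2*p-2. real (n choose i) * \<phi> (2 * x + real n - real p + 1))) +
         (\<Sum>r\<in>{- 2 * int p..-1}. c r * ?f x r)))" .
      also have "\<dots> = (\<Sum>i\<in>{..<3*p}. complex_of_real (b i) * edge_zoom_system i x)"
        unfolding split inner using True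
        by (simp add: edge_fun_def distrib_left sum_distrib_left mult.assoc)
      finally show ?thesis .
    qed
  qed
  then show ?thesis unfolding ae_comb_def by (intro exI)
qed

text \<open>Gram-Schmidt is triangular in both directions, so left functions and edge functions
  generate each other, and the refinement carries over.\<close>

lemma phi_left_refine:
  assumes k: "k < p"
  shows "ae_comb zoom_system {..<3 * p} (phi_left p \<phi> k)"
proof (rule ae_comb_trans[OF _ _ phi_left_comb_edge[OF k]])
  fix i assume i: "i \<in> {..<p}"
  show "ae_comb zoom_system {..<3 * p} (edge_fun p \<phi> i)"
  proof (rule ae_comb_trans[OF _ _ edge_refine])
    fix l assume l: "l \<in> {..<3 * p}"
    show "ae_comb zoom_system {..<3 * p} (edge_zoom_system l)"
    proof (cases "l < p")
      case True
      obtain c where "AE x in lborel. edge_fun p \<phi> l x = (\<Sum>i\<in>{..<p}. c i * phi_left p \<phi> i x)"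
        using edge_comb_phi_left[OF True] by (auto simp: ae_comb_def)
      from AE_lborel_affine[OF this, of 2 0, simplified]
      have "AE x in lborel. edge_zoom_system l x = (\<Sum>i\<in>{..<p}. c i * zoom_system i x)"
        by eventually_elim (use True in \<open>auto simp: edge_zoom_system_def zoom_system_def intro!: sum.cong\<close>)
      then have "ae_comb zoom_system {..<p} (edge_zoom_system l)" by (auto simp: ae_comb_def)
      then show ?thesis by (rule ae_comb_mono) auto
    next
      case False
      then show ?thesis using l by (intro ae_comb_base[of _ l]) (auto simp: zoom_system_def edge_zoom_system_def)
    qed
  qed (use i in auto)
qed auto

end

section \<open>The boundary scaling functions on the interval\<close>

lemma L2_inner_affine:
  fixes f g :: "real \<Rightarrow> complex"
  assumes "c \<noteq> 0"
  shows "L2_inner (\<lambda>x. f (t + c * x)) (\<lambda>x. g (t + c * x)) = L2_inner f g / complex_of_real \<bar>c\<bar>"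
  unfolding L2_inner_def
  using lborel_integral_real_affine[OF assms, of "\<lambda>x. f x * cnj (g x)" t] assms
  by (simp add: scaleR_conv_of_real)

lemma L2_fun_affine:
  fixes f :: "real \<Rightarrow> complex"
  assumes "f \<in> L2_fun" "c \<noteq> 0" shows "(\<lambda>x. f (t + c * x)) \<in> L2_fun"
proof -
  have [measurable]: "f \<in> borel_measurable borel" using assms by (simp add: L2_fun_measurable)
  show ?thesis
    using lborel_integrable_real_affine[OF L2_funD[OF assms(1)] assms(2), of t] by (simp add: L2_fun_def)
qed

text \<open>\<open>phi_b\<close> at unit spacing, on an interval of length \<open>2 ^ j\<close> and
  without the cut at its ends. Up to translation only finitely many functions occur, for all
  \<open>j\<close> together.\<close>

definition unit_system :: "nat \<Rightarrow> (real \<Rightarrow> real) \<Rightarrow> nat \<Rightarrow> nat \<Rightarrow> real \<Rightarrow> complex" where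
  "unit_system p \<phi> j n y = (if n < p then phi_left p \<phi> n y
     else if n < 2 ^ j - p then complex_of_real (\<phi> (y - real n))
     else phi_right p \<phi> (2 ^ j - 1 - n) (y - 2 ^ j))"

lemma phi_b_eq_unit_system:
  "phi_b p \<phi> j n x = (if x \<in> {0..1} then complex_of_real (2 powr (real j / 2)) * unit_system p \<phi> j n (2 ^ j * x) else 0)"
proof -
  have e: "2 ^ j * (x - 1) = 2 ^ j * x - 2 ^ j" by (simp add: algebra_simps)
  show ?thesis unfolding phi_b_def interval_system_def unit_system_def e ..
qed

text \<open>With \<open>\<phi>\<close> reflected by \<open>1 - y\<close> and the interval by
  \<open>1 - x\<close>, the index \<open>n\<close> goes to \<open>2 ^ j - 1 - n\<close> and the two
  ends are exchanged. This reduces refinement at the right end to the left end.\<close>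

lemma phi_b_reflect:
  assumes "n < 2 ^ j" "2 * p \<le> 2 ^ j"
  shows "phi_b p \<phi> j n (1 - x) = phi_b p (\<lambda>y. \<phi> (1 - y)) j (2 ^ j - 1 - n) x"
proof -
  have r: "real (2 ^ j - Suc n) = 2 ^ j - 1 - real n" using assms(1) by (simp add: of_nat_diff)
  have r2: "2 ^ j - Suc (2 ^ j - Suc n) = n" using assms(1) by simp
  have in01: "1 - x \<in> {0..1} \<longleftrightarrow> x \<in> {0..1}" by auto
  consider "n < p" | "p \<le> n" "n < 2 ^ j - p" | "2 ^ j - p \<le> n" by linarith
  then show ?thesis
  proof cases
    case 1
    then have "\<not> 2 ^ j - 1 - n < p" "\<not> 2 ^ j - 1 - n < 2 ^ j - p" using assms by auto
    then show ?thesis using 1 unfolding phi_b_def interval_system_def phi_right_def in01 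
      by (simp add: r2 algebra_simps)
  next
    case 2
    then have "\<not> 2 ^ j - 1 - n < p" "2 ^ j - 1 - n < 2 ^ j - p" "\<not> n < p" using assms by auto
    then show ?thesis using 2 unfolding phi_b_def interval_system_def in01
      by (simp add: r algebra_simps)
  next
    case 3
    then have "2 ^ j - 1 - n < p" "\<not> n < 2 ^ j - p" "\<not> n < p" using assms by auto
    then show ?thesis using 3 unfolding phi_b_def interval_system_def phi_right_def in01
      by (simp add: algebra_simps)
  qed
qed

text \<open>Left boundary functions are combinations of the translates of \<open>\<phi>\<close> cut at \<open>0\<close>, right ones of
  the translates cut at \<open>2\<^sup>j\<close>.\<close>

definition cut_translate :: "(real \<Rightarrow> real) \<Rightarrow> real set \<Rightarrow> int \<Rightarrow> real \<Rightarrow> complex" where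
  "cut_translate \<phi> A m y = (if y \<in> A then complex_of_real (\<phi> (y - of_int m)) else 0)"

section \<open>Orthogonality and refinement of the boundary scaling functions\<close>

context scaling_function
begin

lemma AE_phi_shift: "AE y in lborel. y - of_int m \<notin> {1 - real p..real p} \<longrightarrow> \<phi> (y - of_int m) = 0"
  using AE_phi_affine[of 1 "- of_int m"] by simp

lemma phi_left_cut_translates:
  "\<exists>c. \<forall>y. phi_left p \<phi> k y = (\<Sum>n=0..2*p-2. c n * cut_translate \<phi> {0..} (int p - 1 - int n) y)"
proof -
  obtain c where c: "\<And>x. phi_left p \<phi> k x = (\<Sum>i\<le>k. c i * edge_fun p \<phi> i x)" using phi_left_gram_schmidt(4) by metis
  have e: "edge_fun p \<phi> i x = (\<Sum>n=0..2*p-2. complex_of_real (real (n choose i)) * cut_translate \<phi> {0..} (int p - 1 - int n) x)" for i x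
    by (simp add: edge_fun_def cut_translate_def algebra_simps)
  have "phi_left p \<phi> k x = (\<Sum>n=0..2*p-2. (\<Sum>i\<le>k. c i * complex_of_real (real (n choose i))) * cut_translate \<phi> {0..} (int p - 1 - int n) x)" for x
    unfolding c e sum_distrib_left sum_distrib_right by (subst sum.swap) (simp add: mult.assoc)
  then show ?thesis by (intro exI[of _ "\<lambda>n. \<Sum>i\<le>k. c i * complex_of_real (real (n choose i))"] allI)
qed

text \<open>The rightmost translate in an edge function is \<open>\<phi> (y - (p - 1))\<close>,
  whose support ends at \<open>2 * p - 1\<close>.\<close>

lemma AE_phi_left_support: "AE y in lborel. y \<notin> {0..2 * real p - 1} \<longrightarrow> phi_left p \<phi> k y = 0"
proof -
  obtain c where c: "\<And>y. phi_left p \<phi> k y = (\<Sum>n=0..2*p-2. c n * cut_translate \<phi> {0..} (int p - 1 - int n) y)"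
    using phi_left_cut_translates by metis
  have "AE y in lborel. \<forall>n\<in>{0..2*p-2}. y - of_int (int p - 1 - int n) \<notin> {1 - real p..real p} \<longrightarrow> \<phi> (y - of_int (int p - 1 - int n)) = 0"
    by (subst AE_finite_all, simp, intro ballI AE_phi_shift)
  then show ?thesis
  proof eventually_elim
    case (elim y)
    show ?case
    proof
      assume y: "y \<notin> {0..2 * real p - 1}"
      have "cut_translate \<phi> {0..} (int p - 1 - int n) y = 0" if n: "n \<in> {0..2*p-2}" for n
      proof (cases "0 \<le> y")
        case True
        then have "y - of_int (int p - 1 - int n) \<notin> {1 - real p..real p}" using y by auto
        then have "\<phi> (y - of_int (int p - 1 - int n)) = 0" using bspec[OF elim n] by blast
        then show ?thesis by (simp only: cut_translate_def) simp
      qed (simp add: cut_translate_def)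
      then show "phi_left p \<phi> k y = 0" unfolding c by (intro sum.neutral) simp
    qed
  qed
qed

lemma cut_translate_L2:
  assumes [measurable]: "A \<in> sets borel" shows "cut_translate \<phi> A m \<in> L2_fun"
proof -
  have *: "(\<lambda>y. complex_of_real (\<phi> (y - of_int m))) \<in> L2_fun" by (rule L2_fun_shift[OF L2_phi])
  have "cut_translate \<phi> A m \<in> borel_measurable borel" unfolding cut_translate_def by measurable
  then show ?thesis by (rule L2_funI[OF _ L2_funD[OF *]]) (auto simp: cut_translate_def)
qed

lemma cut_translate_inner:
  assumes [measurable]: "A \<in> sets borel" "B \<in> sets borel"
    and AB: "AE y in lborel. y \<notin> A \<inter> B \<longrightarrow> \<phi> (y - of_int m) * \<phi> (y - of_int n) = 0"
  shows "L2_inner (cut_translate \<phi> A m) (cut_translate \<phi> B n) = (if m = n then 1 else 0)"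
proof -
  have [measurable]: "cut_translate \<phi> A m \<in> borel_measurable borel" "cut_translate \<phi> B n \<in> borel_measurable borel"
    unfolding cut_translate_def by measurable
  have "L2_inner (cut_translate \<phi> A m) (cut_translate \<phi> B n) = (LINT y|lborel. complex_of_real (\<phi> (y - of_int m) * \<phi> (y - of_int n)))"
    unfolding L2_inner_def
  proof (rule integral_cong_AE)
    show "AE y in lborel. cut_translate \<phi> A m y * cnj (cut_translate \<phi> B n y) = complex_of_real (\<phi> (y - of_int m) * \<phi> (y - of_int n))"
      using AB by eventually_elim (auto simp: cut_translate_def)
  qed measurable
  also have "\<dots> = complex_of_real (LINT y|lborel. \<phi> (y - of_int m) * \<phi> (y - of_int n))" by (rule integral_complex_of_real)
  also have "(LINT y|lborel. \<phi> (y - of_int m) * \<phi> (y - of_int n)) = (LINT y|lborel. \<phi> y * \<phi> (y - of_int (n - m)))"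
    using integral_shift[of "\<lambda>y. \<phi> y * \<phi> (y - of_int (n - m))" "of_int m"] by (simp add: algebra_simps)
  also have "\<dots> = (if m = n then 1 else 0)" unfolding orth by auto
  finally show ?thesis by simp
qed

text \<open>The interval is long enough for the product of a left and a later translate not to be cut.\<close>

lemma cut_translate_orth:
  assumes mn: "m < n" and n: "int p \<le> n" and m: "m \<le> int N - int p - 1"
    and A: "A = {0..} \<or> A = UNIV" and B: "B = {..real N} \<or> B = UNIV"
  shows "L2_inner (cut_translate \<phi> A m) (cut_translate \<phi> B n) = 0"
proof -
  have AB: "A \<in> sets borel" "B \<in> sets borel" "{0..real N} \<subseteq> A \<inter> B" using A B by auto
  have "real_of_int n \<ge> real p" "real_of_int m \<le> real N - real p - 1" using m n by linarith+
  note mn' = this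
  have "AE y in lborel. y \<notin> A \<inter> B \<longrightarrow> \<phi> (y - of_int m) * \<phi> (y - of_int n) = 0"
    using AE_phi_shift[of m] AE_phi_shift[of n]
  proof eventually_elim
    case (elim y)
    show ?case
    proof
      assume "y \<notin> A \<inter> B"
      then have "y < 0 \<or> real N < y" using AB(3) by (metis atLeastAtMost_iff not_le subsetD)
      then have "y - of_int n \<notin> {1 - real p..real p} \<or> y - of_int m \<notin> {1 - real p..real p}"
        using mn' by auto
      then show "\<phi> (y - of_int m) * \<phi> (y - of_int n) = 0" using elim by auto
    qed
  qed
  then show ?thesis using cut_translate_inner[OF AB(1,2)] mn by simp
qed

lemma phi_right_cut_translates:
  "\<exists>c. \<forall>y. phi_right p \<phi> k (y - real N) = (\<Sum>n=0..2*p-2. c n * cut_translate \<phi> {..real N} (int N - int p + int n) y)"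
proof -
  interpret r: scaling_function p "\<lambda>x. \<phi> (1 - x)" "\<lambda>k. h (1 - k)" by (rule reflected)
  obtain c where c: "\<And>y. phi_left p (\<lambda>x. \<phi> (1 - x)) k y = (\<Sum>n=0..2*p-2. c n * cut_translate (\<lambda>x. \<phi> (1 - x)) {0..} (int p - 1 - int n) y)"
    using r.phi_left_cut_translates by metis
  have "cut_translate (\<lambda>x. \<phi> (1 - x)) {0..} (int p - 1 - int n) (- (y - real N)) = cut_translate \<phi> {..real N} (int N - int p + int n) y" for n y
    by (simp add: cut_translate_def algebra_simps)
  then have "phi_right p \<phi> k (y - real N) = (\<Sum>n=0..2*p-2. c n * cut_translate \<phi> {..real N} (int N - int p + int n) y)" for y
    unfolding phi_right_def c by simp
  then show ?thesis by (intro exI[of _ c] allI)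
qed

lemma phi_right_L2: "phi_right p \<phi> k \<in> L2_fun"
proof -
  interpret r: scaling_function p "\<lambda>x. \<phi> (1 - x)" "\<lambda>k. h (1 - k)" by (rule reflected)
  show ?thesis using L2_fun_affine[OF r.phi_left_gram_schmidt(1)[of k], of "-1" 0] by (simp add: phi_right_def[abs_def])
qed

lemma unit_system_L2: "unit_system p \<phi> j n \<in> L2_fun"
proof -
  consider "n < p" | "\<not> n < p" "n < 2 ^ j - p" | "\<not> n < p" "\<not> n < 2 ^ j - p" by blast
  then show ?thesis
  proof cases
    case 1
    then have "unit_system p \<phi> j n = phi_left p \<phi> n" by (auto simp: unit_system_def)
    then show ?thesis using phi_left_gram_schmidt(1) by simp
  next
    case 2
    then have "unit_system p \<phi> j n = (\<lambda>y. complex_of_real (\<phi> (y - real n)))" by (auto simp: unit_system_def)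
    then show ?thesis using L2_fun_shift[OF L2_phi] by simp
  next
    case 3
    then have "unit_system p \<phi> j n = (\<lambda>y. phi_right p \<phi> (2 ^ j - 1 - n) (y - 2 ^ j))" by (auto simp: unit_system_def)
    then show ?thesis using L2_fun_shift[OF phi_right_L2] by simp
  qed
qed

text \<open>Two functions at the same end are orthogonal by Gram-Schmidt. In all other cases both
  are combinations of cut translates: left ones have index at most \<open>p - 1\<close>, right ones
  at least \<open>N - p\<close>, and \<open>2 * p \<le> N\<close> keeps the groups apart, so that
  \<open>cut_translate_orth\<close> applies.\<close>

lemma unit_system_inner_0:
  assumes j: "2 * p \<le> 2 ^ j" and nm: "n < m" "m < 2 ^ j"
  shows "L2_inner (unit_system p \<phi> j n) (unit_system p \<phi> j m) = 0"
proof -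
  define N :: nat where "N = 2 ^ j"
  have rN: "real N = 2 ^ j" by (simp add: N_def)
  let ?u = "unit_system p \<phi> j"
  let ?L = "\<lambda>i. cut_translate \<phi> {0..} (int p - 1 - int i)"
  let ?R = "\<lambda>i. cut_translate \<phi> {..real N} (int N - int p + int i)"
  let ?I = "\<lambda>i. cut_translate \<phi> UNIV (int i)"
  have p1: "1 \<le> p" by (rule p_pos)
  have jN: "2 * p \<le> N" using j by (simp add: N_def)
  have left: "\<exists>c. AE y in lborel. ?u n y = (\<Sum>i\<in>{0..2*p-2}. c i * ?L i y)" if n: "n < p" for n
  proof -
    obtain c where c: "\<And>y. phi_left p \<phi> n y = (\<Sum>i=0..2*p-2. c i * ?L i y)" using phi_left_cut_translates by metis
    show ?thesis by (intro exI[of _ c] AE_I2) (simp only: unit_system_def n if_True c)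
  qed
  have right: "\<exists>c. AE y in lborel. ?u n y = (\<Sum>i\<in>{0..2*p-2}. c i * ?R i y)" if n: "\<not> n < p" "\<not> n < N - p" for n
  proof -
    obtain c where c: "\<And>y. phi_right p \<phi> (N - 1 - n) (y - real N) = (\<Sum>i=0..2*p-2. c i * ?R i y)"
      using phi_right_cut_translates by metis
    have "?u n y = phi_right p \<phi> (N - 1 - n) (y - real N)" for y using n by (simp add: unit_system_def N_def)
    then show ?thesis by (intro exI[of _ c] AE_I2) (simp only: c)
  qed
  have inter: "?u n = ?I n" if "p \<le> n" "n < N - p" for n
    using that by (auto simp: unit_system_def N_def cut_translate_def fun_eq_iff)
  have L2: "?L i \<in> L2_fun" "?R i \<in> L2_fun" "?I i \<in> L2_fun" for i by (auto intro!: cut_translate_L2)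
  have um: "?u n \<in> borel_measurable borel" for n using unit_system_L2 by (simp add: L2_fun_measurable)
  have LR: "L2_inner (?L i) (?R l) = 0" if "i \<in> {0..2*p-2}" "l \<in> {0..2*p-2}" for i l
    by (rule cut_translate_orth[of _ _ N]) (use jN that p1 in auto)
  have LI: "L2_inner (?L i) (?I l) = 0" if "i \<in> {0..2*p-2}" "p \<le> l" "l < N - p" for i l
    by (rule cut_translate_orth[of _ _ N]) (use jN that p1 in auto)
  have IR: "L2_inner (?I i) (?R l) = 0" if "p \<le> i" "i < N - p" "l \<in> {0..2*p-2}" for i l
    by (rule cut_translate_orth[of _ _ N]) (use jN that p1 in auto)
  have II: "L2_inner (?I i) (?I l) = 0" if "p \<le> i" "i < l" "l < N - p" for i l
    by (rule cut_translate_orth[of _ _ N]) (use jN that p1 in auto)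
  have comm: "L2_inner f g = 0" if "L2_inner g f = 0" for f g :: "real \<Rightarrow> complex"
    using that by (simp add: L2_inner_eq_0_commute)
  consider "m < p" | "n < p" "p \<le> m" "m < N - p" | "n < p" "N - p \<le> m" "\<not> m < p"
    | "p \<le> n" "n < N - p" "m < N - p" | "p \<le> n" "n < N - p" "N - p \<le> m" | "p \<le> n" "N - p \<le> n"
    using nm not_less by metis
  then show ?thesis
  proof cases
    case 1
    have u: "?u n = phi_left p \<phi> n" "?u m = phi_left p \<phi> m" using 1 nm by (auto simp: unit_system_def)
    show ?thesis unfolding u by (rule comm) (use phi_left_gram_schmidt(2)[of m] nm(1) in simp)
  next
    case 2
    obtain c where c: "AE y in lborel. ?u n y = (\<Sum>i\<in>{0..2*p-2}. c i * ?L i y)" by (rule exE[OF left[OF 2(1)]])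
    show ?thesis unfolding inter[OF 2(2,3)]
      by (rule comm, rule L2_orth_lincomb[OF L2(1) L2(3) _ um c]) (rule comm, rule LI; use 2 in simp)
  next
    case 3
    obtain c where c: "AE y in lborel. ?u n y = (\<Sum>i\<in>{0..2*p-2}. c i * ?L i y)" by (rule exE[OF left[OF 3(1)]])
    have m: "\<not> m < N - p" using 3 by simp
    obtain d where d: "AE y in lborel. ?u m y = (\<Sum>i\<in>{0..2*p-2}. d i * ?R i y)"
      by (rule exE[OF right[OF 3(3) m]])
    show ?thesis
    proof (rule L2_orth_lincomb[OF L2(2) unit_system_L2 _ um d])
      fix i assume i: "i \<in> {0..2*p-2}"
      show "L2_inner (?u n) (?R i) = 0"
        by (rule comm, rule L2_orth_lincomb[OF L2(1) L2(2) _ um c]) (rule comm, intro LR i)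
    qed
  next
    case 4
    then have "p \<le> m" using nm by simp
    then show ?thesis unfolding inter[OF 4(1,2)] inter[OF \<open>p \<le> m\<close> 4(3)] using II 4 nm by simp
  next
    case 5
    have m: "\<not> m < p" "\<not> m < N - p" using 5 nm by simp_all
    obtain d where d: "AE y in lborel. ?u m y = (\<Sum>i\<in>{0..2*p-2}. d i * ?R i y)"
      by (rule exE[OF right[OF m]])
    show ?thesis unfolding inter[OF 5(1,2)]
      by (rule L2_orth_lincomb[OF L2(2) L2(3) _ um d]) (intro IR 5; simp)
  next
    case 6
    interpret r: scaling_function p "\<lambda>x. \<phi> (1 - x)" "\<lambda>k. h (1 - k)" by (rule reflected)
    have u: "?u n = (\<lambda>y. phi_left p (\<lambda>x. \<phi> (1 - x)) (N - 1 - n) (real N + (-1) * y))"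
      "?u m = (\<lambda>y. phi_left p (\<lambda>x. \<phi> (1 - x)) (N - 1 - m) (real N + (-1) * y))"
      using 6 nm by (auto simp: unit_system_def N_def phi_right_def fun_eq_iff)
    have "N - 1 - m < N - 1 - n" using nm N_def by linarith
    then show ?thesis unfolding u using r.phi_left_gram_schmidt(2)[of "N - 1 - n"] 
      by (subst L2_inner_affine) auto
  qed
qed

lemma unit_system_nrm:
  assumes "n < 2 ^ j"
  shows "L2_nrm (unit_system p \<phi> j n) = 1 \<or> unit_system p \<phi> j n = (\<lambda>y. 0)"
proof -
  consider "n < p" | "\<not> n < p" "n < 2 ^ j - p" | "\<not> n < p" "\<not> n < 2 ^ j - p" by blast
  then show ?thesis
  proof cases
    case 1
    then have "unit_system p \<phi> j n = phi_left p \<phi> n" by (auto simp: unit_system_def)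
    then show ?thesis using phi_left_gram_schmidt(3)[of n] by simp
  next
    case 2
    then have u: "unit_system p \<phi> j n = cut_translate \<phi> UNIV (int n)" by (auto simp: unit_system_def cut_translate_def)
    have "L2_inner (unit_system p \<phi> j n) (unit_system p \<phi> j n) = 1"
      unfolding u by (subst cut_translate_inner) auto
    then have "(L2_nrm (unit_system p \<phi> j n))\<^sup>2 = 1" unfolding L2_inner_self using of_real_eq_1_iff by blast
    then show ?thesis using L2_nrm_nonneg[of "unit_system p \<phi> j n"] by (auto simp: power2_eq_1_iff)
  next
    case 3
    interpret r: scaling_function p "\<lambda>x. \<phi> (1 - x)" "\<lambda>k. h (1 - k)" by (rule reflected)
    let ?g = "phi_left p (\<lambda>x. \<phi> (1 - x)) (2 ^ j - 1 - n)"
    have u: "unit_system p \<phi> j n = (\<lambda>y. ?g (2 ^ j + (-1) * y))"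
      using 3 by (auto simp: unit_system_def phi_right_def fun_eq_iff)
    have "L2_inner (unit_system p \<phi> j n) (unit_system p \<phi> j n) = L2_inner ?g ?g" unfolding u
      by (subst L2_inner_affine) auto
    then have "(L2_nrm (unit_system p \<phi> j n))\<^sup>2 = (L2_nrm ?g)\<^sup>2" unfolding L2_inner_self using of_real_eq_iff by blast
    then have "L2_nrm (unit_system p \<phi> j n) = L2_nrm ?g" by simp
    then show ?thesis using r.phi_left_gram_schmidt(3)[of "2 ^ j - 1 - n"] unfolding u by auto
  qed
qed

text \<open>The restriction to the unit interval changes nothing outside a null set: every dilated
  function is already supported there, the boundary functions because
  \<open>2 * p - 1 \<le> 2 ^ j\<close>.\<close>

lemma phi_b_unit_system:
  assumes j: "2 * p \<le> 2 ^ j" and n: "n < 2 ^ j"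
  shows "AE x in lborel. phi_b p \<phi> j n x = complex_of_real (2 powr (real j / 2)) * unit_system p \<phi> j n (2 ^ j * x)"
proof -
  have jr: "2 * real p \<le> 2 ^ j" using j by (metis of_nat_le_iff of_nat_mult of_nat_numeral of_nat_power)
  have supp: "AE y in lborel. y \<notin> {0..2 ^ j} \<longrightarrow> unit_system p \<phi> j n y = 0"
  proof -
    consider "n < p" | "\<not> n < p" "n < 2 ^ j - p" | "\<not> n < p" "\<not> n < 2 ^ j - p" by blast
    then show ?thesis
    proof cases
      case 1
      show ?thesis using AE_phi_left_support[of n]
        by eventually_elim (use 1 jr in \<open>auto simp: unit_system_def\<close>)
    next
      case 2
      then have n2: "real n + real p \<le> 2 ^ j" by (metis less_diff_conv less_imp_le of_nat_add of_nat_le_iff of_nat_numeral of_nat_power)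
      show ?thesis using AE_phi_shift[of "int n"]
        by eventually_elim (use 2 n2 in \<open>auto simp: unit_system_def\<close>)
    next
      case 3
      interpret r: scaling_function p "\<lambda>x. \<phi> (1 - x)" "\<lambda>k. h (1 - k)" by (rule reflected)
      have "(- 1 :: real) \<noteq> 0" by simp
      from AE_lborel_affine[OF r.AE_phi_left_support[of "2 ^ j - 1 - n"] this, of "2 ^ j"]
      show ?thesis
        by eventually_elim (use 3 jr in \<open>auto simp: unit_system_def phi_right_def\<close>)
    qed
  qed
  have "AE x in lborel. 0 + 2 ^ j * x \<notin> {0..2 ^ j} \<longrightarrow> unit_system p \<phi> j n (0 + 2 ^ j * x) = 0"
    by (rule AE_lborel_affine[OF supp]) simp
  then show ?thesis
  proof eventually_elim
    case (elim x)
    show ?case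
    proof (cases "x \<in> {0..1}")
      case True
      then show ?thesis by (simp only: phi_b_eq_unit_system if_True)
    next
      case False
      then have "0 + 2 ^ j * x \<notin> {0..2 ^ j}" by (auto simp: mult_le_cancel_left1 zero_le_mult_iff not_le[of "2 ^ j" "0::real"])
      then show ?thesis using elim False by (simp only: phi_b_eq_unit_system if_False) simp
    qed
  qed
qed

lemma phi_b_measurable [measurable]: "phi_b p \<phi> j n \<in> borel_measurable borel"
proof -
  have [measurable]: "phi_left p \<phi> n \<in> borel_measurable borel" "phi_right p \<phi> k \<in> borel_measurable borel" for n k
    using phi_left_gram_schmidt(1) phi_right_L2 by (simp_all add: L2_fun_measurable)
  show ?thesis unfolding phi_b_def interval_system_def by measurable
qed

lemma phi_b_L2:
  assumes j: "2 * p \<le> 2 ^ j" and n: "n < 2 ^ j"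
  shows "phi_b p \<phi> j n \<in> L2_fun"
proof (rule L2_fun_cong_AE)
  show "(\<lambda>x. complex_of_real (2 powr (real j / 2)) * unit_system p \<phi> j n (0 + 2 ^ j * x)) \<in> L2_fun"
    by (intro L2_fun_mult L2_fun_affine unit_system_L2) simp
  show "AE x in lborel. complex_of_real (2 powr (real j / 2)) * unit_system p \<phi> j n (0 + 2 ^ j * x) = phi_b p \<phi> j n x"
    using phi_b_unit_system[OF assms] by eventually_elim simp
qed measurable

lemma powr_half_sq: "(2 powr (real j / 2))\<^sup>2 = (2::real) ^ j"
  by (simp add: powr_realpow[symmetric] power2_eq_square powr_add[symmetric])

lemma phi_b_inner:
  assumes j: "2 * p \<le> 2 ^ j" and n: "n < 2 ^ j" and m: "m < 2 ^ j"
  shows "L2_inner (phi_b p \<phi> j n) (phi_b p \<phi> j m) = L2_inner (unit_system p \<phi> j n) (unit_system p \<phi> j m)"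
proof -
  let ?c = "complex_of_real (2 powr (real j / 2))"
  have [measurable]: "unit_system p \<phi> j n \<in> borel_measurable borel" for n
    using unit_system_L2 by (simp add: L2_fun_measurable)
  have "L2_inner (phi_b p \<phi> j n) (phi_b p \<phi> j m) = L2_inner (\<lambda>x. ?c * unit_system p \<phi> j n (0 + 2 ^ j * x)) (\<lambda>x. ?c * unit_system p \<phi> j m (0 + 2 ^ j * x))"
    by (intro L2_inner_cong_AE) (use phi_b_unit_system[OF j n] phi_b_unit_system[OF j m] in simp_all)
  also have "\<dots> = ?c * cnj ?c * L2_inner (\<lambda>x. unit_system p \<phi> j n (0 + 2 ^ j * x)) (\<lambda>x. unit_system p \<phi> j m (0 + 2 ^ j * x))"
    unfolding L2_inner_mult_left
    by (subst L2_inner_cnj[symmetric], unfold L2_inner_mult_left, simp add: L2_inner_cnj)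
  also have "?c * cnj ?c = 2 ^ j"
  proof -
    have "(cmod ?c)\<^sup>2 = 2 ^ j" by (simp add: powr_half_sq)
    then show ?thesis unfolding complex_norm_square[symmetric] by (simp only: of_real_power of_real_numeral)
  qed
  finally show ?thesis by (subst (asm) L2_inner_affine) simp_all
qed

lemma phi_b_orthogonal:
  assumes j: "2 * p \<le> 2 ^ j" and n: "n < 2 ^ j" and m: "m < 2 ^ j" and nm: "n \<noteq> m"
  shows "L2_inner (phi_b p \<phi> j n) (phi_b p \<phi> j m) = 0"
  unfolding phi_b_inner[OF j n m]
  using unit_system_inner_0[OF j, of n m] unit_system_inner_0[OF j, of m n] nm n m
  by (metis L2_inner_eq_0_commute nat_neq_iff)

lemma phi_b_nrm:
  assumes j: "2 * p \<le> 2 ^ j" and n: "n < 2 ^ j"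
  shows "L2_nrm (phi_b p \<phi> j n) = 1 \<or> phi_b p \<phi> j n = (\<lambda>x. 0)"
proof -
  have "(L2_nrm (phi_b p \<phi> j n))\<^sup>2 = (L2_nrm (unit_system p \<phi> j n))\<^sup>2"
    using phi_b_inner[OF j n n] unfolding L2_inner_self using of_real_eq_iff by blast
  then have "L2_nrm (phi_b p \<phi> j n) = L2_nrm (unit_system p \<phi> j n)" by simp
  moreover have "phi_b p \<phi> j n = (\<lambda>x. 0)" if u: "unit_system p \<phi> j n = (\<lambda>y. 0)"
    unfolding fun_eq_iff phi_b_eq_unit_system u by simp
  ultimately show ?thesis using unit_system_nrm[OF n] by auto
qed

lemma phi_b_left_refine:
  assumes j: "2 * p \<le> 2 ^ j" and n: "n < p"
  shows "ae_comb (phi_b p \<phi> (Suc j)) {..<2 ^ Suc j} (phi_b p \<phi> j n)"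
proof -
  obtain c where c: "AE y in lborel. phi_left p \<phi> n y = (\<Sum>i\<in>{..<3 * p}. c i * zoom_system i y)"
    using phi_left_refine[OF n] by (auto simp: ae_comb_def)
  have "AE x in lborel. phi_left p \<phi> n (0 + 2 ^ j * x) = (\<Sum>i\<in>{..<3 * p}. c i * zoom_system i (0 + 2 ^ j * x))"
    by (rule AE_lborel_affine[OF c]) simp
  \<comment> \<open>The factor \<open>1 / sqrt 2\<close> is the ratio of the normalisations of the
    two scales, which \<open>zoom_system\<close> omits.\<close>
  then have "AE x in lborel. phi_b p \<phi> j n x = (\<Sum>i\<in>{..<3 * p}. (c i / complex_of_real (sqrt 2)) * phi_b p \<phi> (Suc j) i x)"
  proof eventually_elim
    case (elim x)
    show ?case
    proof (cases "x \<in> {0..1}")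
      case True
      have s: "2 powr ((1 + real j) / 2) = sqrt 2 * 2 powr (real j / 2)"
        by (simp add: add_divide_distrib powr_add powr_half_sqrt)
      have b: "phi_b p \<phi> (Suc j) i x = complex_of_real (2 powr (real (Suc j) / 2)) * zoom_system i (2 ^ j * x)" if "i < 3 * p" for i
      proof -
        \<comment> \<open>As \<open>4 * p \<le> 2 ^ Suc j\<close>, the \<open>3 * p\<close>
          functions in use stay clear of the right boundary.\<close>
        have "i < 2 ^ Suc j - p" using that j by simp
        then show ?thesis using True by (simp add: phi_b_def interval_system_def zoom_system_def mult.assoc)
      qed
      have "phi_b p \<phi> j n x = complex_of_real (2 powr (real j / 2)) * phi_left p \<phi> n (2 ^ j * x)"
        using True n by (simp add: phi_b_def interval_system_def)
      also have "\<dots> = (\<Sum>i\<in>{..<3 * p}. c i * (complex_of_real (2 powr (real j / 2)) * zoom_system i (2 ^ j * x)))"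
        using elim by (simp add: sum_distrib_left mult_ac)
      also have "\<dots> = (\<Sum>i\<in>{..<3 * p}. (c i / complex_of_real (sqrt 2)) * phi_b p \<phi> (Suc j) i x)"
        by (intro sum.cong refl) (simp add: b s)
      finally show ?thesis .
    next
      case False
      then show ?thesis by (simp add: phi_b_eq_unit_system del: atLeastAtMost_iff)
    qed
  qed
  then have "ae_comb (phi_b p \<phi> (Suc j)) {..<3 * p} (phi_b p \<phi> j n)" unfolding ae_comb_def by (intro exI)
  then show ?thesis by (rule ae_comb_mono) (use j in auto)
qed

lemma phi_b_interior_refine:
  assumes j: "2 * p \<le> 2 ^ j" and n: "p \<le> n" "n < 2 ^ j - p"
  shows "ae_comb (phi_b p \<phi> (Suc j)) {..<2 ^ Suc j} (phi_b p \<phi> j n)"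
proof -
  let ?D = "{1 - int p..int p}"
  have "AE x in lborel. \<phi> (- real n + 2 ^ j * x) = sqrt 2 * (\<Sum>k\<in>?D. h k * \<phi> (2 * (- real n + 2 ^ j * x) - of_int k))"
    by (rule AE_lborel_affine[OF refine]) simp
  then have "AE x in lborel. phi_b p \<phi> j n x = (\<Sum>m\<in>{..<2 ^ Suc j}. complex_of_real (h (int m - 2 * int n)) * phi_b p \<phi> (Suc j) m x)"
  proof eventually_elim
    case (elim x)
    show ?case
    proof (cases "x \<in> {0..1}")
      case True
      have s: "2 powr ((1 + real j) / 2) = sqrt 2 * 2 powr (real j / 2)"
        by (simp add: add_divide_distrib powr_add powr_half_sqrt)
      have "(\<Sum>k\<in>?D. h k * \<phi> (2 * (- real n + 2 ^ j * x) - of_int k)) =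
        (\<Sum>m\<in>{m. int m - 2 * int n \<in> ?D}. h (int m - 2 * int n) * \<phi> (2 ^ Suc j * x - real m))"
        by (rule sum.reindex_bij_witness[of _ "\<lambda>m. int m - 2 * int n" "\<lambda>k. nat (k + 2 * int n)"])
           (use n in \<open>auto simp: algebra_simps\<close>)
      then have "phi_b p \<phi> j n x = complex_of_real (2 powr (real (Suc j) / 2) * 
         (\<Sum>m\<in>{m. int m - 2 * int n \<in> ?D}. h (int m - 2 * int n) * \<phi> (2 ^ Suc j * x - real m)))"
        using True n elim by (simp add: phi_b_def interval_system_def s)
      also have "\<dots> = (\<Sum>m\<in>{m. int m - 2 * int n \<in> ?D}. complex_of_real (h (int m - 2 * int n)) * (complex_of_real (2 powr (real (Suc j) / 2)) * complex_of_real (\<phi> (2 ^ Suc j * x - real m))))"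
        by (simp add: sum_distrib_left mult_ac)
      also have "\<dots> = (\<Sum>m\<in>{m. int m - 2 * int n \<in> ?D}. complex_of_real (h (int m - 2 * int n)) * phi_b p \<phi> (Suc j) m x)"
      proof (intro sum.cong refl)
        fix m assume m: "m \<in> {m. int m - 2 * int n \<in> ?D}"
        \<comment> \<open>With \<open>p \<le> n < 2 ^ j - p\<close> and a tap \<open>k\<close> in
          \<open>1 - p..p\<close>, the index \<open>m = 2 * n + k\<close> stays in
          \<open>p..<2 ^ Suc j - p\<close>: interior functions refine into interior functions
          only.\<close>
        have "n + p < 2 ^ j" using n by simp
        then have "\<not> m < p" "m < 2 ^ Suc j - p" using m n by auto
        then have "phi_b p \<phi> (Suc j) m x = complex_of_real (2 powr (real (Suc j) / 2)) * complex_of_real (\<phi> (2 ^ Suc j * x - real m))"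
          using True unfolding phi_b_def interval_system_def by simp
        then show "complex_of_real (h (int m - 2 * int n)) * (complex_of_real (2 powr (real (Suc j) / 2)) * complex_of_real (\<phi> (2 ^ Suc j * x - real m))) =
          complex_of_real (h (int m - 2 * int n)) * phi_b p \<phi> (Suc j) m x" by simp
      qed
      also have "\<dots> = (\<Sum>m\<in>{..<2 ^ Suc j}. complex_of_real (h (int m - 2 * int n)) * phi_b p \<phi> (Suc j) m x)"
      proof (rule sum.mono_neutral_left)
        have "n + p < 2 ^ j" using n by simp
        then show "{m. int m - 2 * int n \<in> ?D} \<subseteq> {..<2 ^ Suc j}" by auto
        show "\<forall>m\<in>{..<2 ^ Suc j} - {m. int m - 2 * int n \<in> ?D}. complex_of_real (h (int m - 2 * int n)) * phi_b p \<phi> (Suc j) m x = 0"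
          using h_supp by simp
      qed simp
      finally show ?thesis .
    next
      case False
      then show ?thesis by (simp add: phi_b_eq_unit_system del: atLeastAtMost_iff)
    qed
  qed
  then show ?thesis unfolding ae_comb_def by (intro exI)
qed

text \<open>At the right end, the refinement of the left functions of the reflected scaling function
  is pulled back by \<open>phi_b_reflect\<close>.\<close>

lemma phi_b_refine:
  assumes j: "2 * p \<le> 2 ^ j" and n: "n < 2 ^ j"
  shows "ae_comb (phi_b p \<phi> (Suc j)) {..<2 ^ Suc j} (phi_b p \<phi> j n)"
proof -
  consider "n < p" | "p \<le> n" "n < 2 ^ j - p" | "2 ^ j - p \<le> n" by linarith
  then show ?thesis
  proof cases
    case 1 then show ?thesis by (intro phi_b_left_refine j)
  next
    case 2 then show ?thesis by (intro phi_b_interior_refine j)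
  next
    case 3
    interpret r: scaling_function p "\<lambda>x. \<phi> (1 - x)" "\<lambda>k. h (1 - k)" by (rule reflected)
    let ?r = "\<lambda>x. \<phi> (1 - x)"
    have n': "2 ^ j - 1 - n < p" using 3 n p_pos by linarith
    have refl: "phi_b p ?r i m (1 - x) = phi_b p \<phi> i (2 ^ i - 1 - m) x" if "m < 2 ^ i" "2 * p \<le> 2 ^ i" for i m x
      using phi_b_reflect[OF that, of ?r x] by simp
    obtain c where c: "AE x in lborel. phi_b p ?r j (2 ^ j - 1 - n) x = (\<Sum>m\<in>{..<2 ^ Suc j}. c m * phi_b p ?r (Suc j) m x)"
      using r.phi_b_left_refine[OF j n'] by (auto simp: ae_comb_def)
    have "AE x in lborel. phi_b p ?r j (2 ^ j - 1 - n) (1 + (-1) * x) = (\<Sum>m\<in>{..<2 ^ Suc j}. c m * phi_b p ?r (Suc j) m (1 + (-1) * x))"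
      by (rule AE_lborel_affine[OF c]) simp
    then have "AE x in lborel. phi_b p \<phi> j n x = (\<Sum>m\<in>{..<2 ^ Suc j}. c (2 ^ Suc j - 1 - m) * phi_b p \<phi> (Suc j) m x)"
    proof eventually_elim
      case (elim x)
      have "phi_b p \<phi> j n x = phi_b p ?r j (2 ^ j - 1 - n) (1 - x)"
        using refl[of "2 ^ j - 1 - n" j x] n j by simp
      also have "\<dots> = (\<Sum>m\<in>{..<2 ^ Suc j}. c m * phi_b p ?r (Suc j) m (1 - x))"
        using elim by simp
      also have "\<dots> = (\<Sum>m\<in>{..<2 ^ Suc j}. c m * phi_b p \<phi> (Suc j) (2 ^ Suc j - 1 - m) x)"
        by (intro sum.cong refl arg_cong2[where f="(*)"] refl) (use j in auto)
      also have "\<dots> = (\<Sum>m\<in>{..<2 ^ Suc j}. c (2 ^ Suc j - 1 - m) * phi_b p \<phi> (Suc j) m x)"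
        by (rule sum.reindex_bij_witness[of _ "\<lambda>m. 2 ^ Suc j - 1 - m" "\<lambda>m. 2 ^ Suc j - 1 - m"]) auto
      finally show ?case .
    qed
    then show ?thesis unfolding ae_comb_def by (intro exI)
  qed
qed

lemma phi_b_nested:
  assumes j: "2 * p \<le> 2 ^ j" and n: "n < 2 ^ j" and jJ: "j \<le> J"
  shows "ae_comb (phi_b p \<phi> J) {..<2 ^ J} (phi_b p \<phi> j n)"
  using jJ
proof (induction J rule: dec_induct)
  case base
  show ?case using n by (intro ae_comb_base[of _ n]) auto
next
  case (step J)
  have "2 * p \<le> 2 ^ J" using j step(1) by (meson le_trans one_le_numeral power_increasing)
  then show ?case
    using phi_b_refine by (intro ae_comb_trans[OF _ _ step.IH]) auto
qed

end

section \<open>Approximation by trigonometric polynomials\<close>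

lemma L2_shift_modulus_finite:
  fixes G :: "(real \<Rightarrow> complex) set"
  assumes "finite G" "\<And>g. g \<in> G \<Longrightarrow> g \<in> L2_fun" "0 < \<omega>"
  obtains \<eta> where "0 < \<eta>" "\<eta> \<le> 1" "\<And>g s. g \<in> G \<Longrightarrow> \<bar>s\<bar> \<le> \<eta> \<Longrightarrow> (L2_nrm (\<lambda>x. g x - g (x - s)))\<^sup>2 \<le> \<omega>"
proof -
  have "\<forall>\<^sub>F s in at 0. \<forall>g\<in>G. (L2_nrm (\<lambda>x. g x - g (x - s)))\<^sup>2 < \<omega>"
  proof (subst eventually_ball_finite_distrib[OF assms(1)], rule ballI)
    fix g assume "g \<in> G"
    then show "\<forall>\<^sub>F s in at 0. (L2_nrm (\<lambda>x. g x - g (x - s)))\<^sup>2 < \<omega>"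
      using L2_shift_cont_L2_fun[OF assms(2)[OF \<open>g \<in> G\<close>]] assms(3) unfolding L2_shift_cont_def by (intro order_tendstoD) auto
  qed
  then obtain d where d: "0 < d" "\<And>s. s \<noteq> 0 \<Longrightarrow> dist s 0 < d \<Longrightarrow> \<forall>g\<in>G. (L2_nrm (\<lambda>x. g x - g (x - s)))\<^sup>2 < \<omega>"
    unfolding eventually_at by blast
  show ?thesis
  \<comment> \<open>Halving \<open>d\<close> turns the strict bound into a weak one; the cap 1 will
    ensure that a translation moves a support by at most one unit.\<close>
  proof (rule that[of "min 1 (d / 2)"])
    fix g and s :: real assume g: "g \<in> G" and s: "\<bar>s\<bar> \<le> min 1 (d / 2)"
    show "(L2_nrm (\<lambda>x. g x - g (x - s)))\<^sup>2 \<le> \<omega>"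
    proof (cases "s = 0")
      case True
      then show ?thesis using assms(3) by (simp add: L2_nrm_def)
    next
      case False
      then have "(L2_nrm (\<lambda>x. g x - g (x - s)))\<^sup>2 < \<omega>" using d(2)[OF False] g s d(1) by auto
      then show ?thesis by simp
    qed
  qed (use d(1) in auto)
qed

lemma card_nat_near: "finite {n::nat. \<bar>y - real n\<bar> \<le> real r}" "card {n::nat. \<bar>y - real n\<bar> \<le> real r} \<le> 2 * r + 2"
proof -
  have sub: "{n::nat. \<bar>y - real n\<bar> \<le> real r} \<subseteq> nat ` {\<lfloor>y\<rfloor> - int r..\<lfloor>y\<rfloor> + int r + 1}"
  proof
    fix n :: nat assume "n \<in> {n. \<bar>y - real n\<bar> \<le> real r}"
    then have "\<lfloor>y\<rfloor> - int r \<le> int n" "int n \<le> \<lfloor>y\<rfloor> + int r + 1" by (auto simp: abs_le_iff) linarith+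
    then show "n \<in> nat ` {\<lfloor>y\<rfloor> - int r..\<lfloor>y\<rfloor> + int r + 1}" by (intro image_eqI[of _ _ "int n"]) auto
  qed
  then show "finite {n::nat. \<bar>y - real n\<bar> \<le> real r}" by (rule finite_subset) simp
  have "card {n::nat. \<bar>y - real n\<bar> \<le> real r} \<le> card (nat ` {\<lfloor>y\<rfloor> - int r..\<lfloor>y\<rfloor> + int r + 1})"
    by (intro card_mono sub) simp
  also have "\<dots> \<le> card {\<lfloor>y\<rfloor> - int r..\<lfloor>y\<rfloor> + int r + 1}" by (rule card_image_le) simp
  finally show "card {n::nat. \<bar>y - real n\<bar> \<le> real r} \<le> 2 * r + 2" by simp
qed

lemma fejer_mean_lincomb:
  assumes "\<And>i. i \<in> I \<Longrightarrow> integrable lborel (F i)"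
  shows "fejer_mean \<epsilon> M (\<lambda>x. \<Sum>i\<in>I. c i * F i x) x = (\<Sum>i\<in>I. c i * fejer_mean \<epsilon> M (F i) x)"
proof -
  have cm [measurable]: "(\<lambda>y. cis (- (d * y))) \<in> borel_measurable borel" for d
    by (intro borel_measurable_continuous_onI continuous_intros)
  have i: "integrable lborel (\<lambda>y. cis (- (d * y)) * F i y)" if "i \<in> I" for d i
    by (rule Bochner_Integration.integrable_bound[OF assms[OF that]]) (use assms[OF that] in \<open>auto simp: norm_mult\<close>)
  have "(LINT y|lborel. cis (- (d * y)) * (\<Sum>i\<in>I. c i * F i y)) = (\<Sum>i\<in>I. c i * (LINT y|lborel. cis (- (d * y)) * F i y))" for d
  proof -
    have "(LINT y|lborel. cis (- (d * y)) * (\<Sum>i\<in>I. c i * F i y)) = (LINT y|lborel. (\<Sum>i\<in>I. c i * (cis (- (d * y)) * F i y)))"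
      by (simp add: sum_distrib_left mult_ac)
    also have "\<dots> = (\<Sum>i\<in>I. LINT y|lborel. c i * (cis (- (d * y)) * F i y))"
      by (intro Bochner_Integration.integral_sum integrable_mult_right i)
    finally show ?thesis by simp
  qed
  note * = this
  have "fejer_mean \<epsilon> M (\<lambda>x. \<Sum>i\<in>I. c i * F i x) x = (\<Sum>k\<le>M. \<Sum>l\<le>M. \<Sum>i\<in>I. c i * (complex_of_real (\<epsilon> / (real M + 1)) *
     (LINT y|lborel. cis (- (2 * pi * \<epsilon> * (real k - real l) * y)) * F i y) *
     cis (2 * pi * \<epsilon> * (real k - real l) * x)))"
    unfolding fejer_mean_def * by (simp only: sum_distrib_left sum_distrib_right mult_ac)
  also have "\<dots> = (\<Sum>i\<in>I. \<Sum>k\<le>M. \<Sum>l\<le>M. c i * (complex_of_real (\<epsilon> / (real M + 1)) *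
     (LINT y|lborel. cis (- (2 * pi * \<epsilon> * (real k - real l) * y)) * F i y) *
     cis (2 * pi * \<epsilon> * (real k - real l) * x)))"
    by (rule trans[OF sum.cong[OF refl sum.swap] sum.swap])
  finally show ?thesis by (simp only: fejer_mean_def sum_distrib_left)
qed

definition trig_approx :: "real \<Rightarrow> nat \<Rightarrow> (real \<Rightarrow> complex) \<Rightarrow> real \<Rightarrow> complex" where
  "trig_approx \<epsilon> M f x = indicator {0..1} x * fejer_mean \<epsilon> M f x"

lemma trig_approx_measurable [measurable]: "trig_approx \<epsilon> M f \<in> borel_measurable borel"
  unfolding trig_approx_def by measurable

section \<open>Translation modulus and approximation in one variable, uniformly in the scale\<close>

context scaling_function
begin

text \<open>Up to translation the system consists of \<open>\<phi>\<close>, \<open>p\<close> left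
  and \<open>p\<close> right functions, for all \<open>j\<close> at once. A finite set has a common
  modulus, which is the origin of the uniformity in \<open>j\<close>.\<close>

lemma unit_system_modulus:
  assumes "0 < \<omega>"
  obtains \<eta> where "0 < \<eta>" "\<eta> \<le> 1"
    "\<And>j n s. n < 2 ^ j \<Longrightarrow> \<bar>s\<bar> \<le> \<eta> \<Longrightarrow> (L2_nrm (\<lambda>y. unit_system p \<phi> j n y - unit_system p \<phi> j n (y - s)))\<^sup>2 \<le> \<omega>"
proof -
  let ?f = "\<lambda>x. complex_of_real (\<phi> x)"
  let ?G = "insert ?f (phi_left p \<phi> ` {..<p} \<union> phi_right p \<phi> ` {..<p})"
  obtain \<eta> where \<eta>: "0 < \<eta>" "\<eta> \<le> 1" "\<And>g s. g \<in> ?G \<Longrightarrow> \<bar>s\<bar> \<le> \<eta> \<Longrightarrow> (L2_nrm (\<lambda>x. g x - g (x - s)))\<^sup>2 \<le> \<omega>"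
    by (rule L2_shift_modulus_finite[of ?G \<omega>]) (use assms L2_phi phi_left_gram_schmidt(1) phi_right_L2 in auto)
  have sh: "L2_nrm (\<lambda>y. g (y - a) - g (y - s - a)) = L2_nrm (\<lambda>y. g y - g (y - s))" for g a and s :: real
    using L2_nrm_shift[of "\<lambda>y. g y - g (y - s)" a] by (simp add: algebra_simps)
  show ?thesis
  proof (rule that[OF \<eta>(1,2)])
    fix j n :: nat and s :: real assume n: "n < 2 ^ j" and s: "\<bar>s\<bar> \<le> \<eta>"
    consider "n < p" | "\<not> n < p" "n < 2 ^ j - p" | "\<not> n < p" "\<not> n < 2 ^ j - p" by blast
    then show "(L2_nrm (\<lambda>y. unit_system p \<phi> j n y - unit_system p \<phi> j n (y - s)))\<^sup>2 \<le> \<omega>"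
    proof cases
      case 1
      then show ?thesis using \<eta>(3)[of "phi_left p \<phi> n" s] s by (simp add: unit_system_def)
    next
      case 2
      then show ?thesis using \<eta>(3)[of ?f s] s sh[of ?f "real n" s] by (simp add: unit_system_def)
    next
      case 3
      then have "2 ^ j - 1 - n < p" using n by linarith
      then show ?thesis using 3 \<eta>(3)[of "phi_right p \<phi> (2 ^ j - 1 - n)" s] s sh[of "phi_right p \<phi> (2 ^ j - 1 - n)" "2 ^ j" s]
        by (simp add: unit_system_def)
    qed
  qed
qed

lemma L2_nrm_dilate:
  fixes v :: "real \<Rightarrow> complex"
  shows "(L2_nrm (\<lambda>x. complex_of_real (2 powr (real j / 2)) * v (2 ^ j * x)))\<^sup>2 = (L2_nrm v)\<^sup>2"
proof -
  have "(L2_nrm (\<lambda>x. complex_of_real (2 powr (real j / 2)) * v (2 ^ j * x)))\<^sup>2 = 2 ^ j * (LINT x|lborel. (norm (v (0 + 2 ^ j * x)))\<^sup>2)"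
    unfolding L2_nrm_sq by (simp add: norm_mult power_mult_distrib powr_half_sq)
  also have "\<dots> = (L2_nrm v)\<^sup>2"
    unfolding L2_nrm_sq using lborel_integral_real_affine[of "2 ^ j" "\<lambda>x. (norm (v x))\<^sup>2" 0] by simp
  finally show ?thesis .
qed

text \<open>The normalised dilation preserves norms and turns a shift by \<open>t\<close> into one
  by \<open>2 ^ j * t\<close>, so that only this product matters.\<close>

lemma phi_b_shift_nrm:
  assumes j: "2 * p \<le> 2 ^ j" and n: "n < 2 ^ j"
  shows "(L2_nrm (\<lambda>x. phi_b p \<phi> j n x - phi_b p \<phi> j n (x - t)))\<^sup>2 =
    (L2_nrm (\<lambda>y. unit_system p \<phi> j n y - unit_system p \<phi> j n (y - 2 ^ j * t)))\<^sup>2"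
proof -
  let ?c = "complex_of_real (2 powr (real j / 2))" and ?u = "unit_system p \<phi> j n"
  have [measurable]: "?u \<in> borel_measurable borel" using unit_system_L2 by (simp add: L2_fun_measurable)
  have "AE x in lborel. phi_b p \<phi> j n (- t + 1 * x) = ?c * ?u (2 ^ j * (- t + 1 * x))"
    by (rule AE_lborel_affine[OF phi_b_unit_system[OF j n]]) simp
  with phi_b_unit_system[OF j n]
  have "AE x in lborel. phi_b p \<phi> j n x - phi_b p \<phi> j n (x - t) = ?c * (?u (2 ^ j * x) - ?u (2 ^ j * x - 2 ^ j * t))"
    by eventually_elim (simp add: right_diff_distrib)
  then have "L2_nrm (\<lambda>x. phi_b p \<phi> j n x - phi_b p \<phi> j n (x - t)) = L2_nrm (\<lambda>x. ?c * (?u (2 ^ j * x) - ?u (2 ^ j * x - 2 ^ j * t)))"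
    by (rule L2_nrm_cong_AE) measurable
  then show ?thesis using L2_nrm_dilate[of j "\<lambda>y. ?u y - ?u (y - 2 ^ j * t)"] by simp
qed

lemma AE_phi_b_local:
  assumes "p \<le> n" "n < 2 ^ j - p"
  shows "AE x in lborel. phi_b p \<phi> j n x \<noteq> 0 \<longrightarrow> \<bar>2 ^ j * x - real n\<bar> \<le> real p"
proof -
  have "(2::real) ^ j \<noteq> 0" by simp
  from AE_phi_affine[OF this, of "- real n"] show ?thesis
    by eventually_elim (use assms in \<open>auto simp: phi_b_def interval_system_def split: if_splits\<close>)
qed

text \<open>At almost every point only boundedly many of the functions differ from their translates.\<close>

lemma phi_b_modulus:
  assumes "0 < \<omega>"
  obtains \<eta> where "0 < \<eta>"
    "\<And>j t c. 2 * p \<le> 2 ^ j \<Longrightarrow> \<bar>t\<bar> \<le> \<eta> / 2 ^ j \<Longrightarrow>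
      (L2_nrm (\<lambda>x. (\<Sum>n<2 ^ j. c n * phi_b p \<phi> j n x) - (\<Sum>n<2 ^ j. c n * phi_b p \<phi> j n (x - t))))\<^sup>2
        \<le> \<omega> * (\<Sum>n<2 ^ j. (norm (c n))\<^sup>2)"
proof -
  \<comment> \<open>At a given point at most \<open>p\<close> left, \<open>p\<close> right and
    \<open>2 * (p + 1) + 2\<close> interior functions contribute, in total \<open>4 * p + 4\<close>;
    the 1 in \<open>p + 1\<close> accounts for the shift.\<close>
  define N where "N = 4 * p + 4"
  have N: "0 < real N" by (simp add: N_def)
  obtain \<eta> where \<eta>: "0 < \<eta>" "\<eta> \<le> 1"
    "\<And>j n s. n < 2 ^ j \<Longrightarrow> \<bar>s\<bar> \<le> \<eta> \<Longrightarrow> (L2_nrm (\<lambda>y. unit_system p \<phi> j n y - unit_system p \<phi> j n (y - s)))\<^sup>2 \<le> \<omega> / real N"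
    by (rule unit_system_modulus[OF divide_pos_pos[OF assms N]], rule that, assumption+)
  show ?thesis
  proof (rule that[OF \<eta>(1)])
    fix j t and c :: "nat \<Rightarrow> complex" assume j: "2 * p \<le> 2 ^ j" and t: "\<bar>t\<bar> \<le> \<eta> / 2 ^ j"
    let ?I = "{..<2 ^ j} :: nat set"
    let ?\<Phi> = "phi_b p \<phi> j"
    define D where "D n x = ?\<Phi> n x - ?\<Phi> n (x - t)" for n x
    have t1: "\<bar>2 ^ j * t\<bar> \<le> \<eta>" using t by (simp add: abs_mult field_simps)
    have DL: "D n \<in> L2_fun" if "n \<in> ?I" for n
      unfolding D_def using phi_b_L2[OF j] that by (intro L2_fun_diff L2_fun_shift) auto
    have Dn: "(L2_nrm (D n))\<^sup>2 \<le> \<omega> / real N" if "n \<in> ?I" for n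
      using \<eta>(3)[OF _ t1, of n j] phi_b_shift_nrm[OF j, of n t] that unfolding D_def[abs_def] by simp
    let ?int = "{n\<in>?I. p \<le> n \<and> n < 2 ^ j - p}"
    have "AE x in lborel. \<forall>n\<in>?int. D n x \<noteq> 0 \<longrightarrow> \<bar>2 ^ j * x - real n\<bar> \<le> real (p + 1)"
    proof (subst AE_finite_all, simp, intro ballI)
      fix n assume n: "n \<in> ?int"
      then have l: "AE x in lborel. ?\<Phi> n x \<noteq> 0 \<longrightarrow> \<bar>2 ^ j * x - real n\<bar> \<le> real p" by (intro AE_phi_b_local) auto
      have "AE x in lborel. ?\<Phi> n (- t + 1 * x) \<noteq> 0 \<longrightarrow> \<bar>2 ^ j * (- t + 1 * x) - real n\<bar> \<le> real p"
        by (rule AE_lborel_affine[OF l]) simp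
      with l show "AE x in lborel. D n x \<noteq> 0 \<longrightarrow> \<bar>2 ^ j * x - real n\<bar> \<le> real (p + 1)"
      proof eventually_elim
        case (elim x)
        show ?case
        proof
          assume "D n x \<noteq> 0"
          then have "?\<Phi> n x \<noteq> 0 \<or> ?\<Phi> n (x - t) \<noteq> 0" by (auto simp: D_def)
          then show "\<bar>2 ^ j * x - real n\<bar> \<le> real (p + 1)"
          proof
            assume "?\<Phi> n (x - t) \<noteq> 0"
            then have "\<bar>2 ^ j * x - 2 ^ j * t - real n\<bar> \<le> real p" using elim(2) by (simp add: right_diff_distrib)
            then show ?thesis using t1 \<eta>(2) by simp
          qed (use elim(1) in auto)
        qed
      qed
    qed
    \<comment> \<open>Cauchy-Schwarz over the at most \<open>N\<close> nonzero terms takes the place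
      of orthogonality, which the differences \<open>D n\<close> lack in general.\<close>
    then have pw: "AE x in lborel. (norm (\<Sum>n\<in>?I. c n * D n x))\<^sup>2 \<le> real N * (\<Sum>n\<in>?I. (norm (c n))\<^sup>2 * (norm (D n x))\<^sup>2)"
    proof eventually_elim
      case (elim x)
      let ?A = "{n\<in>?I. D n x \<noteq> 0}" and ?B = "{n::nat. \<bar>2 ^ j * x - real n\<bar> \<le> real (p + 1)}"
      have "?A \<subseteq> {..<p} \<union> {2 ^ j - p..<2 ^ j} \<union> ?B" using elim by auto
      note sub = this
      have "finite ({..<p} \<union> {2 ^ j - p..<2 ^ j} \<union> ?B)"
        by (intro finite_UnI card_nat_near(1)) simp_all
      then have "card ?A \<le> card ({..<p} \<union> {2 ^ j - p..<2 ^ j} \<union> ?B)"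
        using sub by (rule card_mono)
      also have "\<dots> \<le> card {..<p} + card {2 ^ j - p..<(2::nat) ^ j} + card ?B"
        by (meson card_Un_le add_le_mono le_refl le_trans)
      also have "\<dots> \<le> N" using card_nat_near(2)[of "2 ^ j * x" "p + 1"] by (simp add: N_def)
      finally have cA: "card ?A \<le> N" .
      have "(\<Sum>n\<in>?I. c n * D n x) = (\<Sum>n\<in>?A. c n * D n x)" by (rule sum.mono_neutral_right) auto
      then have "(norm (\<Sum>n\<in>?I. c n * D n x))\<^sup>2 \<le> real (card ?A) * (\<Sum>n\<in>?A. (norm (c n * D n x))\<^sup>2)"
        by (simp only: norm_sum_sq_le)
      also have "\<dots> \<le> real N * (\<Sum>n\<in>?I. (norm (c n * D n x))\<^sup>2)"
        using cA by (intro mult_mono sum_mono2 sum_nonneg) auto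
      finally show ?case by (simp add: norm_mult power_mult_distrib)
    qed
    have "(L2_nrm (\<lambda>x. \<Sum>n\<in>?I. c n * D n x))\<^sup>2 \<le> (LINT x|lborel. real N * (\<Sum>n\<in>?I. (norm (c n))\<^sup>2 * (norm (D n x))\<^sup>2))"
      unfolding L2_nrm_sq
      by (intro integral_mono_AE pw L2_funD L2_fun_lincomb DL integrable_mult_right Bochner_Integration.integrable_sum)
    also have "\<dots> = real N * (\<Sum>n\<in>?I. (norm (c n))\<^sup>2 * (L2_nrm (D n))\<^sup>2)"
      unfolding L2_nrm_sq
      by (simp add: Bochner_Integration.integral_sum integrable_mult_right L2_funD DL)
    also have "\<dots> \<le> real N * (\<Sum>n\<in>?I. (norm (c n))\<^sup>2 * (\<omega> / real N))"
      by (intro mult_left_mono sum_mono Dn) auto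
    also have "\<dots> = \<omega> * (\<Sum>n\<in>?I. (norm (c n))\<^sup>2)"
      using N by (simp add: sum_distrib_left sum_distrib_right[symmetric] mult.commute)
    finally show "(L2_nrm (\<lambda>x. (\<Sum>n<2 ^ j. c n * ?\<Phi> n x) - (\<Sum>n<2 ^ j. c n * ?\<Phi> n (x - t))))\<^sup>2 \<le> \<omega> * (\<Sum>n<2 ^ j. (norm (c n))\<^sup>2)"
      by (simp add: D_def right_diff_distrib sum_subtractf)
  qed
qed

lemma phi_b_lincomb_nrm:
  assumes j: "2 * p \<le> 2 ^ j"
  shows "(L2_nrm (\<lambda>x. \<Sum>n<2 ^ j. c n * phi_b p \<phi> j n x))\<^sup>2 = (\<Sum>n<2 ^ j. (norm (c n))\<^sup>2 * (L2_nrm (phi_b p \<phi> j n))\<^sup>2)"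
proof (rule L2_nrm_orthogonal_sum)
  show "phi_b p \<phi> j n \<in> L2_fun" if "n \<in> {..<2 ^ j}" for n using phi_b_L2[OF j] that by simp
  show "L2_inner (phi_b p \<phi> j n) (phi_b p \<phi> j m) = 0" if "n \<in> {..<2 ^ j}" "m \<in> {..<2 ^ j}" "n \<noteq> m" for n m
    using phi_b_orthogonal[OF j, of n m] that by simp
qed simp

lemma phi_b_nrm_le_1:
  assumes "2 * p \<le> 2 ^ j" "n < 2 ^ j" shows "(L2_nrm (phi_b p \<phi> j n))\<^sup>2 \<le> 1"
  using phi_b_nrm[OF assms] by (auto simp: L2_nrm_def)

text \<open>An inequality only, since a boundary function that came out as zero contributes nothing
  on the left.\<close>

lemma phi_b_bessel:
  assumes j: "2 * p \<le> 2 ^ j"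
  shows "(L2_nrm (\<lambda>x. \<Sum>n<2 ^ j. c n * phi_b p \<phi> j n x))\<^sup>2 \<le> (\<Sum>n<2 ^ j. (norm (c n))\<^sup>2)"
  unfolding phi_b_lincomb_nrm[OF j]
  by (intro sum_mono mult_left_le phi_b_nrm_le_1 j) auto

lemma phi_b_outside: "x \<notin> {0..1} \<Longrightarrow> phi_b p \<phi> j n x = 0"
  by (simp only: phi_b_eq_unit_system if_False)

text \<open>A bound for all coefficient vectors at once, which is the form that passes to tensor
  products. Shifts are split at \<open>\<eta> / 2 ^ j\<close> and the degree is
  \<open>K * 2 ^ j\<close>, so that \<open>2 ^ j\<close> cancels in the tail term.\<close>

proposition phi_b_trig_approx:
  assumes "0 < \<delta>"
  obtains S where "0 < S"
    "\<And>\<epsilon> j K c. 0 < \<epsilon> \<Longrightarrow> \<epsilon> \<le> 1 \<Longrightarrow> 2 * p \<le> 2 ^ j \<Longrightarrow> S \<le> \<epsilon> * real K \<Longrightarrow>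
      energy (\<lambda>x. \<Sum>n<2 ^ j. c n * (phi_b p \<phi> j n x - trig_approx \<epsilon> (K * 2 ^ j) (phi_b p \<phi> j n) x))
        \<le> ennreal (\<delta> * (\<Sum>n<2 ^ j. (norm (c n))\<^sup>2))"
proof -
  obtain \<eta> where \<eta>: "0 < \<eta>"
    "\<And>j t c. 2 * p \<le> 2 ^ j \<Longrightarrow> \<bar>t\<bar> \<le> \<eta> / 2 ^ j \<Longrightarrow>
      (L2_nrm (\<lambda>x. (\<Sum>n<2 ^ j. c n * phi_b p \<phi> j n x) - (\<Sum>n<2 ^ j. c n * phi_b p \<phi> j n (x - t))))\<^sup>2
        \<le> \<delta> / 6 * (\<Sum>n<2 ^ j. (norm (c n))\<^sup>2)"
  proof -
    have "0 < \<delta> / 6" using assms by simp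
    show thesis by (rule phi_b_modulus[OF \<open>0 < \<delta> / 6\<close>], rule that, assumption+)
  qed
  \<comment> \<open>Chosen so that the tail term \<open>2 * C / (S * \<eta>)\<close> equals
    \<open>\<delta> * C / 6\<close>. With a modulus term of the same size and the factor 3 in
    \<open>fejer_mean_error\<close>, the total is \<open>\<delta> * C\<close>.\<close>
  define S where "S = 12 / (\<eta> * \<delta>)"
  have S: "0 < S" using \<eta>(1) assms by (simp add: S_def)
  show ?thesis
  proof (rule that[OF S])
    fix \<epsilon> :: real and j K and c :: "nat \<Rightarrow> complex"
    assume e: "0 < \<epsilon>" "\<epsilon> \<le> 1" and j: "2 * p \<le> 2 ^ j" and K: "S \<le> \<epsilon> * real K"
    let ?I = "{..<2 ^ j} :: nat set" and ?\<Phi> = "phi_b p \<phi> j" and ?M = "K * 2 ^ j"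
    define F where "F x = (\<Sum>n\<in>?I. c n * ?\<Phi> n x)" for x
    define C where "C = (\<Sum>n\<in>?I. (norm (c n))\<^sup>2)"
    have C: "0 \<le> C" by (simp add: C_def sum_nonneg)
    have FL: "F \<in> L2_fun" unfolding F_def[abs_def] using phi_b_L2[OF j] by (intro L2_fun_lincomb) auto
    have F0: "\<forall>x. x \<notin> {0..1} \<longrightarrow> F x = 0" unfolding F_def using phi_b_outside by (auto intro!: sum.neutral)
    have FC: "(L2_nrm F)\<^sup>2 \<le> C" unfolding F_def[abs_def] C_def by (rule phi_b_bessel[OF j])
    have int: "integrable lborel (?\<Phi> n)" if "n \<in> ?I" for n
      using that phi_b_L2[OF j] phi_b_outside by (intro L2_fun_integrable_bounded_support[of _ 0 1]) auto
    have "(\<Sum>n\<in>?I. c n * (?\<Phi> n x - trig_approx \<epsilon> ?M (?\<Phi> n) x)) = indicator {0..1} x * (F x - fejer_mean \<epsilon> ?M F x)" for x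
    proof -
      have Fx: "F x = indicator {0..1} x * F x" using F0 by (auto simp: indicator_def)
      have "fejer_mean \<epsilon> ?M F x = (\<Sum>n\<in>?I. c n * fejer_mean \<epsilon> ?M (?\<Phi> n) x)"
        unfolding F_def[abs_def] by (rule fejer_mean_lincomb[OF int])
      then have "indicator {0..1} x * fejer_mean \<epsilon> ?M F x = (\<Sum>n\<in>?I. c n * trig_approx \<epsilon> ?M (?\<Phi> n) x)"
        by (simp only: trig_approx_def sum_distrib_left mult.left_commute)
      then show ?thesis
        unfolding right_diff_distrib sum_subtractf F_def[symmetric] using Fx by metis
    qed
    then have "energy (\<lambda>x. \<Sum>n\<in>?I. c n * (?\<Phi> n x - trig_approx \<epsilon> ?M (?\<Phi> n) x)) =
       (\<integral>\<^sup>+x. indicator {0..1} x * ennreal ((norm (F x - fejer_mean \<epsilon> ?M F x))\<^sup>2) \<partial>lborel)"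
      by (intro nn_integral_cong) (auto simp: indicator_def)
    also have "\<dots> \<le> ennreal (3 * (\<delta> / 6 * C + 2 * (L2_nrm F)\<^sup>2 / (\<epsilon> * (real ?M + 1) * (\<eta> / 2 ^ j))))"
    proof (rule fejer_mean_error[OF FL F0 e])
      fix t assume "\<bar>t\<bar> \<le> \<eta> / 2 ^ j"
      then show "(L2_nrm (\<lambda>x. F x - F (x - t)))\<^sup>2 \<le> \<delta> / 6 * C"
        unfolding F_def C_def by (rule \<eta>(2)[OF j])
    qed (use \<eta> assms C in auto)
    also have "\<dots> \<le> ennreal (\<delta> * C)"
    proof (rule ennreal_leI)
      have "S * \<eta> \<le> \<epsilon> * real K * \<eta>" using K \<eta>(1) by (intro mult_right_mono) auto
      also have "\<dots> = \<epsilon> * real ?M * (\<eta> / 2 ^ j)" by simp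
      also have "\<dots> \<le> \<epsilon> * (real ?M + 1) * (\<eta> / 2 ^ j)" using e \<eta>(1) by (intro mult_right_mono mult_left_mono) auto
      finally have le: "S * \<eta> \<le> \<epsilon> * (real ?M + 1) * (\<eta> / 2 ^ j)" .
      have "2 * (L2_nrm F)\<^sup>2 / (\<epsilon> * (real ?M + 1) * (\<eta> / 2 ^ j)) \<le> 2 * C / (S * \<eta>)"
        using FC C le S \<eta>(1) by (intro frac_le) auto
      also have "2 * C / (S * \<eta>) = \<delta> * C / 6" using \<eta>(1) assms by (simp add: S_def)
      finally have le6: "2 * (L2_nrm F)\<^sup>2 / (\<epsilon> * (real ?M + 1) * (\<eta> / 2 ^ j)) \<le> \<delta> * C / 6" .
      have arith: "3 * (\<delta> / 6 * C + X) \<le> \<delta> * C" if "X \<le> \<delta> * C / 6" for X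
        using that by (simp add: field_simps)
      show "3 * (\<delta> / 6 * C + 2 * (L2_nrm F)\<^sup>2 / (\<epsilon> * (real ?M + 1) * (\<eta> / 2 ^ j))) \<le> \<delta> * C" by (rule arith[OF le6])
    qed
    finally show "energy (\<lambda>x. \<Sum>n\<in>?I. c n * (?\<Phi> n x - trig_approx \<epsilon> ?M (?\<Phi> n) x)) \<le> ennreal (\<delta> * (\<Sum>n\<in>?I. (norm (c n))\<^sup>2))"
      unfolding C_def .
  qed
qed

end

section \<open>Tensor products\<close>

lemma borel_measurable_fst_snd_real:
  "(fst :: real \<times> real \<Rightarrow> real) \<in> borel_measurable borel" "(snd :: real \<times> real \<Rightarrow> real) \<in> borel_measurable borel"
  by (auto intro!: borel_measurable_continuous_onI continuous_intros)

lemma nn_integral_lborel_pair: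
  fixes f :: "real \<times> real \<Rightarrow> ennreal"
  assumes [measurable]: "f \<in> borel_measurable borel"
  shows "(\<integral>\<^sup>+z. f z \<partial>lborel) = (\<integral>\<^sup>+y. (\<integral>\<^sup>+x. f (x, y) \<partial>lborel) \<partial>lborel)"
proof -
  have "f \<in> borel_measurable (lborel \<Otimes>\<^sub>M lborel)" unfolding lborel_prod by simp
  from lborel_pair.nn_integral_snd[OF this] show ?thesis unfolding lborel_prod by simp
qed

lemma AE_lborel_fst:
  fixes P :: "real \<Rightarrow> bool"
  assumes "AE x in lborel. P x" shows "AE z in (lborel :: (real \<times> real) measure). P (fst z)"
proof -
  obtain N where N: "N \<in> sets borel" and N0: "emeasure lborel N = 0" and PN: "{x. \<not> P x} \<subseteq> N"
    by (rule AE_lborel_null_set[OF assms])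
  have meas: "(\<lambda>z. indicator N (fst z) :: ennreal) \<in> borel_measurable (borel :: (real \<times> real) measure)"
    by (rule measurable_compose[OF borel_measurable_fst_snd_real(1)]) (use N in simp)
  have "(\<integral>\<^sup>+z. indicator N (fst z) \<partial>(lborel :: (real \<times> real) measure)) = (\<integral>\<^sup>+y. (\<integral>\<^sup>+x. indicator N x \<partial>(lborel :: real measure)) \<partial>(lborel :: real measure))"
    by (subst nn_integral_lborel_pair[OF meas]) simp
  also have "\<dots> = 0" using N N0 by simp
  finally have "AE z in (lborel :: (real \<times> real) measure). indicator N (fst z) = (0::ennreal)"
    using meas by (subst (asm) nn_integral_0_iff_AE) auto
  then show ?thesis by eventually_elim (use PN in \<open>auto simp: indicator_def split: if_splits\<close>)
qed

lemma AE_lborel_snd: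
  fixes P :: "real \<Rightarrow> bool"
  assumes "AE x in lborel. P x" shows "AE z in (lborel :: (real \<times> real) measure). P (snd z)"
proof -
  obtain N where N: "N \<in> sets borel" and N0: "emeasure lborel N = 0" and PN: "{x. \<not> P x} \<subseteq> N"
    by (rule AE_lborel_null_set[OF assms])
  have meas: "(\<lambda>z. indicator N (snd z) :: ennreal) \<in> borel_measurable (borel :: (real \<times> real) measure)"
    by (rule measurable_compose[OF borel_measurable_fst_snd_real(2)]) (use N in simp)
  have "AE y in lborel. y \<notin> N" using N N0 by (intro AE_not_in null_setsI) auto
  then have "AE y in lborel. (\<integral>\<^sup>+x. indicator N (snd (x::real, y::real)) \<partial>(lborel :: real measure)) = 0"
    by eventually_elim simp
  then have "(\<integral>\<^sup>+z. indicator N (snd z) \<partial>(lborel :: (real \<times> real) measure)) = (\<integral>\<^sup>+y. 0 \<partial>(lborel :: real measure))"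
    by (subst nn_integral_lborel_pair[OF meas]) (rule nn_integral_cong_AE)
  then have "AE z in (lborel :: (real \<times> real) measure). indicator N (snd z) = (0::ennreal)"
    using nn_integral_0_iff_AE[of "\<lambda>z. indicator N (snd z)" "lborel :: (real \<times> real) measure"] meas by simp
  then show ?thesis by eventually_elim (use PN in \<open>auto simp: indicator_def split: if_splits\<close>)
qed

lemma tensor_measurable [measurable]:
  "f \<in> borel_measurable borel \<Longrightarrow> g \<in> borel_measurable borel \<Longrightarrow> f \<otimes>\<^sub>f g \<in> borel_measurable borel"
  unfolding tensor_def[abs_def]
  by (intro borel_measurable_times measurable_compose[OF borel_measurable_fst_snd_real(1)]
      measurable_compose[OF borel_measurable_fst_snd_real(2)])

definition tensor_family :: "('i \<Rightarrow> real \<Rightarrow> complex) \<Rightarrow> ('i \<Rightarrow> real \<Rightarrow> complex) \<Rightarrow> 'i \<times> 'i \<Rightarrow> real \<times> real \<Rightarrow> complex" where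
  "tensor_family F G = (\<lambda>(i, k). F i \<otimes>\<^sub>f G k)"

lemma ae_comb_tensor:
  assumes "ae_comb F I f" "ae_comb G K g"
  shows "ae_comb (tensor_family F G) (I \<times> K) (f \<otimes>\<^sub>f g)"
proof -
  obtain c where c: "AE x in lborel. f x = (\<Sum>i\<in>I. c i * F i x)" using assms(1) by (auto simp: ae_comb_def)
  obtain d where d: "AE x in lborel. g x = (\<Sum>k\<in>K. d k * G k x)" using assms(2) by (auto simp: ae_comb_def)
  have "AE z in lborel. (f \<otimes>\<^sub>f g) z = (\<Sum>r\<in>I \<times> K. (c (fst r) * d (snd r)) * tensor_family F G r z)"
    using AE_lborel_fst[OF c] AE_lborel_snd[OF d]
  proof eventually_elim
    case (elim z)
    then show ?case
      by (simp add: tensor_def tensor_family_def sum_product sum.cartesian_product case_prod_unfold mult_ac)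
  qed
  then show ?thesis unfolding ae_comb_def by (intro exI)
qed

lemma energy_tensor_sum:
  fixes A B :: "'i \<Rightarrow> real \<Rightarrow> complex"
  assumes [measurable]: "\<And>i. i \<in> I \<Longrightarrow> A i \<in> borel_measurable borel" "\<And>i. i \<in> I \<Longrightarrow> B i \<in> borel_measurable borel"
  shows "energy (\<lambda>z. \<Sum>i\<in>I. \<Sum>k\<in>I. c i k * (A i \<otimes>\<^sub>f B k) z) =
    (\<integral>\<^sup>+y. energy (\<lambda>x. \<Sum>i\<in>I. (\<Sum>k\<in>I. c i k * B k y) * A i x) \<partial>lborel)"
proof -
  have "energy (\<lambda>z. \<Sum>i\<in>I. \<Sum>k\<in>I. c i k * (A i \<otimes>\<^sub>f B k) z) =
    (\<integral>\<^sup>+y. energy (\<lambda>x. \<Sum>i\<in>I. \<Sum>k\<in>I. c i k * (A i \<otimes>\<^sub>f B k) (x, y)) \<partial>lborel)"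
    by (rule nn_integral_lborel_pair) measurable
  then show ?thesis
    by (simp add: tensor_def sum_distrib_left sum_distrib_right mult_ac)
qed

text \<open>For fixed \<open>y\<close> the sum is a combination of the \<open>A i\<close> with
  coefficients \<open>b i y\<close>; bounding it and integrating over \<open>y\<close> leaves
  combinations of the \<open>B k\<close>, one for each row of \<open>c\<close>. Hence the two bounds
  multiply.\<close>

lemma tensor_sum_bound:
  fixes A B :: "'i \<Rightarrow> real \<Rightarrow> complex"
  assumes [measurable]: "\<And>i. i \<in> I \<Longrightarrow> A i \<in> borel_measurable borel" "\<And>i. i \<in> I \<Longrightarrow> B i \<in> borel_measurable borel"
    and \<alpha>: "0 \<le> \<alpha>" and \<beta>: "0 \<le> \<beta>"
    and A: "\<And>c. energy (\<lambda>x. \<Sum>i\<in>I. c i * A i x) \<le> ennreal (\<alpha> * (\<Sum>i\<in>I. (norm (c i))\<^sup>2))"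
    and B: "\<And>c. energy (\<lambda>x. \<Sum>i\<in>I. c i * B i x) \<le> ennreal (\<beta> * (\<Sum>i\<in>I. (norm (c i))\<^sup>2))"
  shows "energy (\<lambda>z. \<Sum>i\<in>I. \<Sum>k\<in>I. c i k * (A i \<otimes>\<^sub>f B k) z)
     \<le> ennreal (\<alpha> * \<beta> * (\<Sum>i\<in>I. \<Sum>k\<in>I. (norm (c i k))\<^sup>2))"
proof -
  define b where "b i y = (\<Sum>k\<in>I. c i k * B k y)" for i y
  have [measurable]: "b i \<in> borel_measurable borel" for i unfolding b_def by measurable
  have "energy (\<lambda>z. \<Sum>i\<in>I. \<Sum>k\<in>I. c i k * (A i \<otimes>\<^sub>f B k) z) =
    (\<integral>\<^sup>+y. energy (\<lambda>x. \<Sum>i\<in>I. b i y * A i x) \<partial>lborel)"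
    unfolding b_def by (rule energy_tensor_sum) measurable
  also have "\<dots> \<le> (\<integral>\<^sup>+y. ennreal \<alpha> * (\<Sum>i\<in>I. ennreal ((norm (b i y))\<^sup>2)) \<partial>lborel)"
  proof (rule nn_integral_mono)
    fix y
    have "ennreal (\<alpha> * (\<Sum>i\<in>I. (norm (b i y))\<^sup>2)) = ennreal \<alpha> * (\<Sum>i\<in>I. ennreal ((norm (b i y))\<^sup>2))"
      by (subst sum_ennreal) (auto intro!: ennreal_mult \<alpha> sum_nonneg)
    then show "energy (\<lambda>x. \<Sum>i\<in>I. b i y * A i x) \<le> ennreal \<alpha> * (\<Sum>i\<in>I. ennreal ((norm (b i y))\<^sup>2))"
      using A[of "\<lambda>i. b i y"] by simp
  qed
  also have "\<dots> = ennreal \<alpha> * (\<Sum>i\<in>I. \<integral>\<^sup>+y. ennreal ((norm (b i y))\<^sup>2) \<partial>lborel)"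
    by (subst nn_integral_cmult, measurable, subst nn_integral_sum) auto
  also have "\<dots> \<le> ennreal \<alpha> * (\<Sum>i\<in>I. ennreal (\<beta> * (\<Sum>k\<in>I. (norm (c i k))\<^sup>2)))"
    unfolding b_def by (intro mult_left_mono sum_mono B) auto
  also have "\<dots> = ennreal (\<alpha> * (\<Sum>i\<in>I. \<beta> * (\<Sum>k\<in>I. (norm (c i k))\<^sup>2)))"
    by (subst sum_ennreal) (auto intro!: ennreal_mult[symmetric] mult_nonneg_nonneg sum_nonneg \<alpha> \<beta>)
  also have "\<alpha> * (\<Sum>i\<in>I. \<beta> * (\<Sum>k\<in>I. (norm (c i k))\<^sup>2)) = \<alpha> * \<beta> * (\<Sum>i\<in>I. \<Sum>k\<in>I. (norm (c i k))\<^sup>2)"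
    by (simp add: sum_distrib_left mult.assoc)
  finally show ?thesis .
qed

text \<open>The same slicing with equality. The hypothesis \<open>A\<close> is Parseval's identity,
  that is, orthonormality of the family expressed through \<open>energy\<close>.\<close>

lemma tensor_sum_orthonormal:
  fixes A :: "'i \<Rightarrow> real \<Rightarrow> complex"
  assumes [measurable]: "\<And>i. i \<in> I \<Longrightarrow> A i \<in> borel_measurable borel"
    and A: "\<And>c. energy (\<lambda>x. \<Sum>i\<in>I. c i * A i x) = ennreal (\<Sum>i\<in>I. (norm (c i))\<^sup>2)"
  shows "energy (\<lambda>z. \<Sum>i\<in>I. \<Sum>k\<in>I. c i k * (A i \<otimes>\<^sub>f A k) z)
     = ennreal (\<Sum>i\<in>I. \<Sum>k\<in>I. (norm (c i k))\<^sup>2)"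
proof -
  define b where "b i y = (\<Sum>k\<in>I. c i k * A k y)" for i y
  have [measurable]: "b i \<in> borel_measurable borel" for i unfolding b_def by measurable
  have "energy (\<lambda>z. \<Sum>i\<in>I. \<Sum>k\<in>I. c i k * (A i \<otimes>\<^sub>f A k) z) =
    (\<integral>\<^sup>+y. energy (\<lambda>x. \<Sum>i\<in>I. b i y * A i x) \<partial>lborel)"
    unfolding b_def by (rule energy_tensor_sum) measurable
  also have "\<dots> = (\<integral>\<^sup>+y. (\<Sum>i\<in>I. ennreal ((norm (b i y))\<^sup>2)) \<partial>lborel)"
    unfolding A by (subst sum_ennreal) auto
  also have "\<dots> = (\<Sum>i\<in>I. \<integral>\<^sup>+y. ennreal ((norm (b i y))\<^sup>2) \<partial>lborel)"
    by (subst nn_integral_sum) auto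
  also have "\<dots> = (\<Sum>i\<in>I. ennreal (\<Sum>k\<in>I. (norm (c i k))\<^sup>2))"
    unfolding b_def A ..
  also have "\<dots> = ennreal (\<Sum>i\<in>I. \<Sum>k\<in>I. (norm (c i k))\<^sup>2)"
    by (subst sum_ennreal) (auto intro!: sum_nonneg)
  finally show ?thesis .
qed

section \<open>Sampling functions as tensor products of cut exponentials\<close>

definition trig_char :: "real \<Rightarrow> int \<Rightarrow> real \<Rightarrow> complex" where
  "trig_char \<epsilon> d x = indicator {0..1} x * cis (2 * pi * \<epsilon> * of_int d * x)"

lemma trig_approx_comb: "ae_comb (trig_char \<epsilon>) {- int M..int M} (trig_approx \<epsilon> M f)"
proof (rule ae_comb_trans[of "{..M} \<times> {..M}"])
  show "ae_comb (\<lambda>(k, l). trig_char \<epsilon> (int k - int l)) ({..M} \<times> {..M}) (trig_approx \<epsilon> M f)"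
    unfolding ae_comb_def
    by (intro exI[of _ "\<lambda>(k, l). complex_of_real (\<epsilon> / (real M + 1)) *
        (LINT y|lborel. cis (- (2 * pi * \<epsilon> * (real k - real l) * y)) * f y)"] AE_I2)
       (simp add: trig_approx_def fejer_mean_def sum.cartesian_product case_prod_unfold trig_char_def sum_distrib_left mult_ac)
  fix kl assume "kl \<in> {..M} \<times> {..M}"
  then show "ae_comb (trig_char \<epsilon>) {- int M..int M} ((\<lambda>(k, l). trig_char \<epsilon> (int k - int l)) kl)"
    by (intro ae_comb_base[of _ "int (fst kl) - int (snd kl)"]) auto
qed simp

lemma sampling_fun_eq_tensor:
  "sampling_fun \<epsilon> l z = complex_of_real \<epsilon> * tensor_family (trig_char \<epsilon>) (trig_char \<epsilon>) l z"
proof -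
  have "exp (2 * complex_of_real pi * \<i> * complex_of_real (\<epsilon> * (of_int (fst l) * fst z + of_int (snd l) * snd z))) =
     cis (2 * pi * \<epsilon> * of_int (fst l) * fst z) * cis (2 * pi * \<epsilon> * of_int (snd l) * snd z)"
    unfolding cis_conv_exp by (simp add: algebra_simps exp_add)
  then show ?thesis
    by (cases z) (auto simp: sampling_fun_def tensor_family_def tensor_def trig_char_def case_prod_unfold)
qed

lemma trig_char_measurable [measurable]: "trig_char \<epsilon> d \<in> borel_measurable borel"
proof -
  have [measurable]: "(\<lambda>x. cis (2 * pi * \<epsilon> * of_int d * x)) \<in> borel_measurable borel"
    by (intro borel_measurable_continuous_onI continuous_intros)
  show ?thesis unfolding trig_char_def[abs_def] by measurable
qed

lemma sampling_fun_L2: "sampling_fun \<epsilon> l \<in> L2_fun"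
proof (rule L2_funI)
  show "sampling_fun \<epsilon> l \<in> borel_measurable borel"
    unfolding sampling_fun_eq_tensor[abs_def] tensor_family_def case_prod_unfold by measurable
  show "integrable lborel (\<lambda>z. \<epsilon>\<^sup>2 * indicator (cbox (0, 0) (1::real, 1::real)) z)"
    by (intro integrable_mult_right integrable_real_indicator) (use emeasure_lborel_cbox_finite[of "(0, 0)" "(1::real, 1::real)"] in auto)
  show "AE z in lborel. (norm (sampling_fun \<epsilon> l z))\<^sup>2 \<le> \<epsilon>\<^sup>2 * indicator (cbox (0, 0) (1, 1)) z"
    by (intro AE_I2) (auto simp: sampling_fun_def norm_mult power_mult_distrib indicator_def cbox_Pair_eq)
qed

lemma J_0_le: "J_0 p \<le> J \<Longrightarrow> 2 * p \<le> 2 ^ J"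
proof -
  assume J: "J_0 p \<le> J"
  have "2 * p \<le> 2 ^ (2 * p)" by (rule less_imp_le[OF less_exp])
  then have "2 * p \<le> 2 ^ J_0 p" unfolding J_0_def by (rule LeastI)
  also have "\<dots> \<le> 2 ^ J" using J by (intro power_increasing) auto
  finally show ?thesis .
qed

text \<open>A wavelet belongs to the span of its own system, which is \<open>W_b\<close> and hence
  part of \<open>V_b\<close> at the next level.\<close>

lemma cdv_wavelet_comb:
  assumes cdv: "cdv_wavelets p \<phi> \<psi> \<psi>l \<psi>r" and j: "J_0 p \<le> j" and n: "n < 2 ^ j"
  shows "ae_comb (phi_b p \<phi> (Suc j)) {..<2 ^ Suc j} (interval_system p \<psi> \<psi>l \<psi>r j n)"
proof -
  let ?\<Psi> = "interval_system p \<psi> \<psi>l \<psi>r j"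
  have c: "L2_orthonormal {..<2 ^ j} ?\<Psi>" "L2_span (?\<Psi> ` {..<2 ^ j}) = W_b p \<phi> j"
    using cdv j unfolding cdv_wavelets_def by auto
  have "?\<Psi> n \<in> L2_fun" using c(1) n unfolding L2_orthonormal_def by auto
  then have "?\<Psi> n \<in> L2_span (?\<Psi> ` {..<2 ^ j})"
    by (rule L2_spanI[where c="\<lambda>i. if i = n then 1 else 0"])
       (use n in \<open>auto simp: if_distrib[of "\<lambda>c. c * _"] cong: if_cong\<close>)
  then have "?\<Psi> n \<in> L2_span (phi_b p \<phi> (Suc j) ` {..<2 ^ Suc j})"
    unfolding c(2) W_b_def V_b_def by simp
  then show ?thesis unfolding ae_comb_def by (rule L2_spanE) (auto intro: exI)
qed

section \<open>Approximating reconstruction vectors from the sampling space\<close>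

context scaling_function
begin

lemma recon_space_comb:
  assumes cdv: "cdv_wavelets p \<phi> \<psi> \<psi>l \<psi>r" and J: "J_0 p \<le> J" and u: "u \<in> recon_space p \<phi> \<psi> \<psi>l \<psi>r J"
  shows "ae_comb (tensor_family (phi_b p \<phi> J) (phi_b p \<phi> J)) ({..<2 ^ J} \<times> {..<2 ^ J}) u"
proof -
  let ?I = "{..<2 ^ J} :: nat set" and ?\<Phi> = "phi_b p \<phi>" and ?\<Psi> = "interval_system p \<psi> \<psi>l \<psi>r"
  let ?T = "tensor_family (?\<Phi> J) (?\<Phi> J)"
  define B where "B = {?\<Phi> (J_0 p) n1 \<otimes>\<^sub>f ?\<Phi> (J_0 p) n2 | n1 n2. n1 < 2 ^ J_0 p \<and> n2 < 2 ^ J_0 p} \<union>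
         {psi_b2 ?\<Phi> ?\<Psi> k j n1 n2 | k j n1 n2.
            k \<in> {1, 2, 3} \<and> J_0 p \<le> j \<and> j < J \<and> n1 < 2 ^ j \<and> n2 < 2 ^ j}"
  have phi: "ae_comb (?\<Phi> J) ?I (?\<Phi> j n)" if "J_0 p \<le> j" "j \<le> J" "n < 2 ^ j" for j n
    by (rule phi_b_nested[OF J_0_le[OF that(1)] that(3,2)])
  have psi: "ae_comb (?\<Phi> J) ?I (?\<Psi> j n)" if "J_0 p \<le> j" "j < J" "n < 2 ^ j" for j n
  proof (rule ae_comb_trans[OF _ _ cdv_wavelet_comb[OF cdv that(1,3)]])
    fix i :: nat assume "i \<in> {..<2 ^ Suc j}"
    then show "ae_comb (?\<Phi> J) ?I (?\<Phi> (Suc j) i)" using that by (intro phi) auto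
  qed simp
  have gen: "ae_comb ?T (?I \<times> ?I) b" if "b \<in> B" for b
    using that unfolding B_def
  proof (elim UnE CollectE exE conjE)
    fix n1 n2 assume "b = ?\<Phi> (J_0 p) n1 \<otimes>\<^sub>f ?\<Phi> (J_0 p) n2" "n1 < 2 ^ J_0 p" "n2 < 2 ^ J_0 p"
    then show ?thesis using J by (auto intro!: ae_comb_tensor phi)
  next
    fix k j n1 n2 :: nat assume "b = psi_b2 ?\<Phi> ?\<Psi> k j n1 n2" "J_0 p \<le> j" "j < J" "n1 < 2 ^ j" "n2 < 2 ^ j"
    then show ?thesis by (auto simp: psi_b2_def intro!: ae_comb_tensor phi psi)
  qed
  have "u \<in> L2_span B" using u unfolding recon_space_def B_def by (simp add: Let_def)
  then obtain T c where T: "finite T" "T \<subseteq> B" "AE x in lborel. u x = (\<Sum>b\<in>T. c b * b x)"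
    by (auto simp: L2_span_def)
  show ?thesis
  proof (rule ae_comb_trans[OF T(1)])
    show "ae_comb (\<lambda>b. b) T u" unfolding ae_comb_def using T(3) by (intro exI)
  qed (use gen T(2) in auto)
qed

text \<open>Both factors of each tensor product are replaced by their trigonometric approximations.
  With \<open>\<Phi>\<close> for a factor, \<open>T\<close> for its approximation and
  \<open>D = \<Phi> - T\<close>, the error is \<open>D \<otimes> \<Phi> + T \<otimes> D\<close>, so
  that each part has one small factor and one bounded factor.\<close>

lemma sampling_space_approx:
  assumes cdv: "cdv_wavelets p \<phi> \<psi> \<psi>l \<psi>r" and J: "J_0 p \<le> J" and u: "u \<in> recon_space p \<phi> \<psi> \<psi>l \<psi>r J"
    and u1: "L2_nrm u = 1" and \<delta>: "0 \<le> \<delta>" "\<delta> \<le> 1" and e: "0 < \<epsilon>"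
    and approx: "\<And>c. energy (\<lambda>x. \<Sum>n<2 ^ J. c n * (phi_b p \<phi> J n x - trig_approx \<epsilon> M (phi_b p \<phi> J n) x))
        \<le> ennreal (\<delta> * (\<Sum>n<2 ^ J. (norm (c n))\<^sup>2))"
  shows "\<exists>q \<in> sampling_space \<epsilon> (M, M). (L2_nrm (\<lambda>z. u z - q z))\<^sup>2 \<le> 10 * \<delta>"
proof -
  note j = J_0_le[OF J]
  let ?\<Phi> = "phi_b p \<phi> J" and ?I = "{..<2 ^ J} :: nat set"
  let ?T = "\<lambda>n. trig_approx \<epsilon> M (?\<Phi> n)"
  \<comment> \<open>Functions that vanish identically are dropped. The remaining ones have norm 1,
    so that \<open>L2_nrm u = 1\<close> fixes the sum of the squared coefficients.\<close>
  define G where "G = {n\<in>?I. ?\<Phi> n \<noteq> (\<lambda>x. 0)}"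
  have G: "finite G" "G \<subseteq> ?I" by (auto simp: G_def)
  have uL: "u \<in> L2_fun" using u unfolding recon_space_def by (auto simp: Let_def L2_span_def)
  have um [measurable]: "u \<in> borel_measurable borel" using uL by (simp add: L2_fun_measurable)
  have ext: "(\<Sum>n\<in>?I. (if n \<in> G then c n else 0) * F n) = (\<Sum>n\<in>G. c n * F n)" for c F :: "nat \<Rightarrow> complex"
    using G by (intro sum.mono_neutral_cong_right) auto
  have extn: "(\<Sum>n\<in>?I. (norm (if n \<in> G then c n else 0))\<^sup>2) = (\<Sum>n\<in>G. (norm (c n))\<^sup>2)" for c :: "nat \<Rightarrow> complex"
    using G by (intro sum.mono_neutral_cong_right) auto
  have on: "energy (\<lambda>x. \<Sum>n\<in>G. c n * ?\<Phi> n x) = ennreal (\<Sum>n\<in>G. (norm (c n))\<^sup>2)" for c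
  proof -
    have L: "(\<lambda>x. \<Sum>n\<in>G. c n * ?\<Phi> n x) \<in> L2_fun" using G phi_b_L2[OF j] by (intro L2_fun_lincomb) auto
    have "(L2_nrm (\<lambda>x. \<Sum>n\<in>G. c n * ?\<Phi> n x))\<^sup>2 = (\<Sum>n\<in>G. (norm (c n))\<^sup>2 * (L2_nrm (?\<Phi> n))\<^sup>2)"
    proof (rule L2_nrm_orthogonal_sum[OF G(1)])
      show "?\<Phi> n \<in> L2_fun" if "n \<in> G" for n using phi_b_L2[OF j] G that by auto
      show "L2_inner (?\<Phi> n) (?\<Phi> m) = 0" if "n \<in> G" "m \<in> G" "n \<noteq> m" for n m
        using phi_b_orthogonal[OF j, of n m] G that by auto
    qed
    also have "\<dots> = (\<Sum>n\<in>G. (norm (c n))\<^sup>2)"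
    proof (intro sum.cong refl)
      fix n assume "n \<in> G"
      then have "L2_nrm (?\<Phi> n) = 1" using phi_b_nrm[OF j, of n] by (auto simp: G_def)
      then show "(norm (c n))\<^sup>2 * (L2_nrm (?\<Phi> n))\<^sup>2 = (norm (c n))\<^sup>2" by simp
    qed
    finally show ?thesis using L2_nrm_sq_nn[OF L] by simp
  qed
  obtain c0 where c0: "AE z in lborel. u z = (\<Sum>r\<in>?I \<times> ?I. c0 r * tensor_family ?\<Phi> ?\<Phi> r z)"
    using recon_space_comb[OF cdv J u] unfolding ae_comb_def by blast
  define c where "c n m = c0 (n, m)" for n m
  have uG: "AE z in lborel. u z = (\<Sum>n\<in>G. \<Sum>m\<in>G. c n m * (?\<Phi> n \<otimes>\<^sub>f ?\<Phi> m) z)"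
    using c0
  proof eventually_elim
    case (elim z)
    have "(\<Sum>r\<in>?I \<times> ?I. c0 r * tensor_family ?\<Phi> ?\<Phi> r z) = (\<Sum>r\<in>G \<times> G. c0 r * tensor_family ?\<Phi> ?\<Phi> r z)"
      using G(2) by (intro sum.mono_neutral_right) (auto simp: G_def tensor_family_def tensor_def)
    also have "\<dots> = (\<Sum>n\<in>G. \<Sum>m\<in>G. c n m * (?\<Phi> n \<otimes>\<^sub>f ?\<Phi> m) z)"
      by (simp add: sum.cartesian_product case_prod_unfold tensor_family_def c_def)
    finally show ?case using elim by simp
  qed
  have "ennreal 1 = energy u"
    using L2_nrm_sq_nn[OF uL] u1 by simp
  also have "\<dots> = energy (\<lambda>z. \<Sum>n\<in>G. \<Sum>m\<in>G. c n m * (?\<Phi> n \<otimes>\<^sub>f ?\<Phi> m) z)"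
    using uG by (intro nn_integral_cong_AE) auto
  also have "\<dots> = ennreal (\<Sum>n\<in>G. \<Sum>m\<in>G. (norm (c n m))\<^sup>2)"
    by (rule tensor_sum_orthonormal) (use on in auto)
  finally have C1: "(\<Sum>n\<in>G. \<Sum>m\<in>G. (norm (c n m))\<^sup>2) = 1"
    by (metis ennreal_eq_1 ennreal_1)
  define q where "q z = (\<Sum>n\<in>G. \<Sum>m\<in>G. c n m * (?T n \<otimes>\<^sub>f ?T m) z)" for z
  have qm [measurable]: "q \<in> borel_measurable borel" unfolding q_def[abs_def] by measurable
  have "ae_comb (sampling_fun \<epsilon>) (sampling_index (M, M)) q"
  proof (rule ae_comb_trans[of "G \<times> G"])
    show "ae_comb (tensor_family ?T ?T) (G \<times> G) q"
      unfolding ae_comb_def q_def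
      by (intro exI[of _ "\<lambda>(n, m). c n m"] AE_I2) (simp add: sum.cartesian_product case_prod_unfold tensor_family_def)
    fix r assume "r \<in> G \<times> G"
    show "ae_comb (sampling_fun \<epsilon>) (sampling_index (M, M)) (tensor_family ?T ?T r)"
    proof (rule ae_comb_trans[of "{- int M..int M} \<times> {- int M..int M}"])
      show "ae_comb (tensor_family (trig_char \<epsilon>) (trig_char \<epsilon>)) ({- int M..int M} \<times> {- int M..int M}) (tensor_family ?T ?T r)"
        unfolding tensor_family_def[of ?T] case_prod_unfold by (intro ae_comb_tensor trig_approx_comb)
      fix l assume l: "l \<in> {- int M..int M} \<times> {- int M..int M}"
      \<comment> \<open>The coefficient \<open>1 / \<epsilon>\<close> undoes the factor
        \<open>\<epsilon>\<close> in \<open>sampling_fun\<close>.\<close>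
      show "ae_comb (sampling_fun \<epsilon>) (sampling_index (M, M)) (tensor_family (trig_char \<epsilon>) (trig_char \<epsilon>) l)"
        unfolding ae_comb_def
        by (intro exI[of _ "\<lambda>i. if i = l then 1 / complex_of_real \<epsilon> else 0"] AE_I2)
           (use l e in \<open>auto simp: sampling_index_def sampling_fun_eq_tensor if_distrib[of "\<lambda>c. c * _"] cong: if_cong\<close>)
    qed simp
  qed (use G in auto)
  then obtain a where a: "AE z in lborel. q z = (\<Sum>l\<in>sampling_index (M, M). a l * sampling_fun \<epsilon> l z)"
    by (auto simp: ae_comb_def)
  have fin: "finite (sampling_index (M, M))" by (simp add: sampling_index_def)
  have qL: "q \<in> L2_fun"
  proof (rule L2_fun_cong_AE[OF _ qm])
    show "(\<lambda>z. \<Sum>l\<in>sampling_index (M, M). a l * sampling_fun \<epsilon> l z) \<in> L2_fun" by (intro L2_fun_lincomb sampling_fun_L2)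
  qed (use a in eventually_elim, simp)
  have qS: "q \<in> sampling_space \<epsilon> (M, M)"
    unfolding sampling_space_def by (rule L2_spanI[OF qL fin a])
  let ?D = "\<lambda>n x. ?\<Phi> n x - ?T n x"
  have bP: "energy (\<lambda>x. \<Sum>n\<in>G. c n * ?\<Phi> n x) \<le> ennreal (1 * (\<Sum>n\<in>G. (norm (c n))\<^sup>2))" for c
    using on[of c] by simp
  have bD: "energy (\<lambda>x. \<Sum>n\<in>G. c n * ?D n x) \<le> ennreal (\<delta> * (\<Sum>n\<in>G. (norm (c n))\<^sup>2))" for c
    using approx[of "\<lambda>n. if n \<in> G then c n else 0"] unfolding ext extn .
  have sq2: "energy (\<lambda>z. f z - g z) \<le> 2 * energy f + 2 * energy g"
    if [measurable]: "f \<in> borel_measurable borel" "g \<in> borel_measurable borel" for f g :: "'b::euclidean_space \<Rightarrow> complex"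
  proof -
    have "energy (\<lambda>z. f z - g z) \<le> (\<integral>\<^sup>+z. 2 * ennreal ((norm (f z))\<^sup>2) + 2 * ennreal ((norm (g z))\<^sup>2) \<partial>lborel)"
    proof (rule nn_integral_mono)
      fix z
      have "ennreal ((norm (f z - g z))\<^sup>2) \<le> ennreal (2 * (norm (f z))\<^sup>2 + 2 * (norm (g z))\<^sup>2)"
        using norm_add_sq_le[of "f z" "- g z"] by (intro ennreal_leI) simp
      then show "ennreal ((norm (f z - g z))\<^sup>2) \<le> 2 * ennreal ((norm (f z))\<^sup>2) + 2 * ennreal ((norm (g z))\<^sup>2)"
        by (simp add: ennreal_plus ennreal_mult)
    qed
    also have "\<dots> = 2 * energy f + 2 * energy g"
      by (subst nn_integral_add, measurable, subst (1 2) nn_integral_cmult) auto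
    finally show ?thesis .
  qed
  \<comment> \<open>Writing \<open>?T\<close> as \<open>?\<Phi> - ?D\<close> gives the constant
    \<open>2 + 2 * \<delta>\<close>, at most 4 because \<open>\<delta> \<le> 1\<close>.\<close>
  have bT: "energy (\<lambda>x. \<Sum>n\<in>G. c n * ?T n x) \<le> ennreal (4 * (\<Sum>n\<in>G. (norm (c n))\<^sup>2))" for c
  proof -
    let ?C = "\<Sum>n\<in>G. (norm (c n))\<^sup>2"
    have C: "0 \<le> ?C" by (simp add: sum_nonneg)
    have "energy (\<lambda>x. \<Sum>n\<in>G. c n * ?T n x) =
       energy (\<lambda>x. (\<Sum>n\<in>G. c n * ?\<Phi> n x) - (\<Sum>n\<in>G. c n * ?D n x))"
      by (simp add: right_diff_distrib sum_subtractf)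
    also have "\<dots> \<le> 2 * energy (\<lambda>x. \<Sum>n\<in>G. c n * ?\<Phi> n x) + 2 * energy (\<lambda>x. \<Sum>n\<in>G. c n * ?D n x)"
      by (rule sq2) measurable
    also have "\<dots> \<le> 2 * ennreal (1 * ?C) + 2 * ennreal (\<delta> * ?C)"
      by (intro add_mono mult_left_mono bP bD) auto
    also have "\<dots> = ennreal (2 * (1 * ?C) + 2 * (\<delta> * ?C))"
      using C \<delta> by (simp add: ennreal_plus ennreal_mult)
    also have "\<dots> \<le> ennreal (4 * ?C)"
      using mult_right_mono[OF \<delta>(2) C] by (intro ennreal_leI) simp
    finally show ?thesis .
  qed
  define f1 where "f1 z = (\<Sum>n\<in>G. \<Sum>m\<in>G. c n m * (?D n \<otimes>\<^sub>f ?\<Phi> m) z)" for z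
  \<comment> \<open>The sign makes the error the difference \<open>f1 - f2\<close>, the form to
    which \<open>sq2\<close> applies.\<close>
  define f2 where "f2 z = (\<Sum>n\<in>G. \<Sum>m\<in>G. - c n m * (?T n \<otimes>\<^sub>f ?D m) z)" for z
  have [measurable]: "f1 \<in> borel_measurable borel" "f2 \<in> borel_measurable borel"
    unfolding f1_def[abs_def] f2_def[abs_def] by measurable
  have mD: "?D n \<in> borel_measurable borel" and mT: "?T n \<in> borel_measurable borel"
    and mP: "?\<Phi> n \<in> borel_measurable borel" for n by measurable
  have b1: "energy f1 \<le> ennreal (\<delta> * 1 * (\<Sum>n\<in>G. \<Sum>m\<in>G. (norm (c n m))\<^sup>2))"
    unfolding f1_def by (rule tensor_sum_bound[OF _ _ _ _ bD bP]) (use \<delta> mD mT mP in auto)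
  have b2: "energy f2 \<le> ennreal (4 * \<delta> * (\<Sum>n\<in>G. \<Sum>m\<in>G. (norm (- c n m))\<^sup>2))"
    unfolding f2_def by (rule tensor_sum_bound[OF _ _ _ _ bT bD]) (use \<delta> mD mT mP in auto)
  have "ennreal ((L2_nrm (\<lambda>z. u z - q z))\<^sup>2) = energy (\<lambda>z. u z - q z)"
    by (intro L2_nrm_sq_nn L2_fun_diff uL qL)
  also have "\<dots> = energy (\<lambda>z. f1 z - f2 z)"
  proof (rule nn_integral_cong_AE)
    show "AE z in lborel. ennreal ((norm (u z - q z))\<^sup>2) = ennreal ((norm (f1 z - f2 z))\<^sup>2)"
      using uG
    proof eventually_elim
      case (elim z)
      have "u z - q z = f1 z - f2 z"
        unfolding elim q_def f1_def f2_def sum_subtractf[symmetric]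
        by (intro sum.cong refl) (simp add: tensor_def algebra_simps)
      then show ?case by simp
    qed
  qed
  also have "\<dots> \<le> 2 * energy f1 + 2 * energy f2"
    by (rule sq2) measurable
  \<comment> \<open>The two parts contribute \<open>2 * \<delta>\<close> and
    \<open>2 * (4 * \<delta>)\<close>, whence the constant 10.\<close>
  also have "\<dots> \<le> 2 * ennreal (\<delta> * 1 * 1) + 2 * ennreal (4 * \<delta> * 1)"
    using b1 b2 unfolding norm_minus_cancel C1 by (intro add_mono mult_left_mono) auto
  also have "\<dots> = ennreal (2 * \<delta> + 8 * \<delta>)"
    using \<delta> by (simp add: ennreal_mult distrib_right[symmetric])
  finally have "(L2_nrm (\<lambda>z. u z - q z))\<^sup>2 \<le> 10 * \<delta>"
    using \<delta> by (subst (asm) ennreal_le_iff) auto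
  then show ?thesis using qS by blast
qed

end

section \<open>Reconstruction and sampling spaces\<close>

text \<open>Right of \<open>2 * p - 2\<close> only the term \<open>n = 0\<close> of the edge
  function survives, and there it is the last unit piece of \<open>\<phi>\<close>. Were the edge
  function null, \<open>\<phi>\<close> would vanish near the endpoint \<open>p\<close> of its
  essential support.\<close>

lemma phi_left_0_nrm:
  assumes D: "daubechies_pair p \<phi> \<psi>" and S: "scaling_function p \<phi> h"
  shows "L2_nrm (phi_left p \<phi> 0) = 1"
proof (rule ccontr)
  interpret scaling_function p \<phi> h by (rule S)
  assume "L2_nrm (phi_left p \<phi> 0) \<noteq> 1"
  then have z: "phi_left p \<phi> 0 = (\<lambda>x. 0)" using phi_left_gram_schmidt(3)[of 0] by blast
  obtain c where c: "AE x in lborel. edge_fun p \<phi> 0 x = (\<Sum>i\<le>0. c i * phi_left p \<phi> i x)"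
    by (rule exE[OF phi_left_gram_schmidt(5)[of 0]])
  have "AE x in lborel. \<forall>n\<in>{1..2*p-2}. x + real n - real p + 1 \<notin> {1 - real p..real p} \<longrightarrow> \<phi> (x + real n - real p + 1) = 0"
  proof (subst AE_finite_all, simp, intro ballI)
    fix n
    show "AE x in lborel. x + real n - real p + 1 \<notin> {1 - real p..real p} \<longrightarrow> \<phi> (x + real n - real p + 1) = 0"
      using AE_phi_affine[of 1 "real n - real p + 1"] by (simp add: algebra_simps)
  qed
  with c have "AE x in lborel. 2 * real p - 2 < x \<longrightarrow> \<phi> (x - real p + 1) = 0"
  proof eventually_elim
    case (elim x)
    show ?case
    proof
      assume x: "2 * real p - 2 < x"
      have sum: "(\<Sum>n=0..2*p-2. real (n choose 0) * \<phi> (x + real n - real p + 1)) = (\<Sum>n\<in>{0}. \<phi> (x + real n - real p + 1))"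
      proof (rule sum.mono_neutral_cong_right)
        show "\<forall>n\<in>{0..2*p-2} - {0}. real (n choose 0) * \<phi> (x + real n - real p + 1) = 0"
        proof
          fix n assume n: "n \<in> {0..2*p-2} - {0}"
          then have "1 \<le> real n" by auto
          then have "x + real n - real p + 1 \<notin> {1 - real p..real p}" using x by auto
          moreover have "n \<in> {1..2*p-2}" using n by auto
          ultimately show "real (n choose 0) * \<phi> (x + real n - real p + 1) = 0" using elim(2) by auto
        qed
      qed auto
      have "1 \<le> real p" using p_pos by simp
      then have "0 \<le> x" using x by linarith
      then have "edge_fun p \<phi> 0 x = complex_of_real (\<phi> (x - real p + 1))"
        unfolding edge_fun_def sum by simp
      moreover have "edge_fun p \<phi> 0 x = 0" using elim(1) z by simp
      ultimately show "\<phi> (x - real p + 1) = 0" by simp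
    qed
  qed
  \<comment> \<open>The shift by \<open>p - 1\<close> carries the half-line beyond
    \<open>2 * p - 2\<close> to the one beyond \<open>p - 1\<close>, which contains the ball of
    radius 1 around \<open>p\<close>.\<close>
  from AE_lborel_affine[OF this one_neq_zero, of "real p - 1"]
  have "AE y in lborel. y \<in> ball (real p) 1 \<longrightarrow> \<phi> y = 0"
    by eventually_elim (auto simp: dist_real_def algebra_simps)
  moreover have "real p \<in> ess_support \<phi>" using D unfolding daubechies_pair_def by auto
  ultimately show False unfolding ess_support_def mem_Collect_eq using zero_less_one by blast
qed

text \<open>A lower bound for the infimum in \<open>cos_angle\<close> requires a nonempty set. The
  tensor square of the first left function, which has norm 1 by \<open>phi_left_0_nrm\<close>, is a
  witness at every level.\<close>

lemma recon_space_unit_sphere: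
  assumes D: "daubechies_pair p \<phi> \<psi>" and S: "scaling_function p \<phi> h"
  shows "\<exists>u \<in> recon_space p \<phi> \<psi> \<psi>l \<psi>r J. L2_nrm u = 1"
proof -
  interpret scaling_function p \<phi> h by (rule S)
  have j: "2 * p \<le> 2 ^ J_0 p" by (rule J_0_le) simp
  let ?\<Phi> = "phi_b p \<phi> (J_0 p) 0"
  let ?u = "?\<Phi> \<otimes>\<^sub>f ?\<Phi>"
  have n0: "(0::nat) < 2 ^ J_0 p" by simp
  have "unit_system p \<phi> (J_0 p) 0 = phi_left p \<phi> 0" using p_pos by (auto simp: unit_system_def)
  then have "L2_inner ?\<Phi> ?\<Phi> = 1"
    using phi_b_inner[OF j n0 n0] phi_left_0_nrm[OF D S] by (simp add: L2_inner_self)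
  then have "(L2_nrm ?\<Phi>)\<^sup>2 = 1" unfolding L2_inner_self using of_real_eq_1_iff by blast
  then have P1: "energy ?\<Phi> = 1"
    using L2_nrm_sq_nn[OF phi_b_L2[OF j n0]] by simp
  \<comment> \<open>The one-point index set makes the tensor square an instance of
    \<open>tensor_sum_orthonormal\<close>.\<close>
  have "energy (\<lambda>z. \<Sum>i\<in>{()}. \<Sum>k\<in>{()}. 1 * (?\<Phi> \<otimes>\<^sub>f ?\<Phi>) z)
     = ennreal (\<Sum>i\<in>{()}. \<Sum>k\<in>{()}. (norm (1::complex))\<^sup>2)"
  proof (rule tensor_sum_orthonormal)
    fix c :: "unit \<Rightarrow> complex"
    have "energy (\<lambda>x. \<Sum>i\<in>{()}. c i * ?\<Phi> x) = (\<integral>\<^sup>+x. ennreal ((norm (c ()))\<^sup>2) * ennreal ((norm (?\<Phi> x))\<^sup>2) \<partial>lborel)"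
      by (intro nn_integral_cong) (simp add: norm_mult power_mult_distrib ennreal_mult)
    also have "\<dots> = ennreal ((norm (c ()))\<^sup>2) * energy ?\<Phi>"
      by (rule nn_integral_cmult) measurable
    finally show "energy (\<lambda>x. \<Sum>i\<in>{()}. c i * ?\<Phi> x) = ennreal (\<Sum>i\<in>{()}. (norm (c i))\<^sup>2)"
      by (simp add: P1)
  qed measurable
  then have u1: "energy ?u = 1" by simp
  have um: "?u \<in> borel_measurable borel" by measurable
  have uL: "?u \<in> L2_fun"
    unfolding L2_fun_def using um by (auto intro!: integrableI_bounded simp: u1)
  have "ennreal ((L2_nrm ?u)\<^sup>2) = ennreal 1" using L2_nrm_sq_nn[OF uL] u1 by simp
  then have "(L2_nrm ?u)\<^sup>2 = 1" by (subst (asm) ennreal_inj) auto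
  then have n1: "L2_nrm ?u = 1" using L2_nrm_nonneg[of ?u] by (auto simp: power2_eq_1_iff)
  have span: "?u \<in> L2_span B" if "?u \<in> B" for B
    unfolding L2_span_def mem_Collect_eq
    by (intro conjI uL exI[of _ "{?u}"] exI[of _ "\<lambda>_. 1"]) (use that in auto)
  have "?u \<in> recon_space p \<phi> \<psi> \<psi>l \<psi>r J"
    unfolding recon_space_def Let_def
    by (rule span, rule UnI1, rule CollectI, rule exI[of _ 0], rule exI[of _ 0]) simp
  then show ?thesis using n1 by (intro bexI)
qed

theorem cos_angle_recon_sampling:
  assumes D: "daubechies_pair p \<phi> \<psi>" and cdv: "cdv_wavelets p \<phi> \<psi> \<psi>l \<psi>r" and \<theta>: "\<theta> > 1"
  obtains S where "0 < S"
    "\<And>\<epsilon> J K. 0 < \<epsilon> \<Longrightarrow> \<epsilon> \<le> 1 \<Longrightarrow> J_0 p \<le> J \<Longrightarrow> S \<le> \<epsilon> * real K \<Longrightarrow>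
      1 / \<theta> \<le> cos_angle (recon_space p \<phi> \<psi> \<psi>l \<psi>r J) (sampling_space \<epsilon> (K * 2 ^ J, K * 2 ^ J))"
proof -
  obtain h where Sc: "scaling_function p \<phi> h" using daubechies_scaling_function[OF D] by metis
  interpret scaling_function p \<phi> h by (rule Sc)
  \<comment> \<open>With a squared error of at most \<open>10 * \<delta>\<close>, the projection
    keeps at least \<open>1 - 10 * \<delta> = 1 / \<theta>\<^sup>2\<close> of the squared
    norm.\<close>
  define \<delta> where "\<delta> = (1 - 1 / \<theta>\<^sup>2) / 10"
  have "1 < \<theta>\<^sup>2" using \<theta> by (simp add: one_less_power)
  then have *: "1 / \<theta>\<^sup>2 < 1" "0 \<le> 1 / \<theta>\<^sup>2" by (simp_all add: divide_less_eq)
  have "(1 - a) / 10 \<le> 1" "0 < (1 - a) / 10" if "a < 1" "0 \<le> a" for a :: real using that by auto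
  from this[OF *] have \<delta>: "0 < \<delta>" "\<delta> \<le> 1" by (simp_all only: \<delta>_def)
  obtain S where S: "0 < S"
    "\<And>\<epsilon> j K c. 0 < \<epsilon> \<Longrightarrow> \<epsilon> \<le> 1 \<Longrightarrow> 2 * p \<le> 2 ^ j \<Longrightarrow> S \<le> \<epsilon> * real K \<Longrightarrow>
      energy (\<lambda>x. \<Sum>n<2 ^ j. c n * (phi_b p \<phi> j n x - trig_approx \<epsilon> (K * 2 ^ j) (phi_b p \<phi> j n) x))
        \<le> ennreal (\<delta> * (\<Sum>n<2 ^ j. (norm (c n))\<^sup>2))"
    by (rule phi_b_trig_approx[OF \<delta>(1)], rule that, assumption+)
  show ?thesis
  proof (rule that[OF S(1)])
    fix \<epsilon> :: real and J K
    assume e: "0 < \<epsilon>" "\<epsilon> \<le> 1" and J: "J_0 p \<le> J" and K: "S \<le> \<epsilon> * real K"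
    let ?R = "recon_space p \<phi> \<psi> \<psi>l \<psi>r J" and ?S = "sampling_space \<epsilon> (K * 2 ^ J, K * 2 ^ J)"
    show "1 / \<theta> \<le> cos_angle ?R ?S"
      unfolding cos_angle_def
    proof (rule cINF_greatest)
      show "{u \<in> ?R. L2_nrm u = 1} \<noteq> {}" using recon_space_unit_sphere[OF D Sc] by blast
      fix u assume "u \<in> {u \<in> ?R. L2_nrm u = 1}"
      then have u: "u \<in> ?R" "L2_nrm u = 1" by auto
      have uL: "u \<in> L2_fun" using u(1) unfolding recon_space_def by (auto simp: Let_def L2_span_def)
      obtain q where q: "q \<in> ?S" "(L2_nrm (\<lambda>z. u z - q z))\<^sup>2 \<le> 10 * \<delta>"
        using sampling_space_approx[OF cdv J u less_imp_le[OF \<delta>(1)] \<delta>(2) e(1) S(2)[OF e J_0_le[OF J] K]] by blast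
      have fin: "finite (sampling_index (K * 2 ^ J, K * 2 ^ J))" by (simp add: sampling_index_def)
      have "(L2_nrm u)\<^sup>2 - (L2_nrm (\<lambda>z. u z - q z))\<^sup>2 \<le> (L2_nrm (orth_proj ?S u))\<^sup>2"
        unfolding sampling_space_def
        by (rule L2_nrm_orth_proj_ge[OF fin sampling_fun_L2 uL]) (use q(1) in \<open>simp add: sampling_space_def\<close>)
      then have "(1 / \<theta>)\<^sup>2 \<le> (L2_nrm (orth_proj ?S u))\<^sup>2"
        using q(2) u(2) by (simp add: \<delta>_def power_divide)
      then show "1 / \<theta> \<le> L2_nrm (orth_proj ?S u)" by (rule power2_le_imp_le) simp
    qed
  qed
qed

section \<open>From the angle to the stable sampling rate\<close>

lemma nat_ceiling_sampling_density:
  assumes "0 < S" "0 < \<epsilon>" shows "S \<le> \<epsilon> * real (nat \<lceil>S / \<epsilon>\<rceil>)" "1 \<le> nat \<lceil>S / \<epsilon>\<rceil>"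
proof -
  have "S / \<epsilon> \<le> real (nat \<lceil>S / \<epsilon>\<rceil>)" by (rule real_nat_ceiling_ge)
  then have "\<epsilon> * (S / \<epsilon>) \<le> \<epsilon> * real (nat \<lceil>S / \<epsilon>\<rceil>)" using assms by (intro mult_left_mono) auto
  then show "S \<le> \<epsilon> * real (nat \<lceil>S / \<epsilon>\<rceil>)" using assms by simp
  have "0 < S / \<epsilon>" using assms by simp
  then have "0 < \<lceil>S / \<epsilon>\<rceil>" by simp
  then show "1 \<le> nat \<lceil>S / \<epsilon>\<rceil>" by linarith
qed

lemma card_sampling_index: "card (sampling_index (M, M)) = (2 * M + 1)\<^sup>2"
proof -
  have "card {- int M..int M} = 2 * M + 1" by simp
  then show ?thesis by (simp add: sampling_index_def card_cartesian_product power2_eq_square)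
qed

text \<open>The rate asks for a reconstruction constant strictly below \<open>\<theta>\<close>,
  whereas the angle estimate is weak; the smaller \<open>\<theta>'\<close> supplies the
  strictness.\<close>

lemma stable_sampling_rate_le:
  assumes c: "1 / \<theta>' \<le> cos_angle U (sampling_space \<epsilon> (M, M))" and \<theta>: "0 < \<theta>'" "\<theta>' < \<theta>"
  shows "stable_sampling_rate \<epsilon> U \<theta> \<le> enat ((2 * M + 1)\<^sup>2)"
proof -
  let ?c = "cos_angle U (sampling_space \<epsilon> (M, M))"
  have c0: "0 < ?c" using c \<theta> by (meson less_le_trans zero_less_divide_1_iff)
  have "recon_constant U (sampling_space \<epsilon> (M, M)) = ennreal (1 / ?c)"
    unfolding recon_constant_def using c0 divide_ennreal[of 1 ?c] by simp
  also have "\<dots> < ennreal \<theta>"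
  proof (rule ennreal_lessI)
    have "1 / ?c \<le> \<theta>'" using c c0 \<theta> by (simp add: field_simps)
    then show "1 / ?c < \<theta>" using \<theta> by simp
  qed (use \<theta> in simp)
  finally have "(M, M) \<in> {M. recon_constant U (sampling_space \<epsilon> M) < ennreal \<theta>}" by simp
  then have "stable_sampling_rate \<epsilon> U \<theta> \<le> enat (card (sampling_index (M, M)))"
    unfolding stable_sampling_rate_def by (rule INF_lower)
  then show ?thesis by (simp only: card_sampling_index)
qed

theorem theorem4p3:
  fixes p :: nat and \<phi> \<psi> :: "real \<Rightarrow> real" and \<psi>l \<psi>r :: "nat \<Rightarrow> real \<Rightarrow> complex" and \<theta> :: real
  assumes "daubechies_pair p \<phi> \<psi>"
    and "cdv_wavelets p \<phi> \<psi> \<psi>l \<psi>r"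
    and "\<theta> > 1"
  shows
    "(\<exists>S>0. \<forall>\<epsilon> J. 0 < \<epsilon> \<longrightarrow> \<epsilon> \<le> 1 \<longrightarrow> J_0 p \<le> J \<longrightarrow>
        (INF u \<in> {u \<in> recon_space p \<phi> \<psi> \<psi>l \<psi>r J. L2_nrm u = 1}.
           L2_nrm (orth_proj
             (sampling_space \<epsilon> (nat \<lceil>S / \<epsilon>\<rceil> * 2 ^ J, nat \<lceil>S / \<epsilon>\<rceil> * 2 ^ J)) u))
        \<ge> 1 / \<theta>) \<and>
     (\<forall>\<epsilon>. 0 < \<epsilon> \<longrightarrow> \<epsilon> \<le> 1 \<longrightarrow>
        (\<forall>J\<ge>J_0 p. stable_sampling_rate \<epsilon> (recon_space p \<phi> \<psi> \<psi>l \<psi>r J) \<theta> \<noteq> \<infinity>) \<and>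
        (\<lambda>J. real (the_enat (stable_sampling_rate \<epsilon> (recon_space p \<phi> \<psi> \<psi>l \<psi>r J) \<theta>)))
          \<in> O(\<lambda>J. real (recon_dim J)))"
proof (intro conjI allI impI)
  obtain S where S: "0 < S" "\<And>\<epsilon> J K. 0 < \<epsilon> \<Longrightarrow> \<epsilon> \<le> 1 \<Longrightarrow> J_0 p \<le> J \<Longrightarrow> S \<le> \<epsilon> * real K \<Longrightarrow>
      1 / \<theta> \<le> cos_angle (recon_space p \<phi> \<psi> \<psi>l \<psi>r J) (sampling_space \<epsilon> (K * 2 ^ J, K * 2 ^ J))"
    by (rule cos_angle_recon_sampling[OF assms], rule that, assumption+)
  show "\<exists>S>0. \<forall>\<epsilon> J. 0 < \<epsilon> \<longrightarrow> \<epsilon> \<le> 1 \<longrightarrow> J_0 p \<le> J \<longrightarrow>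
        (INF u \<in> {u \<in> recon_space p \<phi> \<psi> \<psi>l \<psi>r J. L2_nrm u = 1}.
           L2_nrm (orth_proj
             (sampling_space \<epsilon> (nat \<lceil>S / \<epsilon>\<rceil> * 2 ^ J, nat \<lceil>S / \<epsilon>\<rceil> * 2 ^ J)) u))
        \<ge> 1 / \<theta>"
  proof (intro exI[of _ S] conjI allI impI S(1))
    fix \<epsilon> :: real and J
    assume e: "0 < \<epsilon>" "\<epsilon> \<le> 1" and J: "J_0 p \<le> J"
    show "(INF u \<in> {u \<in> recon_space p \<phi> \<psi> \<psi>l \<psi>r J. L2_nrm u = 1}.
           L2_nrm (orth_proj
             (sampling_space \<epsilon> (nat \<lceil>S / \<epsilon>\<rceil> * 2 ^ J, nat \<lceil>S / \<epsilon>\<rceil> * 2 ^ J)) u))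
        \<ge> 1 / \<theta>"
      using S(2)[OF e J nat_ceiling_sampling_density(1)[OF S(1) e(1)]] unfolding cos_angle_def .
  qed
next
  fix \<epsilon> :: real assume e: "0 < \<epsilon>" "\<epsilon> \<le> 1"
  let ?R = "recon_space p \<phi> \<psi> \<psi>l \<psi>r"
  \<comment> \<open>Any value strictly between 1 and \<open>\<theta>\<close> would do; the midpoint
    is taken.\<close>
  define \<theta>' where "\<theta>' = (1 + \<theta>) / 2"
  have \<theta>': "1 < \<theta>'" "0 < \<theta>'" "\<theta>' < \<theta>" using assms(3) by (auto simp: \<theta>'_def)
  obtain S where S: "0 < S" "\<And>\<epsilon> J K. 0 < \<epsilon> \<Longrightarrow> \<epsilon> \<le> 1 \<Longrightarrow> J_0 p \<le> J \<Longrightarrow> S \<le> \<epsilon> * real K \<Longrightarrow>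
      1 / \<theta>' \<le> cos_angle (?R J) (sampling_space \<epsilon> (K * 2 ^ J, K * 2 ^ J))"
    by (rule cos_angle_recon_sampling[OF assms(1,2) \<theta>'(1)], rule that, assumption+)
  define K where "K = nat \<lceil>S / \<epsilon>\<rceil>"
  have K: "S \<le> \<epsilon> * real K" "1 \<le> K"
    unfolding K_def by (rule nat_ceiling_sampling_density[OF S(1) e(1)])+
  have le: "stable_sampling_rate \<epsilon> (?R J) \<theta> \<le> enat (9 * K\<^sup>2 * recon_dim J)" if J: "J_0 p \<le> J" for J
  proof -
    have "stable_sampling_rate \<epsilon> (?R J) \<theta> \<le> enat ((2 * (K * 2 ^ J) + 1)\<^sup>2)"
      by (rule stable_sampling_rate_le[OF S(2)[OF e J K(1)] \<theta>'(2,3)])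
    also have "(2 * (K * 2 ^ J) + 1)\<^sup>2 \<le> (3 * (K * 2 ^ J))\<^sup>2"
    proof (rule power_mono)
      \<comment> \<open>With at least one frequency on each side, the additional 1 for the zero
        frequency is absorbed; this is the source of the factor \<open>9 = 3\<^sup>2\<close> in the
        rate.\<close>
      have "1 * 1 \<le> K * 2 ^ J" using K(2) by (intro mult_le_mono) auto
      then show "2 * (K * 2 ^ J) + 1 \<le> 3 * (K * 2 ^ J)" by simp
    qed simp
    also have "(3 * (K * 2 ^ J))\<^sup>2 = 9 * K\<^sup>2 * recon_dim J"
      by (simp add: recon_dim_def power_mult_distrib mult.commute[of J] flip: power_mult)
    finally show ?thesis by simp
  qed
  show "stable_sampling_rate \<epsilon> (?R J) \<theta> \<noteq> \<infinity>" if "J_0 p \<le> J" for J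
    using le[OF that] by (cases "stable_sampling_rate \<epsilon> (?R J) \<theta>") auto
  show "(\<lambda>J. real (the_enat (stable_sampling_rate \<epsilon> (?R J) \<theta>))) \<in> O(\<lambda>J. real (recon_dim J))"
  \<comment> \<open>\<open>K\<close> depends on \<open>\<epsilon>\<close> and on \<open>S\<close>,
    hence on \<open>\<theta>\<close>, but not on \<open>J\<close>, so this is an admissible
    constant.\<close>
  proof (rule bigoI[of _ "real (9 * K\<^sup>2)"], rule eventually_sequentiallyI[of "J_0 p"])
    fix J assume "J_0 p \<le> J"
    from le[OF this] have "the_enat (stable_sampling_rate \<epsilon> (?R J) \<theta>) \<le> 9 * K\<^sup>2 * recon_dim J"
      by (cases "stable_sampling_rate \<epsilon> (?R J) \<theta>") auto
    then have "real (the_enat (stable_sampling_rate \<epsilon> (?R J) \<theta>)) \<le> real (9 * K\<^sup>2 * recon_dim J)"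
      by (rule of_nat_mono)
    then show "norm (real (the_enat (stable_sampling_rate \<epsilon> (?R J) \<theta>))) \<le> real (9 * K\<^sup>2) * norm (real (recon_dim J))"
      by simp
  qed
qed

end
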